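(* Let $\Gamma = (\Gamma, \le, \mu, (\varphi_x)_{x \in V(\Gamma)})$ be a trickle graph, let $\Omega$ be the set of strata of $\Gamma$, and let $\mathcal R = \mathcal R_0\cup\mathcal R_1 \subseteq \Omega^* \times \Omega^*$, where $\mathcal R_0=\{((\emptyset),\epsilon)\}$ and $\mathcal R_1$ is the set of all T-transformations. Then $\mathcal R$ is a rewriting system for the trickle group $\mathrm{Tr}(\Gamma)$ (that is, $\langle \Omega \mid u=v \text{ for } (u,v)\in\mathcal R\rangle^+$ is a monoid presentation of $\mathrm{Tr}(\Gamma)$), and it is terminating and confluent.
   Context: **Trickle graphs.** For a simplicial graph $\Gamma$ (no loops or multiple edges, possibly infinite) with vertex set $V(\Gamma)$ and edge set $E(\Gamma)$, $\mathrm{star}_x(\Gamma)$ is the full subgraph spanned by $x$ and all vertices adjacent to $x$. A trickle graph is a quadruple $(\Gamma,\le,\mu,(\varphi_x)_{x\in V(\Gamma)})$ where $\Gamma$ is a simplicial graph, $\le$ is a partial order on $V(\Gamma)$, $\mu:V(\Gamma)\to\mathbb N_{\ge 2}\cup\{\infty\}$ is a labeling, and each $\varphi_x$ is a graph automorphism of $\mathrm{star}_x(\Gamma)$, such that, writing $x||y$ if $x\not\le y$ and $y\not\le x$, and $E_{||}(\Gamma)=\{\{x,y\}\in E(\Gamma)\mid x||y\}$: (a) if $x<y$ then $\{x,y\}\in E(\Gamma)$; (b) if $\{x,y\}\in E_{||}(\Gamma)$ and $z\le y$, then $\{x,z\}\in E_{||}(\Gamma)$; (c) for all $x$ and all $y,z\in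 \mathrm{star}_x(\Gamma)$: $z\le y$ iff $\varphi_x(z)\le\varphi_x(y)$; (d) for all $x$ and $y\in\mathrm{star}_x(\Gamma)$: if $\varphi_x(y)\ne y$ then $y<x$; (e) if $\mu(x)$ is finite, then $\varphi_x$ has finite order dividing $\mu(x)$; (f) $\mu(\varphi_x(y))=\mu(y)$ for all $x$ and $y\in \mathrm{star}_x(\Gamma)$; (g) if $z<y<x$ then $(\varphi_x\circ\varphi_y)(z)=(\varphi_{y'}\circ\varphi_x)(z)$ where $y'=\varphi_x(y)$. The trickle group is $\mathrm{Tr}(\Gamma)=\langle V(\Gamma)\mid x^{\mu(x)}=1 \text{ if }\mu(x)\ne\infty,\ \varphi_x(y)\,x=\varphi_y(x)\,y\text{ for }\{x,y\}\in E(\Gamma)\rangle$. **Rewriting systems.** $A^*$ is the free monoid on a set $A$, with empty word $\epsilon$. For $R\subseteq A^*\times A^*$ write $w\to w'$ if $w=w_1 u w_2$ and $w'=w_1 v w_2$ with $(u,v)\in R$; $\to^*$ is the reflexive transitive closure. $R$ is terminating if there is no infinite sequence $w_0\to w_1\to\cdots$; it is confluent if whenever $u\to^*v_1$ and $u\to^*v_2$ there is $w$ with $v_1\to^*w$ and $v_2\to^*w$. $R$ is a rewriting system for a monoid (or group viewed as a monoid) $M$ if $\langle A\mid u=v\text{ for }(u,v)\in R\rangle^+$ is a monoid presentation of $M$. **Strata and T-transformations.** $\mathbb Z_\mu=\mathbb Z/\mu\mathbb Z$ if $\mu\neq\infty$ and $\mathbb Z_\infty=\mathbb Z$. Syllables: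 $S(\Gamma)=\{x^a\mid x\in V(\Gamma),a\in\mathbb Z_{\mu(x)}\setminus\{0\}\}$ (formal symbols). A stratum is a finite set $U=\{x_1^{a_1},\dots,x_p^{a_p}\}\subseteq S(\Gamma)$ with $x_i\ne x_j$ and $\{x_i,x_j\}\in E(\Gamma)$ for $i\ne j$; $\mathrm{supp}(U)=\{x_1,\dots,x_p\}$; $\emptyset$ is a stratum. $\Omega$ is the set of strata; elements of $\Omega^*$ are called pilings. - For $x^a\in U$: $L(U,x^a)=U\setminus\{x^a\}$. - For $x_i^{a_i}\in U$, number $U$ so that $x_j>x_k$ implies $j<k$; then $\gamma(U,x_i^{a_i})=\big((\varphi_{x_1}^{a_1}\circ\cdots\circ\varphi_{x_{i-1}}^{a_{i-1}})(x_i)\big)^{a_i}\in S(\Gamma)$ (independent of the numbering). - $y^b\in S(\Gamma)$ can be added to $U$ if $y\in\mathrm{supp}(U)$ or $\{y,x_i\}\in E(\Gamma)$ for all $i$. Then $R(U,y^b)$ is the stratum: $\{\varphi_y^{-b}(x_1)^{a_1},\dots,\varphi_y^{-b}(x_p)^{a_p},y^b\}$ if $y\notin\mathrm{supp}(U)$; if $y=x_i$, it is $\{\varphi_y^{-b}(x_j)^{a_j}\mid j\ne i\}$ when $a_i+b=0$ in $\mathbb Z_{\mu(y)}$, and $\{\varphi_y^{-b}(x_j)^{a_j}\mid j\ne i\}\cup\{y^{a_i+b}\}$ when $a_i+b\neq0$. - A T-transformation is a pair $((U,V),(U',V'))\in\Omega^*\times\Omega^*$ of pilings of length 2 such that for some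 $x^a\in V$: $V'=L(V,x^a)$, $y^a=\gamma(V,x^a)$ can be added to $U$, and $U'=R(U,y^a)$. - $(\emptyset)$ denotes the piling of length 1 whose only entry is the empty stratum. In the presentation of $\mathrm{Tr}(\Gamma)$ on $\Omega$, a stratum $U=\{x_1^{a_1},\dots,x_p^{a_p}\}$, numbered so that $x_i>x_j$ implies $i<j$, represents the element $\omega(U)=x_1^{a_1}\cdots x_p^{a_p}\in\mathrm{Tr}(\Gamma)$ (independent of the numbering), with $\omega(\emptyset)=1$. *)

theory Defs
  imports "HOL-Algebra.Elementary_Groups" "HOL-Algebra.Bij" "HOL-Algebra.Multiplicative_Group" "HOL-Library.Extended_Nat" "HOL-Library.Confluence"
begin

section \<open>Rewriting systems and monoid presentations\<close>

text \<open>
  The free monoid on a set \<open>A\<close> is \<^term>\<open>lists A\<close> with concatenation.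
\<close>

definition rewrite :: "'a set \<Rightarrow> ('a list \<times> 'a list) set \<Rightarrow> 'a list \<Rightarrow> 'a list \<Rightarrow> bool" where
  "rewrite A R w w' \<longleftrightarrow>
     (\<exists>w1 \<in> lists A. \<exists>w2 \<in> lists A. \<exists>u v. (u, v) \<in> R \<and> w = w1 @ u @ w2 \<and> w' = w1 @ v @ w2)"

definition terminatingp :: "('a \<Rightarrow> 'a \<Rightarrow> bool) \<Rightarrow> bool" where
  "terminatingp r \<longleftrightarrow> \<not> (\<exists>f :: nat \<Rightarrow> 'a. \<forall>i. r (f i) (f (Suc i)))"

definition word_cong :: "'a set \<Rightarrow> ('a list \<times> 'a list) set \<Rightarrow> 'a list rel" where
  "word_cong A R = {(u, v). u \<in> lists A \<and> v \<in> lists A \<and> equivclp (rewrite A R) u v}"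

definition presented_monoid :: "'a set \<Rightarrow> ('a list \<times> 'a list) set \<Rightarrow> 'a list set monoid" where
  "presented_monoid A R =
     \<lparr>carrier = lists A // word_cong A R,
      monoid.mult = (\<lambda>X Y. word_cong A R `` {u @ v | u v. u \<in> X \<and> v \<in> Y}),
      one = word_cong A R `` {[]}\<rparr>"

text \<open>
  \<open>M\<close> has the monoid presentation with generating set \<open>A\<close> and defining relations \<open>R\<close>, where
  the generator \<open>a \<in> A\<close> stands for the element \<open>f a\<close> of \<open>M\<close>.
\<close>

definition has_monoid_presentation ::
  "('m, 'b) monoid_scheme \<Rightarrow> 'a set \<Rightarrow> ('a \<Rightarrow> 'm) \<Rightarrow> ('a list \<times> 'a list) set \<Rightarrow> bool" where
  "has_monoid_presentation M A f R \<longleftrightarrow>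
     R \<subseteq> lists A \<times> lists A \<and>
     (\<exists>h \<in> iso (presented_monoid A R) M. \<forall>a \<in> A. h (word_cong A R `` {[a]}) = f a)"


section \<open>Group presentations\<close>

datatype 'a signed = Gen 'a | Inv 'a

definition signed_letters :: "'a set \<Rightarrow> 'a signed set" where
  "signed_letters X = Gen ` X \<union> Inv ` X"

definition cancel_rels :: "'a set \<Rightarrow> ('a signed list \<times> 'a signed list) set" where
  "cancel_rels X = {([Gen x, Inv x], []) | x. x \<in> X} \<union> {([Inv x, Gen x], []) | x. x \<in> X}"

definition presented_group ::
  "'a set \<Rightarrow> ('a signed list \<times> 'a signed list) set \<Rightarrow> 'a signed list set monoid" where
  "presented_group X R = presented_monoid (signed_letters X) (R \<union> cancel_rels X)"

lemma equivclp_map: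
  assumes "equivclp r x y" and "\<And>x y. r x y \<Longrightarrow> r' (f x) (f y)"
  shows "equivclp r' (f x) (f y)"
  using assms(1)
proof (induction rule: equivclp_induct)
  case base show ?case by (simp add: equivclp_def)
next
  case (step y z)
  then have "equivclp r' (f y) (f z)"
    using assms(2) by (metis equivclp_sym r_into_equivclp)
  with step show ?case by (meson equivclp_trans)
qed

lemma equiv_word_cong: "equiv (lists A) (word_cong A R)"
proof (rule equivI)
  show "word_cong A R \<subseteq> lists A \<times> lists A" by (auto simp: word_cong_def)
  show "refl_on (lists A) (word_cong A R)"
    by (rule refl_onI) (simp add: word_cong_def)
  show "sym (word_cong A R)"
    by (rule symI) (simp add: word_cong_def equivclp_sym)
  show "trans (word_cong A R)"
    by (rule transI) (auto simp: word_cong_def elim: equivclp_trans)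
qed

lemma word_cong_append:
  assumes "(u, u') \<in> word_cong A R" "(v, v') \<in> word_cong A R"
  shows "(u @ v, u' @ v') \<in> word_cong A R"
proof -
  have l: "u \<in> lists A" "u' \<in> lists A" "v \<in> lists A" "v' \<in> lists A"
    using assms by (auto simp: word_cong_def)
  have a: "rewrite A R (x @ v) (y @ v)" if r: "rewrite A R x y" for x y
  proof -
    obtain w1 w2 p q where "w1 \<in> lists A" "w2 \<in> lists A" "(p, q) \<in> R"
      and "x = w1 @ p @ w2" "y = w1 @ q @ w2"
      using r unfolding rewrite_def by blast
    then show ?thesis
      unfolding rewrite_def using l(3)
      by (intro bexI[of _ w1] bexI[of _ "w2 @ v"] exI[of _ p] exI[of _ q]) simp_all
  qed
  have b: "rewrite A R (u' @ x) (u' @ y)" if r: "rewrite A R x y" for x y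
  proof -
    obtain w1 w2 p q where "w1 \<in> lists A" "w2 \<in> lists A" "(p, q) \<in> R"
      and "x = w1 @ p @ w2" "y = w1 @ q @ w2"
      using r unfolding rewrite_def by blast
    then show ?thesis
      unfolding rewrite_def using l(2)
      by (intro bexI[of _ "u' @ w1"] bexI[of _ w2] exI[of _ p] exI[of _ q]) simp_all
  qed
  have "equivclp (rewrite A R) u u'" "equivclp (rewrite A R) v v'"
    using assms by (simp_all add: word_cong_def)
  then have "equivclp (rewrite A R) (u @ v) (u' @ v)"
    and "equivclp (rewrite A R) (u' @ v) (u' @ v')"
    by - (erule equivclp_map[where f = "\<lambda>x. x @ v"], erule a,
        erule equivclp_map[where f = "\<lambda>x. u' @ x"], erule b)
  then have "equivclp (rewrite A R) (u @ v) (u' @ v')"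
    by (rule equivclp_trans)
  with l show ?thesis by (simp add: word_cong_def)
qed

lemma presented_monoid_mult:
  assumes "u \<in> lists A" "v \<in> lists A"
  shows "word_cong A R `` {u} \<otimes>\<^bsub>presented_monoid A R\<^esub> word_cong A R `` {v} = word_cong A R `` {u @ v}"
proof -
  note e = equiv_word_cong[of A R]
  have "word_cong A R `` {p @ q | p q. p \<in> word_cong A R `` {u} \<and> q \<in> word_cong A R `` {v}} = word_cong A R `` {u @ v}"
    (is "?L = ?R")
  proof
    show "?L \<subseteq> ?R"
    proof
      fix w assume "w \<in> ?L"
      then obtain p q where "(p @ q, w) \<in> word_cong A R" "(u,p) \<in> word_cong A R" "(v,q) \<in> word_cong A R" by auto
      moreover from this have "(u @ v, p @ q) \<in> word_cong A R" by (intro word_cong_append)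
      ultimately have "(u @ v, w) \<in> word_cong A R" using e by (auto elim!: equivE dest: transD)
      then show "w \<in> ?R" by simp
    qed
    have "u @ v \<in> {p @ q | p q. p \<in> word_cong A R `` {u} \<and> q \<in> word_cong A R `` {v}}"
      using equiv_class_self[OF e assms(1)] equiv_class_self[OF e assms(2)] by blast
    then show "?R \<subseteq> ?L" by blast
  qed
  then show ?thesis by (simp add: presented_monoid_def)
qed

lemma presented_monoid_carrierE:
  assumes "X \<in> carrier (presented_monoid A R)"
  obtains u where "u \<in> lists A" "X = word_cong A R `` {u}"
  using assms by (auto simp: presented_monoid_def elim!: quotientE)

lemma monoid_presented_monoid: "monoid (presented_monoid A R)"
proof -
  have closed: "word_cong A R `` {u} \<in> carrier (presented_monoid A R)" if "u \<in> lists A" for u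
    using that by (auto simp: presented_monoid_def intro: quotientI)
  have one: "\<one>\<^bsub>presented_monoid A R\<^esub> = word_cong A R `` {[]}"
    by (simp add: presented_monoid_def)
  show ?thesis
  proof (rule monoidI)
    fix x y assume "x \<in> carrier (presented_monoid A R)" "y \<in> carrier (presented_monoid A R)"
    then obtain u v where "u \<in> lists A" "v \<in> lists A"
      and "x = word_cong A R `` {u}" "y = word_cong A R `` {v}"
      by (meson presented_monoid_carrierE)
    then show "x \<otimes>\<^bsub>presented_monoid A R\<^esub> y \<in> carrier (presented_monoid A R)"
      by (simp add: presented_monoid_mult closed)
  next
    show "\<one>\<^bsub>presented_monoid A R\<^esub> \<in> carrier (presented_monoid A R)"
      unfolding one by (rule closed) simp
  next
    fix x y z
    assume "x \<in> carrier (presented_monoid A R)" "y \<in> carrier (presented_monoid A R)"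
      "z \<in> carrier (presented_monoid A R)"
    then obtain u v w where "u \<in> lists A" "v \<in> lists A" "w \<in> lists A"
      and "x = word_cong A R `` {u}" "y = word_cong A R `` {v}" "z = word_cong A R `` {w}"
      by (meson presented_monoid_carrierE)
    then show "x \<otimes>\<^bsub>presented_monoid A R\<^esub> y \<otimes>\<^bsub>presented_monoid A R\<^esub> z =
        x \<otimes>\<^bsub>presented_monoid A R\<^esub> (y \<otimes>\<^bsub>presented_monoid A R\<^esub> z)"
      by (simp add: presented_monoid_mult)
  next
    fix x assume "x \<in> carrier (presented_monoid A R)"
    then obtain u where u: "u \<in> lists A" "x = word_cong A R `` {u}"
      by (meson presented_monoid_carrierE)
    show "\<one>\<^bsub>presented_monoid A R\<^esub> \<otimes>\<^bsub>presented_monoid A R\<^esub> x = x"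
      using presented_monoid_mult[of "[]" A u R] u by (simp add: one)
    show "x \<otimes>\<^bsub>presented_monoid A R\<^esub> \<one>\<^bsub>presented_monoid A R\<^esub> = x"
      using presented_monoid_mult[of u A "[]" R] u by (simp add: one)
  qed
qed

lemma group_presented_group: "group (presented_group S R)"
proof -
  let ?A = "signed_letters S" and ?R = "R \<union> cancel_rels S"
  let ?M = "presented_monoid ?A ?R"
  interpret M: monoid ?M by (rule monoid_presented_monoid)
  have o: "one ?M = word_cong ?A ?R `` {[]}" by (simp add: presented_monoid_def)
  have inC: "word_cong ?A ?R `` {u} \<in> carrier ?M" if "u \<in> lists ?A" for u
    using that by (auto simp: presented_monoid_def intro: quotientI)
  have can: "word_cong ?A ?R `` {[a]} \<otimes>\<^bsub>?M\<^esub> word_cong ?A ?R `` {[b]} = \<one>\<^bsub>?M\<^esub>"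
    if "([a,b],[]) \<in> cancel_rels S" for a b
  proof -
    have ab: "a \<in> ?A" "b \<in> ?A" using that by (auto simp: cancel_rels_def signed_letters_def)
    have "rewrite ?A ?R [a,b] []" unfolding rewrite_def using that by (intro bexI[of _ "[]"]) auto
    then have "([a,b],[]) \<in> word_cong ?A ?R" using ab by (auto simp: word_cong_def)
    then have "word_cong ?A ?R `` {[a,b]} = word_cong ?A ?R `` {[]}" by (rule equiv_class_eq[OF equiv_word_cong])
    then show ?thesis using ab by (simp add: o presented_monoid_mult)
  qed
  have U: "word_cong ?A ?R `` {u} \<in> Units ?M" if "u \<in> lists ?A" for u
    using that
  proof (induction u)
    case Nil show ?case using M.Units_one_closed by (simp add: o)
  next
    case (Cons a u)
    have "\<exists>b\<in>?A. ([a,b],[]) \<in> cancel_rels S \<and> ([b,a],[]) \<in> cancel_rels S"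
      using Cons.hyps by (auto simp: signed_letters_def cancel_rels_def)
    then obtain b where b: "b \<in> ?A" "([a,b],[]) \<in> cancel_rels S" "([b,a],[]) \<in> cancel_rels S" by blast
    have "word_cong ?A ?R `` {[a]} \<in> Units ?M"
    proof -
      have "word_cong ?A ?R `` {[b]} \<in> carrier ?M" using b(1) by (intro inC) simp
      moreover have "word_cong ?A ?R `` {[a]} \<in> carrier ?M" using Cons.hyps by (intro inC) simp
      ultimately show ?thesis unfolding Units_def using can[OF b(2)] can[OF b(3)] by blast
    qed
    from M.Units_m_closed[OF this Cons.IH] Cons show ?case
      by (simp add: presented_monoid_mult)
  qed
  have "carrier ?M \<subseteq> Units ?M"
  proof
    fix x assume "x \<in> carrier ?M"
    then obtain u where "u \<in> lists ?A" "x = word_cong ?A ?R `` {u}"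
      by (rule presented_monoid_carrierE)
    with U show "x \<in> Units ?M" by blast
  qed
  then have "group ?M" by unfold_locales
  then show ?thesis by (simp add: presented_group_def)
qed


section \<open>Trickle graphs\<close>

text \<open>
  Edges are two-element sets of vertices. The label \<open>\<infinity>\<close> is that of \<^typ>\<open>enat\<close>.
\<close>

record 'v trickle_data =
  verts :: "'v set"
  edges :: "'v set set"
  le_rel :: "'v rel"
  mu :: "'v \<Rightarrow> enat"
  phi :: "'v \<Rightarrow> 'v \<Rightarrow> 'v"

definition star :: "('v, 'b) trickle_data_scheme \<Rightarrow> 'v \<Rightarrow> 'v set" where
  "star G x = insert x {y \<in> verts G. {x, y} \<in> edges G}"

definition lt :: "('v, 'b) trickle_data_scheme \<Rightarrow> 'v \<Rightarrow> 'v \<Rightarrow> bool" where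
  "lt G x y \<longleftrightarrow> (x, y) \<in> le_rel G \<and> x \<noteq> y"

definition par_edges :: "('v, 'b) trickle_data_scheme \<Rightarrow> 'v set set" where
  "par_edges G = {{x, y} | x y. {x, y} \<in> edges G \<and> (x, y) \<notin> le_rel G \<and> (y, x) \<notin> le_rel G}"

text \<open>
  Automorphisms of the full subgraph spanned by the star of \<open>x\<close>, as elements of
  \<^term>\<open>BijGroup (star G x)\<close>: they are \<^const>\<open>undefined\<close> outside the star.
\<close>

definition star_auts :: "('v, 'b) trickle_data_scheme \<Rightarrow> 'v \<Rightarrow> ('v \<Rightarrow> 'v) set" where
  "star_auts G x =
     {f \<in> carrier (BijGroup (star G x)).
        \<forall>y \<in> star G x. \<forall>z \<in> star G x. {y, z} \<in> edges G \<longleftrightarrow> {f y, f z} \<in> edges G}"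

text \<open>
  In \<open>phi_order\<close>, the order \<^term>\<open>group.ord\<close> of an element of infinite order is \<open>0\<close>.
\<close>

locale trickle_graph =
  fixes G :: "('v, 'b) trickle_data_scheme" (structure)
  assumes simplicial: "edges G \<subseteq> {{x, y} | x y. x \<in> verts G \<and> y \<in> verts G \<and> x \<noteq> y}"
    and partial_order: "partial_order_on (verts G) (le_rel G)"
    and mu_ge_2: "x \<in> verts G \<Longrightarrow> 2 \<le> mu G x"
    and phi_aut: "x \<in> verts G \<Longrightarrow> phi G x \<in> star_auts G x"
    and lt_edge: "lt G x y \<Longrightarrow> {x, y} \<in> edges G"
    and par_edge_down: "{x, y} \<in> par_edges G \<Longrightarrow> (z, y) \<in> le_rel G \<Longrightarrow> {x, z} \<in> par_edges G"
    and phi_le_iff: "x \<in> verts G \<Longrightarrow> y \<in> star G x \<Longrightarrow> z \<in> star G x \<Longrightarrow>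
      (z, y) \<in> le_rel G \<longleftrightarrow> (phi G x z, phi G x y) \<in> le_rel G"
    and phi_moves: "x \<in> verts G \<Longrightarrow> y \<in> star G x \<Longrightarrow> phi G x y \<noteq> y \<Longrightarrow> lt G y x"
    and phi_order: "x \<in> verts G \<Longrightarrow> mu G x = enat m \<Longrightarrow>
      0 < group.ord (BijGroup (star G x)) (phi G x) \<and>
      group.ord (BijGroup (star G x)) (phi G x) dvd m"
    and mu_phi: "x \<in> verts G \<Longrightarrow> y \<in> star G x \<Longrightarrow> mu G (phi G x y) = mu G y"
    and phi_phi: "lt G z y \<Longrightarrow> lt G y x \<Longrightarrow>
      phi G x (phi G y z) = phi G (phi G x y) (phi G x z)"


section \<open>Trickle groups\<close>

definition trickle_rels ::
  "('v, 'b) trickle_data_scheme \<Rightarrow> ('v signed list \<times> 'v signed list) set" where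
  "trickle_rels G =
     {(replicate m (Gen x), []) | x m. x \<in> verts G \<and> mu G x = enat m} \<union>
     {([Gen (phi G x y), Gen x], [Gen (phi G y x), Gen y]) | x y. {x, y} \<in> edges G}"

definition trickle_group :: "('v, 'b) trickle_data_scheme \<Rightarrow> 'v signed list set monoid" where
  "trickle_group G = presented_group (verts G) (trickle_rels G)"

lemma group_trickle_group: "group (trickle_group G)"
  unfolding trickle_group_def by (rule group_presented_group)

definition trickle_gen :: "('v, 'b) trickle_data_scheme \<Rightarrow> 'v \<Rightarrow> 'v signed list set" where
  "trickle_gen G x =
     word_cong (signed_letters (verts G)) (trickle_rels G \<union> cancel_rels (verts G)) `` {[Gen x]}"


section \<open>Strata and pilings\<close>

text \<open>
  The group of integers modulo \<open>m\<close> has the representatives \<open>0, \<dots>, m - 1\<close> as its elements,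
  so an exponent is always an integer.
\<close>

definition Zmu :: "enat \<Rightarrow> int monoid" where
  "Zmu k = (case k of enat m \<Rightarrow> integer_mod_group m | \<infinity> \<Rightarrow> integer_group)"

type_synonym 'v syllable = "'v \<times> int"
type_synonym 'v stratum = "'v syllable set"
type_synonym 'v piling = "'v stratum list"

definition syllables :: "('v, 'b) trickle_data_scheme \<Rightarrow> 'v syllable set" where
  "syllables G = {(x, a). x \<in> verts G \<and> a \<in> carrier (Zmu (mu G x)) - {\<one>\<^bsub>Zmu (mu G x)\<^esub>}}"

definition supp :: "'v stratum \<Rightarrow> 'v set" where
  "supp U = fst ` U"

definition strata :: "('v, 'b) trickle_data_scheme \<Rightarrow> 'v stratum set" where
  "strata G = {U. finite U \<and> U \<subseteq> syllables G \<and>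
     (\<forall>s \<in> U. \<forall>t \<in> U. s \<noteq> t \<longrightarrow> fst s \<noteq> fst t \<and> {fst s, fst t} \<in> edges G)}"

definition phi_pow :: "('v, 'b) trickle_data_scheme \<Rightarrow> 'v \<Rightarrow> int \<Rightarrow> 'v \<Rightarrow> 'v" where
  "phi_pow G x a = phi G x [^]\<^bsub>BijGroup (star G x)\<^esub> a"

text \<open>
  The numberings of \<open>U\<close> in which larger vertices come first. Neither \<open>gamma\<close> nor \<open>omega\<close>
  below depends on which of them is chosen.
\<close>

definition numbering ::
  "('v, 'b) trickle_data_scheme \<Rightarrow> 'v stratum \<Rightarrow> 'v syllable list \<Rightarrow> bool" where
  "numbering G U us \<longleftrightarrow> distinct us \<and> set us = U \<and>
     (\<forall>j < length us. \<forall>k < length us. lt G (fst (us ! k)) (fst (us ! j)) \<longrightarrow> j < k)"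

definition gamma :: "('v, 'b) trickle_data_scheme \<Rightarrow> 'v stratum \<Rightarrow> 'v syllable \<Rightarrow> 'v syllable" where
  "gamma G U s =
     (foldr (\<lambda>(x, a). phi_pow G x a) (takeWhile (\<lambda>t. t \<noteq> s) (SOME us. numbering G U us)) (fst s),
      snd s)"

definition omega :: "('v, 'b) trickle_data_scheme \<Rightarrow> 'v stratum \<Rightarrow> 'v signed list set" where
  "omega G U =
     foldr (\<lambda>(x, a) g. (trickle_gen G x [^]\<^bsub>trickle_group G\<^esub> a) \<otimes>\<^bsub>trickle_group G\<^esub> g)
       (SOME us. numbering G U us) \<one>\<^bsub>trickle_group G\<^esub>"

definition remove_syll :: "'v stratum \<Rightarrow> 'v syllable \<Rightarrow> 'v stratum" where
  "remove_syll U s = U - {s}"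

definition can_add :: "('v, 'b) trickle_data_scheme \<Rightarrow> 'v stratum \<Rightarrow> 'v syllable \<Rightarrow> bool" where
  "can_add G U s \<longleftrightarrow> fst s \<in> supp U \<or> (\<forall>x \<in> supp U. {fst s, x} \<in> edges G)"

definition add_syll ::
  "('v, 'b) trickle_data_scheme \<Rightarrow> 'v stratum \<Rightarrow> 'v syllable \<Rightarrow> 'v stratum" where
  "add_syll G U = (\<lambda>(y, b).
     let W = {(phi_pow G y (- b) x, a) | x a. (x, a) \<in> U \<and> x \<noteq> y} in
     if y \<notin> supp U then W \<union> {(y, b)}
     else let c = (THE a. (y, a) \<in> U) \<otimes>\<^bsub>Zmu (mu G y)\<^esub> b in
       if c = \<one>\<^bsub>Zmu (mu G y)\<^esub> then W else W \<union> {(y, c)})"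


section \<open>The rewriting system\<close>

definition R0 :: "('v piling \<times> 'v piling) set" where
  "R0 = {([{}], [])}"

definition T_transformations :: "('v, 'b) trickle_data_scheme \<Rightarrow> ('v piling \<times> 'v piling) set" where
  "T_transformations G =
     {([U, V], [U', V']) | U V U' V'. U \<in> strata G \<and> V \<in> strata G \<and>
        (\<exists>s \<in> V. V' = remove_syll V s \<and> can_add G U (gamma G V s) \<and>
           U' = add_syll G U (gamma G V s))}"

definition trickle_rewriting :: "('v, 'b) trickle_data_scheme \<Rightarrow> ('v piling \<times> 'v piling) set" where
  "trickle_rewriting G = R0 \<union> T_transformations G"

end

theory Submission
  imports Defs
begin

text \<open>
  Write \<open>\<Phi>\<^sub>U\<close> for the permutation of the vertices obtained by letting the syllables \<open>x\<^sup>a\<close> of a stratum \<open>U\<close>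
  act by \<open>phi G x\<close> to the power \<open>a\<close>, the largest vertex acting last. The whole proof rests on reading
  a stratum in two ways. In \<open>U\<close> itself each syllable bears the name that it has when it is commuted to
  the right end of the product \<open>omega G U\<close>; commuted to the left end it becomes \<open>\<Phi>\<^sub>U x\<close> with the same
  exponent, and this is \<open>gamma\<close> (\<open>gamma_eq\<close>). Removing a syllable of \<open>U\<close> hence splits off a left
  factor (\<open>stratum_prod_gamma\<close>), and adding one multiplies on the right (\<open>stratum_prod_add_syll\<close>). Both
  statements are proved for every assignment of group elements to syllables that satisfies the
  relations of the trickle group. In the trickle group they say that T-transformations preserve the
  product of a piling; in the symmetric group of the vertices they say how \<open>\<Phi>\<^sub>U\<close> changes.

  Termination holds because syllables only move to the left. For confluence it then suffices, by
  Newman's lemma, to join the critical pairs. Two syllables of one stratum moved in either order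
  rename each other, and the results agree by the relation \<open>act_act\<close> (\<open>joinable_same_stratum\<close>). A syllable
  leaving the middle one of three strata does not interfere with one entering it, except when the two
  merge, and then the exponents just add up (\<open>joinable_overlap\<close>). Deleting an empty stratum and moving
  something into it is repaired by moving the rest of the right neighbour too (\<open>joinable_empty\<close>).

  For the presentation, \<open>omega\<close> induces a homomorphism from the monoid presented by the rewriting system
  to the trickle group. A homomorphism in the other direction sends the generator \<open>x\<close> to the class of
  the stratum with the only syllable \<open>x\<^sup>1\<close>; the edge relation holds because both of its sides are
  obtained by pulling apart the stratum with the syllables \<open>x\<^sup>1\<close> and \<open>y\<^sup>1\<close>. As every stratum can be pulled
  apart into single syllables (\<open>piling_class_prod\<close>), the two homomorphisms are inverse to each other.
\<close>

section \<open>Rewriting and monoid presentations\<close>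

lemma newman:
  assumes "terminatingp r"
    and local_confluence: "\<And>x y z. r x y \<Longrightarrow> r x z \<Longrightarrow> \<exists>u. r\<^sup>*\<^sup>* y u \<and> r\<^sup>*\<^sup>* z u"
  shows "confluentp r"
proof -
  have "wfp (\<lambda>x y. r y x)"
    using assms(1) unfolding wfp_def wf_iff_no_infinite_down_chain terminatingp_def by simp
  then have "\<exists>u. r\<^sup>*\<^sup>* y u \<and> r\<^sup>*\<^sup>* z u" if "r\<^sup>*\<^sup>* x y" "r\<^sup>*\<^sup>* x z" for x y z
    using that
  proof (induction x arbitrary: y z rule: wfp_induct_rule)
    case (less x)
    show ?case
    proof (cases "x = y \<or> x = z")
      case True
      with less.prems show ?thesis by blast
    next
      case False
      then obtain y1 z1 where y1: "r x y1" "r\<^sup>*\<^sup>* y1 y" and z1: "r x z1" "r\<^sup>*\<^sup>* z1 z"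
        using less.prems by (metis converse_rtranclpE)
      obtain u where u: "r\<^sup>*\<^sup>* y1 u" "r\<^sup>*\<^sup>* z1 u"
        using local_confluence[OF y1(1) z1(1)] by blast
      obtain v where v: "r\<^sup>*\<^sup>* y v" "r\<^sup>*\<^sup>* u v"
        using less.IH[OF y1(1) y1(2) u(1)] by blast
      obtain w where "r\<^sup>*\<^sup>* v w" "r\<^sup>*\<^sup>* z w"
        using less.IH[OF z1(1) rtranclp_trans[OF u(2) v(2)] z1(2)] by blast
      with v show ?thesis by (meson rtranclp_trans)
    qed
  qed
  then show ?thesis by (rule confluentpI)
qed

lemma rewrite_context:
  assumes "rewrite A R u v" "w1 \<in> lists A" "w2 \<in> lists A"
  shows "rewrite A R (w1 @ u @ w2) (w1 @ v @ w2)"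
proof -
  obtain p q s t where "p \<in> lists A" "q \<in> lists A" "(s, t) \<in> R" "u = p @ s @ q" "v = p @ t @ q"
    using assms(1) unfolding rewrite_def by blast
  then show ?thesis
    unfolding rewrite_def using assms(2,3)
    by (intro bexI[of _ "w1 @ p"] bexI[of _ "q @ w2"] exI[of _ s] exI[of _ t]) simp_all
qed

lemma rtranclp_rewrite_context:
  assumes "(rewrite A R)\<^sup>*\<^sup>* u v" "w1 \<in> lists A" "w2 \<in> lists A"
  shows "(rewrite A R)\<^sup>*\<^sup>* (w1 @ u @ w2) (w1 @ v @ w2)"
  using assms(1)
proof (induction rule: rtranclp_induct)
  case (step y z)
  then show ?case using rewrite_context[OF step(2) assms(2,3)] by (meson rtranclp.rtrancl_into_rtrancl)
qed simp

lemma rewrite_rule: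
  assumes "(u, v) \<in> R"
  shows "rewrite A R u v"
  unfolding rewrite_def using assms by (intro bexI[of _ "[]"] exI[of _ u] exI[of _ v]) auto

definition eval_word :: "('m, 'b) monoid_scheme \<Rightarrow> ('a \<Rightarrow> 'm) \<Rightarrow> 'a list \<Rightarrow> 'm" where
  "eval_word M f w = foldr (\<lambda>a m. f a \<otimes>\<^bsub>M\<^esub> m) w \<one>\<^bsub>M\<^esub>"

lemma eval_word_Nil [simp]: "eval_word M f [] = \<one>\<^bsub>M\<^esub>"
  and eval_word_Cons [simp]: "eval_word M f (a # w) = f a \<otimes>\<^bsub>M\<^esub> eval_word M f w"
  by (simp_all add: eval_word_def)

lemma eval_word_cong:
  "(\<And>a. a \<in> set w \<Longrightarrow> f a = f' a) \<Longrightarrow> eval_word M f w = eval_word M f' w"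
  by (induction w) auto

lemma (in monoid) eval_word_closed:
  "f \<in> set w \<rightarrow> carrier G \<Longrightarrow> eval_word G f w \<in> carrier G"
  by (induction w) auto

lemma (in monoid) eval_word_append:
  "f \<in> set u \<union> set v \<rightarrow> carrier G \<Longrightarrow> eval_word G f (u @ v) = eval_word G f u \<otimes> eval_word G f v"
proof (induction u)
  case Nil
  then show ?case using eval_word_closed[of f v] by simp
next
  case (Cons a u)
  then show ?case using eval_word_closed[of f v] eval_word_closed[of f u] by (auto simp: m_assoc)
qed

lemma (in monoid) eval_word_replicate:
  "f a \<in> carrier G \<Longrightarrow> eval_word G f (replicate n a) = f a [^] n"
  by (induction n) (auto simp: nat_pow_comm[of "f a" 1, simplified])

lemma hom_eval_word:
  assumes "monoid M" "h \<in> hom M N" "h \<one>\<^bsub>M\<^esub> = \<one>\<^bsub>N\<^esub>" "f \<in> set w \<rightarrow> carrier M"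
  shows "h (eval_word M f w) = eval_word N (\<lambda>a. h (f a)) w"
  using assms(4)
proof (induction w)
  case (Cons a w)
  then have "f a \<in> carrier M" "eval_word M f w \<in> carrier M"
    by (auto intro: monoid.eval_word_closed[OF assms(1)])
  with Cons show ?case by (simp add: hom_mult[OF assms(2)])
qed (simp add: assms)

lemma presented_monoid_one: "\<one>\<^bsub>presented_monoid A R\<^esub> = word_cong A R `` {[]}"
  by (simp add: presented_monoid_def)

lemma presented_monoid_class_closed:
  "w \<in> lists A \<Longrightarrow> word_cong A R `` {w} \<in> carrier (presented_monoid A R)"
  by (auto simp: presented_monoid_def intro: quotientI)

lemma eval_word_class:
  assumes "w \<in> lists A"
  shows "eval_word (presented_monoid A R) (\<lambda>a. word_cong A R `` {[a]}) w = word_cong A R `` {w}"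
  using assms
proof (induction w)
  case (Cons a w)
  then show ?case using presented_monoid_mult[of "[a]" A w R] by simp
qed (simp add: presented_monoid_one)

lemma word_cong_class_eqI:
  assumes "(rewrite A R)\<^sup>*\<^sup>* u v" "u \<in> lists A" "v \<in> lists A"
  shows "word_cong A R `` {u} = word_cong A R `` {v}"
proof -
  have "equivclp (rewrite A R) u v"
    using assms(1) rtranlcp_le_equivclp[of "rewrite A R"] by auto
  then show ?thesis
    using assms by (intro equiv_class_eq[OF equiv_word_cong]) (simp add: word_cong_def)
qed

text \<open>
  The universal property of a presentation. Evaluation of words is multiplicative, so it is constant
  along rewriting steps and descends to the classes.
\<close>

lemma presented_monoid_universal:
  assumes M: "monoid M" and f: "f \<in> A \<rightarrow> carrier M" and R: "R \<subseteq> lists A \<times> lists A"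
    and rel: "\<And>u v. (u, v) \<in> R \<Longrightarrow> eval_word M f u = eval_word M f v"
  obtains h where "h \<in> hom (presented_monoid A R) M"
    and "h \<one>\<^bsub>presented_monoid A R\<^esub> = \<one>\<^bsub>M\<^esub>"
    and "\<And>w. w \<in> lists A \<Longrightarrow> h (word_cong A R `` {w}) = eval_word M f w"
proof -
  interpret M: monoid M by (rule M)
  have fl: "f \<in> set w \<rightarrow> carrier M" if "w \<in> lists A" for w
    using that f by auto
  have app: "eval_word M f (u @ v) = eval_word M f u \<otimes>\<^bsub>M\<^esub> eval_word M f v"
    if "u \<in> lists A" "v \<in> lists A" for u v
    using M.eval_word_append[of f u v] fl[of "u @ v"] that by simp
  have step: "eval_word M f u = eval_word M f v" if "rewrite A R u v" for u v
  proof -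
    obtain w1 w2 s t where st: "w1 \<in> lists A" "w2 \<in> lists A" "(s, t) \<in> R"
      "u = w1 @ s @ w2" "v = w1 @ t @ w2"
      using \<open>rewrite A R u v\<close> unfolding rewrite_def by blast
    moreover have "s \<in> lists A" "t \<in> lists A" using st R by auto
    ultimately show ?thesis by (simp add: app rel[OF st(3)])
  qed
  have cong: "eval_word M f u = eval_word M f v" if "(u, v) \<in> word_cong A R" for u v
  proof -
    have "equivclp (rewrite A R) u v" using that by (simp add: word_cong_def)
    then show ?thesis
      by (induction rule: equivclp_induct) (auto dest: step)
  qed
  define h where "h X = eval_word M f (SOME w. w \<in> X)" for X
  have h: "h (word_cong A R `` {w}) = eval_word M f w" if "w \<in> lists A" for w
  proof -
    have "(SOME v. v \<in> word_cong A R `` {w}) \<in> word_cong A R `` {w}"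
      using equiv_class_self[OF equiv_word_cong that, of R] by (rule someI)
    then show ?thesis unfolding h_def by (intro cong[symmetric]) simp
  qed
  have "h \<in> hom (presented_monoid A R) M"
  proof (rule homI)
    fix X assume "X \<in> carrier (presented_monoid A R)"
    then obtain u where "u \<in> lists A" "X = word_cong A R `` {u}"
      by (rule presented_monoid_carrierE)
    then show "h X \<in> carrier M" using M.eval_word_closed[OF fl] by (simp add: h)
  next
    fix X Y assume "X \<in> carrier (presented_monoid A R)" "Y \<in> carrier (presented_monoid A R)"
    then obtain u v where "u \<in> lists A" "v \<in> lists A"
      "X = word_cong A R `` {u}" "Y = word_cong A R `` {v}"
      by (meson presented_monoid_carrierE)
    then show "h (X \<otimes>\<^bsub>presented_monoid A R\<^esub> Y) = h X \<otimes>\<^bsub>M\<^esub> h Y"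
      by (simp add: presented_monoid_mult h app)
  qed
  moreover have "h \<one>\<^bsub>presented_monoid A R\<^esub> = \<one>\<^bsub>M\<^esub>"
    by (simp add: presented_monoid_one h)
  ultimately show thesis using that h by blast
qed

text \<open>
  The first factor of one product can be commuted to the front of the other one: by the ordering of
  both lists, it is incomparable with all factors that precede it there.
\<close>

lemma (in monoid) eval_word_sorted_unique:
  fixes prec :: "'c \<Rightarrow> 'c \<Rightarrow> bool"
  assumes "distinct us" "distinct vs" "set us = set vs"
    and "sorted_wrt (\<lambda>s t. \<not> prec s t) us" "sorted_wrt (\<lambda>s t. \<not> prec s t) vs"
    and "f \<in> set us \<rightarrow> carrier G"
    and "\<And>s t. s \<in> set us \<Longrightarrow> t \<in> set us \<Longrightarrow> \<not> prec s t \<Longrightarrow> \<not> prec t s \<Longrightarrow> f s \<otimes> f t = f t \<otimes> f s"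
  shows "eval_word G f us = eval_word G f vs"
  using assms
proof (induction us arbitrary: vs)
  case (Cons s us)
  obtain v1 v2 where v: "vs = v1 @ s # v2" using Cons.prems(3) by (metis list.set_intros(1) split_list)
  have sub: "set (v1 @ v2) = set us" using Cons.prems(1-3) v by auto
  have cl: "f s \<in> carrier G" "f \<in> set v1 \<rightarrow> carrier G" "f \<in> set v2 \<rightarrow> carrier G"
    using Cons.prems(6) sub by auto
  have com: "f t \<otimes> f s = f s \<otimes> f t" if "t \<in> set v1" for t
  proof -
    have "t \<in> set us" using that sub by auto
    then show ?thesis using Cons.prems(4,5,7) that v by (auto simp: sorted_wrt_append)
  qed
  have "f \<in> set w \<rightarrow> carrier G \<Longrightarrow> (\<And>t. t \<in> set w \<Longrightarrow> f t \<otimes> f s = f s \<otimes> f t) \<Longrightarrow>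
    eval_word G f w \<otimes> f s = f s \<otimes> eval_word G f w" for w
  proof (induction w)
    case (Cons t w)
    then have "f t \<in> carrier G" "eval_word G f w \<in> carrier G" using eval_word_closed[of f w] by auto
    then show ?case using Cons cl(1) by simp (metis m_assoc)
  qed (simp add: cl)
  then have "eval_word G f v1 \<otimes> f s = f s \<otimes> eval_word G f v1" using com cl by blast
  moreover have "eval_word G f us = eval_word G f (v1 @ v2)"
    using Cons.prems v sub by (intro Cons.IH) (auto simp: sorted_wrt_append)
  moreover have "eval_word G f v1 \<in> carrier G" "eval_word G f v2 \<in> carrier G"
    using cl eval_word_closed by blast+
  ultimately show ?case
    using cl v eval_word_append[of f v1 "s # v2"] eval_word_append[of f v1 v2]
    by (simp add: Pi_iff ball_Un) (metis m_assoc)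
qed simp

section \<open>Vertices acting on a trickle graph\<close>

text \<open>
  Multiplication by a group element is cancellable, so for powers in a group the induction step is an
  equivalence, and one such step covers both directions of the induction over the integers.
\<close>

lemma int_shift_invariant:
  fixes P :: "int \<Rightarrow> bool"
  assumes "\<And>i. P (i + 1) = P i"
  shows "P i = P 0"
proof (induction i rule: int_induct[where k = 0])
  case (step2 i)
  then show ?case using assms[of "i - 1"] by simp
qed (simp_all add: assms)

lemma carrier_BijGroup_UNIV: "carrier (BijGroup UNIV) = {f. bij f}"
  by (auto simp: BijGroup_def Bij_def)

lemma mult_BijGroup_apply:
  "f \<in> carrier (BijGroup S) \<Longrightarrow> g \<in> carrier (BijGroup S) \<Longrightarrow> x \<in> S \<Longrightarrow>
    (f \<otimes>\<^bsub>BijGroup S\<^esub> g) x = f (g x)"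
  by (simp add: BijGroup_def compose_def)

lemma one_BijGroup_apply: "x \<in> S \<Longrightarrow> \<one>\<^bsub>BijGroup S\<^esub> x = x"
  by (simp add: BijGroup_def)

definition adj :: "('v, 'b) trickle_data_scheme \<Rightarrow> 'v \<Rightarrow> 'v \<Rightarrow> bool" where
  "adj G x y \<longleftrightarrow> {x, y} \<in> edges G"

lemma adj_sym: "adj G x y \<Longrightarrow> adj G y x"
  by (simp add: adj_def insert_commute)

text \<open>
  The automorphism \<open>phi G x\<close> moves only vertices below \<open>x\<close>, so extending it by the identity gives
  a permutation of the whole type. These permutations can be composed freely, and the compatibility
  axiom, which is stated for \<open>z < y < x\<close>, becomes an identity between them.
\<close>

definition twist :: "('v, 'b) trickle_data_scheme \<Rightarrow> 'v \<Rightarrow> 'v \<Rightarrow> 'v" where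
  "twist G x y = (if lt G y x then phi G x y else y)"

definition act :: "('v, 'b) trickle_data_scheme \<Rightarrow> 'v \<Rightarrow> int \<Rightarrow> 'v \<Rightarrow> 'v" where
  "act G x a = twist G x [^]\<^bsub>BijGroup UNIV\<^esub> a"

context trickle_graph
begin

interpretation sym: group "BijGroup (UNIV :: 'v set)"
  by (rule group_BijGroup)

lemma adj_verts: "adj G x y \<Longrightarrow> x \<in> verts G \<and> y \<in> verts G \<and> x \<noteq> y"
  using simplicial unfolding adj_def by (auto simp: doubleton_eq_iff)

lemma star_iff: "x \<in> verts G \<Longrightarrow> y \<in> star G x \<longleftrightarrow> y = x \<or> adj G x y"
  using adj_verts by (auto simp: star_def adj_def)

lemma star_verts: "x \<in> verts G \<Longrightarrow> y \<in> star G x \<Longrightarrow> y \<in> verts G"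
  by (auto simp: star_def)

lemma star_self: "x \<in> star G x"
  by (simp add: star_def)

lemma star_sym: "x \<in> verts G \<Longrightarrow> y \<in> star G x \<Longrightarrow> x \<in> star G y"
  by (auto simp: star_def insert_commute)

lemma lt_adj: "lt G y x \<Longrightarrow> adj G x y"
  using lt_edge[of y x] by (simp add: adj_def insert_commute[of x])

lemma lt_verts: "lt G y x \<Longrightarrow> x \<in> verts G \<and> y \<in> verts G"
  using lt_adj adj_verts by blast

lemma lt_star: "lt G y x \<Longrightarrow> y \<in> star G x"
  using lt_adj adj_verts star_iff by blast

lemma lt_irrefl: "\<not> lt G x x"
  by (simp add: lt_def)

lemma lt_trans: "lt G x y \<Longrightarrow> lt G y z \<Longrightarrow> lt G x z"
  using partial_order unfolding lt_def partial_order_on_def preorder_on_def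
  by (meson antisymD transD)

lemma lt_asym: "lt G x y \<Longrightarrow> \<not> lt G y x"
  using lt_trans lt_irrefl by blast

lemma le_iff_lt: "x \<in> verts G \<Longrightarrow> (x, y) \<in> le_rel G \<longleftrightarrow> x = y \<or> lt G x y"
  using partial_order unfolding lt_def partial_order_on_def preorder_on_def
  by (auto dest: refl_onD)

lemma lt_adj_incomparable:
  assumes "adj G x y" "\<not> lt G x y" "\<not> lt G y x" "lt G z y"
  shows "adj G x z" "\<not> lt G z x" "\<not> lt G x z"
proof -
  have v: "x \<in> verts G" "y \<in> verts G" "x \<noteq> y" using adj_verts assms(1) by auto
  have "(x, y) \<notin> le_rel G" "(y, x) \<notin> le_rel G"
    using assms v by (simp_all add: le_iff_lt)
  then have "{x, y} \<in> par_edges G"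
    using assms(1) unfolding par_edges_def adj_def by blast
  then have "{x, z} \<in> par_edges G"
    by (rule par_edge_down) (use assms in \<open>simp add: lt_def\<close>)
  then show "adj G x z" "\<not> lt G z x" "\<not> lt G x z"
    by (auto simp: par_edges_def adj_def lt_def doubleton_eq_iff insert_commute)
qed

lemma phi_bij:
  assumes "x \<in> verts G"
  shows "bij_betw (phi G x) (star G x) (star G x)"
  using phi_aut[OF assms] by (simp add: star_auts_def BijGroup_def Bij_def)

lemma phi_star: "x \<in> verts G \<Longrightarrow> y \<in> star G x \<Longrightarrow> phi G x y \<in> star G x"
  using phi_bij bij_betwE by blast

lemma phi_adj:
  assumes "x \<in> verts G" "y \<in> star G x" "z \<in> star G x"
  shows "adj G (phi G x y) (phi G x z) \<longleftrightarrow> adj G y z"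
  using phi_aut[OF assms(1)] assms by (simp add: star_auts_def adj_def)

lemma phi_lt:
  assumes "x \<in> verts G" "y \<in> star G x" "z \<in> star G x"
  shows "lt G (phi G x y) (phi G x z) \<longleftrightarrow> lt G y z"
proof -
  have "phi G x y = phi G x z \<longleftrightarrow> y = z"
    using phi_bij[OF assms(1)] assms by (auto simp: bij_betw_def dest: inj_onD)
  then show ?thesis using phi_le_iff[OF assms(1,3,2)] by (simp add: lt_def)
qed

lemma phi_fixes: "x \<in> verts G \<Longrightarrow> y \<in> star G x \<Longrightarrow> \<not> lt G y x \<Longrightarrow> phi G x y = y"
  using phi_moves by blast

lemma twist_eq_phi: "x \<in> verts G \<Longrightarrow> y \<in> star G x \<Longrightarrow> twist G x y = phi G x y"
  using phi_fixes by (simp add: twist_def)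

lemma twist_off_star: "y \<notin> star G x \<Longrightarrow> twist G x y = y"
  using lt_star by (auto simp: twist_def)

lemma twist_nonvert: "x \<notin> verts G \<Longrightarrow> twist G x y = y"
  using lt_verts by (auto simp: twist_def)

lemma bij_twist: "bij (twist G x)"
proof (cases "x \<in> verts G")
  case True
  have "bij_betw (twist G x) (star G x) (star G x)"
    using phi_bij[OF True] bij_betw_cong[of "star G x" "twist G x" "phi G x"] twist_eq_phi[OF True]
    by simp
  moreover have "bij_betw (twist G x) (- star G x) (- star G x)"
    using bij_betw_cong[of "- star G x" "twist G x" id] twist_off_star by simp
  ultimately show ?thesis
    using bij_betw_combine[of "twist G x" "star G x" "star G x" "- star G x" "- star G x"] by simp
next
  case False
  then have "twist G x = id" using twist_nonvert by auto
  then show ?thesis by simp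
qed

lemma twist_carrier: "twist G x \<in> carrier (BijGroup UNIV)"
  using bij_twist by (simp add: carrier_BijGroup_UNIV)

lemma act_carrier: "act G x a \<in> carrier (BijGroup UNIV)"
  using twist_carrier by (simp add: act_def)

lemma act_0 [simp]: "act G x 0 y = y"
  by (simp add: act_def one_BijGroup_apply)

lemma act_add: "act G x (a + b) y = act G x a (act G x b y)"
  unfolding act_def
  by (simp add: sym.int_pow_mult twist_carrier mult_BijGroup_apply)

lemma act_1: "act G x 1 y = twist G x y"
  by (simp add: act_def twist_carrier)

lemma act_succ: "act G x (a + 1) y = twist G x (act G x a y)"
  using act_add[of x 1 a y] by (simp add: act_1 add.commute)

lemma act_cancel [simp]: "act G x (- a) (act G x a y) = y" "act G x a (act G x (- a) y) = y"
  using act_add[of x "-a" a y] act_add[of x a "-a" y] by simp_all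

lemma act_eq_iff [simp]: "act G x a y = act G x a z \<longleftrightarrow> y = z"
  by (metis act_cancel(1))

text \<open>
  The axioms constrain \<open>phi G x\<close> on the star of \<open>x\<close> only. As the star is itself invariant, they carry
  over to powers by taking membership in the star as a conjunct of \<open>Q\<close>.
\<close>

lemma act_invariant:
  assumes "\<And>y z. Q (twist G x y) (twist G x z) \<longleftrightarrow> Q y z"
  shows "Q (act G x a y) (act G x a z) \<longleftrightarrow> Q y z"
  using int_shift_invariant[of "\<lambda>a. Q (act G x a y) (act G x a z)" a] assms
  by (simp add: act_succ)

lemma act_star: "act G x a y \<in> star G x \<longleftrightarrow> y \<in> star G x"
proof (rule act_invariant[of "\<lambda>y z. y \<in> star G x" x a y y])
  show "twist G x y \<in> star G x \<longleftrightarrow> y \<in> star G x" for y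
    by (metis phi_star twist_eq_phi twist_nonvert twist_off_star)
qed

lemma act_fixes: "\<not> lt G y x \<Longrightarrow> act G x a y = y"
  using int_shift_invariant[of "\<lambda>a. act G x a y = y" a]
  by (metis act_0 act_1 act_add act_eq_iff add.commute twist_def)

lemma act_off_star: "y \<notin> star G x \<Longrightarrow> act G x a y = y"
  using act_fixes lt_star by blast

lemma act_self [simp]: "act G x a x = x"
  using act_fixes lt_irrefl by blast

lemma act_eq_self_iff [simp]: "act G x a y = x \<longleftrightarrow> y = x"
  by (metis act_eq_iff act_self)

lemma act_adj_lt:
  assumes "y \<in> star G x" "z \<in> star G x"
  shows "adj G (act G x a y) (act G x a z) \<longleftrightarrow> adj G y z"
    and "lt G (act G x a y) (act G x a z) \<longleftrightarrow> lt G y z"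
proof -
  have "(act G x a y \<in> star G x \<and> act G x a z \<in> star G x \<and> adj G (act G x a y) (act G x a z)) \<longleftrightarrow>
    (y \<in> star G x \<and> z \<in> star G x \<and> adj G y z)"
  proof (rule act_invariant)
    show "twist G x y \<in> star G x \<and> twist G x z \<in> star G x \<and> adj G (twist G x y) (twist G x z) \<longleftrightarrow>
      y \<in> star G x \<and> z \<in> star G x \<and> adj G y z" for y z
      using act_star[of x 1] unfolding act_1
      by (metis phi_adj twist_eq_phi twist_nonvert)
  qed
  then show "adj G (act G x a y) (act G x a z) \<longleftrightarrow> adj G y z"
    using assms by (simp add: act_star)
  have "(act G x a y \<in> star G x \<and> act G x a z \<in> star G x \<and> lt G (act G x a y) (act G x a z)) \<longleftrightarrow>
    (y \<in> star G x \<and> z \<in> star G x \<and> lt G y z)"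
  proof (rule act_invariant)
    show "twist G x y \<in> star G x \<and> twist G x z \<in> star G x \<and> lt G (twist G x y) (twist G x z) \<longleftrightarrow>
      y \<in> star G x \<and> z \<in> star G x \<and> lt G y z" for y z
      using act_star[of x 1] unfolding act_1
      by (metis phi_lt twist_eq_phi twist_nonvert)
  qed
  then show "lt G (act G x a y) (act G x a z) \<longleftrightarrow> lt G y z"
    using assms by (simp add: act_star)
qed

lemma act_lt_self: "lt G (act G x a y) x \<longleftrightarrow> lt G y x"
  using act_adj_lt(2)[of y x x a] act_off_star[of y x a] star_self[of x] by (cases "y \<in> star G x") auto

lemma mu_act [simp]: "mu G (act G x a y) = mu G y"
proof -
  have "mu G (twist G x y) = mu G y" for y
    using mu_phi lt_star lt_verts by (auto simp: twist_def)
  then show ?thesis using act_invariant[of "\<lambda>y _. mu G y = k" x a y y for k] by metis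
qed

lemma act_verts: "act G x a y \<in> verts G \<longleftrightarrow> y \<in> verts G"
  using act_fixes act_lt_self lt_verts by metis

lemma act_star_star:
  assumes "y \<in> verts G" "y \<in> star G x" "z \<in> star G x" "z \<in> star G y"
  shows "act G x a z \<in> star G (act G x a y)"
  using assms act_adj_lt(1)[of y x z a] act_verts[of x a y] by (auto simp: star_iff)

lemma phi_pow_eq_act:
  assumes x: "x \<in> verts G" and y: "y \<in> star G x"
  shows "phi_pow G x a y = act G x a y"
proof -
  interpret S: group "BijGroup (star G x)" by (rule group_BijGroup)
  have phi: "phi G x \<in> carrier (BijGroup (star G x))"
    using phi_aut[OF x] by (simp add: star_auts_def)
  have add: "phi_pow G x (a + b) y = phi_pow G x a (phi_pow G x b y)" if "y \<in> star G x" for a b y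
    unfolding phi_pow_def using that by (simp add: S.int_pow_mult phi mult_BijGroup_apply)
  have one: "phi_pow G x 1 y = twist G x y" if "y \<in> star G x" for y
    unfolding phi_pow_def using that by (simp add: phi twist_eq_phi x)
  have "\<forall>y \<in> star G x. phi_pow G x a y = act G x a y"
  proof (induction a rule: int_induct[where k = 0])
    case base
    show ?case by (simp add: phi_pow_def one_BijGroup_apply)
  next
    case (step1 i)
    then show ?case
      using add[of _ 1 i] one act_star by (metis act_succ add.commute)
  next
    case (step2 i)
    show ?case
    proof
      fix y assume y: "y \<in> star G x"
      define z where "z = act G x (- 1) y"
      have z: "z \<in> star G x" and yz: "y = twist G x z"
        using y act_star act_cancel(2)[of x 1 y] by (simp_all add: z_def flip: act_1)
      have "phi_pow G x (i - 1) y = phi_pow G x i z"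
        using add[OF z, of "i - 1" 1] one[OF z] yz by simp
      also have "\<dots> = act G x (i - 1) y"
        using step2 z act_add[of x "i - 1" 1 z] yz by (simp add: act_1)
      finally show "phi_pow G x (i - 1) y = act G x (i - 1) y" .
    qed
  qed
  then show ?thesis using y by blast
qed

lemma act_mu:
  assumes x: "x \<in> verts G" and m: "mu G x = enat m"
  shows "act G x (int m) y = y"
proof (cases "y \<in> star G x")
  case True
  interpret S: group "BijGroup (star G x)" by (rule group_BijGroup)
  have "phi G x \<in> carrier (BijGroup (star G x))"
    using phi_aut[OF x] by (simp add: star_auts_def)
  then have "phi G x [^]\<^bsub>BijGroup (star G x)\<^esub> m = \<one>\<^bsub>BijGroup (star G x)\<^esub>"
    using phi_order[OF x m] by (simp add: S.pow_eq_id)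
  then show ?thesis
    using phi_pow_eq_act[OF x True, of "int m"] True
    by (simp add: phi_pow_def int_pow_int one_BijGroup_apply)
qed (simp add: act_off_star)

text \<open>
  The relation \<open>phi G x y * x = phi G y x * y\<close> of the trickle group, read in the symmetric group of
  the vertex type. Of two comparable adjacent vertices the larger one moves the smaller one, and
  this is the compatibility axiom; two incomparable ones have disjoint down-sets, hence commute.
\<close>

lemma twist_twist:
  assumes "adj G x y"
  shows "twist G (twist G x y) (twist G x z) = twist G (twist G y x) (twist G y z)"
proof -
  have below: "twist G (twist G x y) (twist G x z) = twist G x (twist G y z)" if yx: "lt G y x" for x y z
  proof -
    have x: "x \<in> verts G" and y: "y \<in> star G x" using lt_verts lt_star yx by auto
    show ?thesis
    proof (cases "lt G z y")
      case True
      then have "lt G z x" using yx lt_trans by blast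
      moreover have "lt G (twist G x z) (twist G x y)"
        using True act_adj_lt(2)[of z x y 1] y lt_star[OF \<open>lt G z x\<close>] by (simp add: act_1)
      moreover have "twist G y z = phi G y z" "lt G (twist G y z) x"
        using True act_lt_self[of y 1 z] lt_trans yx by (auto simp: act_1 twist_def)
      ultimately show ?thesis using yx True phi_phi[OF True yx] by (simp add: twist_def)
    next
      case False
      then have "\<not> lt G (twist G x z) (twist G x y)"
        using act_adj_lt(2)[of z x y 1] act_lt_self[of x 1 y] act_star[of x 1 z] lt_star lt_trans yx y
        by (metis act_1)
      then show ?thesis using False by (simp add: twist_def)
    qed
  qed
  consider "lt G x y" | "lt G y x" | "\<not> lt G x y" "\<not> lt G y x" by blast
  then show ?thesis
  proof cases
    case 1
    then have "twist G x y = y" using lt_asym by (auto simp: twist_def)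
    then show ?thesis using below[OF 1] by simp
  next
    case 2
    then have "twist G y x = x" using lt_asym by (auto simp: twist_def)
    then show ?thesis using below[OF 2] by simp
  next
    case 3
    then have *: "twist G x y = y" "twist G y x = x" by (auto simp: twist_def)
    have dis: "\<not> (lt G z x \<and> lt G z y)" for z
      using lt_adj_incomparable(2)[OF assms 3] by blast
    have "lt G z y \<Longrightarrow> lt G (twist G y z) y" "lt G z x \<Longrightarrow> lt G (twist G x z) x" for z
      using act_lt_self[of _ 1] by (simp_all add: act_1)
    then have "twist G y (twist G x z) = twist G x (twist G y z)"
      using dis by (metis twist_def)
    then show ?thesis by (simp add: *)
  qed
qed

end

section \<open>Realizations of the vertices in a group\<close>

text \<open>
  The representative of an exponent in \<^term>\<open>Zmu (mu G x)\<close>.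
\<close>

definition red :: "('v, 'b) trickle_data_scheme \<Rightarrow> 'v \<Rightarrow> int \<Rightarrow> int" where
  "red G x a = (case mu G x of enat m \<Rightarrow> a mod int m | \<infinity> \<Rightarrow> a)"

text \<open>
  The relations of the trickle group for arbitrary exponents. In both realizations used below, in the
  trickle group and in the symmetric group of the vertex type, \<open>F (x, a)\<close> is a power of \<open>F (x, 1)\<close>.
\<close>

definition realization ::
  "('v, 'b) trickle_data_scheme \<Rightarrow> ('m, 'c) monoid_scheme \<Rightarrow> ('v syllable \<Rightarrow> 'm) \<Rightarrow> bool" where
  "realization G M F \<longleftrightarrow> group M \<and>
     (\<forall>x \<in> verts G. \<forall>a b. F (x, a) \<in> carrier M \<and> F (x, a + b) = F (x, a) \<otimes>\<^bsub>M\<^esub> F (x, b)) \<and>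
     (\<forall>x \<in> verts G. \<forall>m. mu G x = enat m \<longrightarrow> F (x, int m) = \<one>\<^bsub>M\<^esub>) \<and>
     (\<forall>x y a b. adj G x y \<longrightarrow>
        F (act G x a y, b) \<otimes>\<^bsub>M\<^esub> F (x, a) = F (act G y b x, a) \<otimes>\<^bsub>M\<^esub> F (y, b))"

lemma realizationI:
  assumes "group M"
    and "\<And>x a. x \<in> verts G \<Longrightarrow> F (x, a) \<in> carrier M"
    and "\<And>x a b. x \<in> verts G \<Longrightarrow> F (x, a + b) = F (x, a) \<otimes>\<^bsub>M\<^esub> F (x, b)"
    and "\<And>x m. x \<in> verts G \<Longrightarrow> mu G x = enat m \<Longrightarrow> F (x, int m) = \<one>\<^bsub>M\<^esub>"
    and "\<And>x y a b. adj G x y \<Longrightarrow>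
      F (act G x a y, b) \<otimes>\<^bsub>M\<^esub> F (x, a) = F (act G y b x, a) \<otimes>\<^bsub>M\<^esub> F (y, b)"
  shows "realization G M F"
  unfolding realization_def using assms by blast

lemma (in group) int_pow_intertwine:
  assumes "u \<in> carrier G" "v \<in> carrier G" "h \<in> carrier G" "u \<otimes> h = h \<otimes> v"
  shows "u [^] (i :: int) \<otimes> h = h \<otimes> v [^] i"
proof -
  have "(u [^] (i + 1) \<otimes> h = h \<otimes> v [^] (i + 1)) = (u [^] i \<otimes> h = h \<otimes> v [^] i)" for i :: int
  proof -
    have "u [^] (i + 1) = u \<otimes> u [^] i" "v [^] (i + 1) = v \<otimes> v [^] i"
      using int_pow_mult[of u 1 i] int_pow_mult[of v 1 i] assms by (simp_all add: add.commute)
    moreover have "h \<otimes> (v \<otimes> v [^] i) = u \<otimes> (h \<otimes> v [^] i)"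
      using assms m_assoc[of h v "v [^] i"] m_assoc[of u h "v [^] i"] by simp
    ultimately have "(u [^] (i + 1) \<otimes> h = h \<otimes> v [^] (i + 1)) =
        (u \<otimes> (u [^] i \<otimes> h) = u \<otimes> (h \<otimes> v [^] i))"
      using assms m_assoc[of u "u [^] i" h] by simp
    then show ?thesis using assms by simp
  qed
  then show ?thesis
    using int_shift_invariant[of "\<lambda>i. u [^] i \<otimes> h = h \<otimes> v [^] i" i] assms by simp
qed

context trickle_graph
begin

text \<open>
  The defining relations of the trickle group concern the generators only. For arbitrary
  exponents, note that for \<open>y < x\<close> they say that conjugation by \<open>x\<close> renames \<open>y\<close>.
\<close>

lemma realization_powers:
  assumes M: "group M" and g: "g \<in> verts G \<rightarrow> carrier M"
    and ord: "\<And>x m. x \<in> verts G \<Longrightarrow> mu G x = enat m \<Longrightarrow> g x [^]\<^bsub>M\<^esub> m = \<one>\<^bsub>M\<^esub>"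
    and rel: "\<And>x y. adj G x y \<Longrightarrow> g (twist G x y) \<otimes>\<^bsub>M\<^esub> g x = g (twist G y x) \<otimes>\<^bsub>M\<^esub> g y"
  shows "realization G M (\<lambda>(x, a). g x [^]\<^bsub>M\<^esub> a)"
proof -
  interpret M: group M by (rule M)
  have cl: "g x \<in> carrier M" if "x \<in> verts G" for x using g that by blast
  have below: "g (act G x a y) [^]\<^bsub>M\<^esub> b \<otimes>\<^bsub>M\<^esub> g x [^]\<^bsub>M\<^esub> a = g x [^]\<^bsub>M\<^esub> a \<otimes>\<^bsub>M\<^esub> g y [^]\<^bsub>M\<^esub> b"
    if yx: "lt G y x" for x y and a b :: int
  proof -
    have v: "g x \<in> carrier M" "g y \<in> carrier M" "g (act G x a y) \<in> carrier M" for a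
      using cl lt_verts[OF yx] act_verts by auto
    have "(g (act G x (a + 1) y) \<otimes>\<^bsub>M\<^esub> g x [^]\<^bsub>M\<^esub> (a + 1) = g x [^]\<^bsub>M\<^esub> (a + 1) \<otimes>\<^bsub>M\<^esub> g y) =
      (g (act G x a y) \<otimes>\<^bsub>M\<^esub> g x [^]\<^bsub>M\<^esub> a = g x [^]\<^bsub>M\<^esub> a \<otimes>\<^bsub>M\<^esub> g y)" for a
    proof -
      define w where "w = act G x a y"
      have "lt G w x" using act_lt_self yx by (simp add: w_def)
      then have w: "adj G x w" "twist G w x = x"
        using lt_adj lt_asym by (auto simp: twist_def)
      have wc: "g w \<in> carrier M" "g (twist G x w) \<in> carrier M"
        using v(3)[of a] v(3)[of "a + 1"] by (simp_all add: w_def act_succ)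
      have "g x [^]\<^bsub>M\<^esub> (a + 1) = g x \<otimes>\<^bsub>M\<^esub> g x [^]\<^bsub>M\<^esub> a"
        using M.int_pow_mult[of "g x" 1 a] v by (simp add: add.commute)
      then have "(g (twist G x w) \<otimes>\<^bsub>M\<^esub> g x [^]\<^bsub>M\<^esub> (a + 1) = g x [^]\<^bsub>M\<^esub> (a + 1) \<otimes>\<^bsub>M\<^esub> g y) =
        (g (twist G x w) \<otimes>\<^bsub>M\<^esub> g x \<otimes>\<^bsub>M\<^esub> g x [^]\<^bsub>M\<^esub> a = g x \<otimes>\<^bsub>M\<^esub> (g x [^]\<^bsub>M\<^esub> a \<otimes>\<^bsub>M\<^esub> g y))"
        using v wc by (simp add: M.m_assoc)
      also have "\<dots> = (g x \<otimes>\<^bsub>M\<^esub> (g w \<otimes>\<^bsub>M\<^esub> g x [^]\<^bsub>M\<^esub> a) = g x \<otimes>\<^bsub>M\<^esub> (g x [^]\<^bsub>M\<^esub> a \<otimes>\<^bsub>M\<^esub> g y))"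
        using rel[OF w(1)] w(2) v wc by (simp add: M.m_assoc)
      finally show ?thesis using v wc by (simp add: w_def act_succ)
    qed
    then have "g (act G x a y) \<otimes>\<^bsub>M\<^esub> g x [^]\<^bsub>M\<^esub> a = g x [^]\<^bsub>M\<^esub> a \<otimes>\<^bsub>M\<^esub> g y"
      using int_shift_invariant[of "\<lambda>a. g (act G x a y) \<otimes>\<^bsub>M\<^esub> g x [^]\<^bsub>M\<^esub> a = g x [^]\<^bsub>M\<^esub> a \<otimes>\<^bsub>M\<^esub> g y" a] v
      by simp
    then show ?thesis using v by (intro M.int_pow_intertwine) auto
  qed
  have "g (act G x a y) [^]\<^bsub>M\<^esub> b \<otimes>\<^bsub>M\<^esub> g x [^]\<^bsub>M\<^esub> a = g (act G y b x) [^]\<^bsub>M\<^esub> a \<otimes>\<^bsub>M\<^esub> g y [^]\<^bsub>M\<^esub> b"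
    if xy: "adj G x y" for x y and a b :: int
  proof -
    consider "lt G x y" | "lt G y x" | "\<not> lt G x y" "\<not> lt G y x" by blast
    then show ?thesis
    proof cases
      case 1
      then show ?thesis using below[OF 1] act_fixes[of y x a] lt_asym by simp
    next
      case 2
      then show ?thesis using below[OF 2] act_fixes[of x y b] lt_asym by simp
    next
      case 3
      have v: "g x \<in> carrier M" "g y \<in> carrier M" using cl adj_verts[OF xy] by auto
      have "g y \<otimes>\<^bsub>M\<^esub> g x = g x \<otimes>\<^bsub>M\<^esub> g y" using rel[OF xy] 3 by (simp add: twist_def)
      then have "g y [^]\<^bsub>M\<^esub> b \<otimes>\<^bsub>M\<^esub> g x = g x \<otimes>\<^bsub>M\<^esub> g y [^]\<^bsub>M\<^esub> b"
        using v by (intro M.int_pow_intertwine) auto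
      then have "g x [^]\<^bsub>M\<^esub> a \<otimes>\<^bsub>M\<^esub> g y [^]\<^bsub>M\<^esub> b = g y [^]\<^bsub>M\<^esub> b \<otimes>\<^bsub>M\<^esub> g x [^]\<^bsub>M\<^esub> a"
        using v by (intro M.int_pow_intertwine) auto
      then show ?thesis using 3 by (simp add: act_fixes)
    qed
  qed
  then show ?thesis
    using M cl ord by (intro realizationI) (simp_all add: M.int_pow_mult int_pow_int)
qed

lemma realization_act: "realization G (BijGroup UNIV) (\<lambda>(x, a). act G x a)"
proof -
  interpret S: group "BijGroup (UNIV :: 'v set)" by (rule group_BijGroup)
  have eqI: "f = g" if "\<And>z. f z = g z" for f g :: "'v \<Rightarrow> 'v" using that by blast
  have "realization G (BijGroup UNIV) (\<lambda>(x, a). twist G x [^]\<^bsub>BijGroup UNIV\<^esub> a)"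
  proof (rule realization_powers)
    fix x m assume "x \<in> verts G" "mu G x = enat m"
    then have "act G x (int m) = \<one>\<^bsub>BijGroup UNIV\<^esub>"
      by (intro eqI) (simp add: act_mu one_BijGroup_apply)
    then show "twist G x [^]\<^bsub>BijGroup UNIV\<^esub> m = \<one>\<^bsub>BijGroup UNIV\<^esub>"
      by (simp add: act_def int_pow_int)
  next
    fix x y assume xy: "adj G x y"
    show "twist G (twist G x y) \<otimes>\<^bsub>BijGroup UNIV\<^esub> twist G x =
        twist G (twist G y x) \<otimes>\<^bsub>BijGroup UNIV\<^esub> twist G y"
      by (intro eqI) (simp add: mult_BijGroup_apply twist_carrier twist_twist[OF xy])
  qed (simp_all add: twist_carrier group_BijGroup)
  then show ?thesis by (simp add: act_def)
qed

lemma act_act: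
  assumes "adj G x y"
  shows "act G (act G x a y) b (act G x a z) = act G (act G y b x) a (act G y b z)"
proof -
  have "act G (act G x a y) b \<otimes>\<^bsub>BijGroup UNIV\<^esub> act G x a =
      act G (act G y b x) a \<otimes>\<^bsub>BijGroup UNIV\<^esub> act G y b"
    using realization_act assms unfolding realization_def by fastforce
  then show ?thesis
    using mult_BijGroup_apply[OF act_carrier act_carrier UNIV_I] by metis
qed

lemma realization_group: "realization G M F \<Longrightarrow> group M"
  and realization_closed: "realization G M F \<Longrightarrow> x \<in> verts G \<Longrightarrow> F (x, a) \<in> carrier M"
  and realization_add: "realization G M F \<Longrightarrow> x \<in> verts G \<Longrightarrow> F (x, a + b) = F (x, a) \<otimes>\<^bsub>M\<^esub> F (x, b)"
  and realization_swap: "realization G M F \<Longrightarrow> adj G x y \<Longrightarrow>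
    F (act G x a y, b) \<otimes>\<^bsub>M\<^esub> F (x, a) = F (act G y b x, a) \<otimes>\<^bsub>M\<^esub> F (y, b)"
  unfolding realization_def by blast+

lemma realization_0:
  assumes "realization G M F" "x \<in> verts G"
  shows "F (x, 0) = \<one>\<^bsub>M\<^esub>"
proof -
  interpret M: group M using assms(1) by (rule realization_group)
  have "F (x, 0) \<otimes>\<^bsub>M\<^esub> F (x, 0) = F (x, 0)" using realization_add[OF assms, of 0 0] by simp
  then show ?thesis using realization_closed[OF assms] by simp
qed

lemma realization_red:
  assumes r: "realization G M F" and x: "x \<in> verts G"
  shows "F (x, red G x a) = F (x, a)"
proof (cases "mu G x")
  case (enat m)
  interpret M: group M using r by (rule realization_group)
  have "F (x, a + int m * k) = F (x, a)" for k
  proof -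
    have "F (x, a + int m * (k + 1)) = F (x, a + int m * k)" for k
    proof -
      have "a + int m * (k + 1) = (a + int m * k) + int m" by (simp add: algebra_simps)
      moreover have "F (x, int m) = \<one>\<^bsub>M\<^esub>"
        using r x enat unfolding realization_def by blast
      ultimately show ?thesis
        using realization_closed[OF r x] by (simp only: realization_add[OF r x]) simp
    qed
    then show ?thesis
      using int_shift_invariant[of "\<lambda>k. F (x, a + int m * k) = F (x, a)" k] by simp
  qed
  from this[of "- (a div int m)"] show ?thesis
    using enat minus_mult_div_eq_mod[of a "int m"] by (simp add: red_def)
qed (simp add: red_def)

lemma red_add_red [simp]: "red G x (red G x a + b) = red G x (a + b)"
  "red G x (a + red G x b) = red G x (a + b)"
  "red G x (red G x a) = red G x a" "red G x 0 = 0"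
  by (simp_all add: red_def mod_simps split: enat.split)

lemma red_act [simp]: "red G (act G x a y) b = red G y b"
  by (simp add: red_def)

lemma mu_cases:
  assumes "x \<in> verts G"
  obtains m where "mu G x = enat m" "2 \<le> m" | "mu G x = \<infinity>"
  using mu_ge_2[OF assms] by (cases "mu G x") auto

lemma Zmu_eq:
  assumes "x \<in> verts G"
  shows "a \<in> carrier (Zmu (mu G x)) \<longleftrightarrow> red G x a = a"
    and "\<one>\<^bsub>Zmu (mu G x)\<^esub> = 0"
    and "a \<otimes>\<^bsub>Zmu (mu G x)\<^esub> b = red G x (a + b)"
proof -
  show "a \<in> carrier (Zmu (mu G x)) \<longleftrightarrow> red G x a = a"
  proof (rule mu_cases[OF assms])
    fix m :: nat
    assume m: "mu G x = enat m" "2 \<le> m"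
    then have "a mod int m = a \<longleftrightarrow> 0 \<le> a \<and> a < int m"
      using zmod_trivial_iff[of a "int m"] by linarith
    then show ?thesis using m by (simp add: Zmu_def red_def carrier_integer_mod_group)
  qed (simp add: Zmu_def red_def)
  show "\<one>\<^bsub>Zmu (mu G x)\<^esub> = 0" "a \<otimes>\<^bsub>Zmu (mu G x)\<^esub> b = red G x (a + b)"
    by (cases "mu G x"; simp add: Zmu_def red_def)+
qed

lemma syllables_iff: "(x, a) \<in> syllables G \<longleftrightarrow> x \<in> verts G \<and> a \<noteq> 0 \<and> red G x a = a"
  by (auto simp: syllables_def Zmu_eq)

lemma red_1: "x \<in> verts G \<Longrightarrow> red G x 1 = 1"
  by (erule mu_cases) (simp_all add: red_def)


section \<open>Strata\<close>

lemma strataD: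
  assumes "U \<in> strata G"
  shows "finite U"
    and "(x, a) \<in> U \<Longrightarrow> x \<in> verts G" "(x, a) \<in> U \<Longrightarrow> a \<noteq> 0" "(x, a) \<in> U \<Longrightarrow> red G x a = a"
    and "(x, a) \<in> U \<Longrightarrow> (x, b) \<in> U \<Longrightarrow> a = b"
    and "(x, a) \<in> U \<Longrightarrow> (y, b) \<in> U \<Longrightarrow> x \<noteq> y \<Longrightarrow> adj G x y"
proof -
  have U: "finite U" "U \<subseteq> syllables G"
    "\<And>s t. s \<in> U \<Longrightarrow> t \<in> U \<Longrightarrow> s \<noteq> t \<Longrightarrow> fst s \<noteq> fst t \<and> {fst s, fst t} \<in> edges G"
    using assms by (auto simp: strata_def)
  show "finite U" by (rule U(1))
  show "(x, a) \<in> U \<Longrightarrow> x \<in> verts G" "(x, a) \<in> U \<Longrightarrow> a \<noteq> 0" "(x, a) \<in> U \<Longrightarrow> red G x a = a"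
    using U(2) syllables_iff by blast+
  show "(x, a) \<in> U \<Longrightarrow> (x, b) \<in> U \<Longrightarrow> a = b" using U(3)[of "(x, a)" "(x, b)"] by auto
  show "(x, a) \<in> U \<Longrightarrow> (y, b) \<in> U \<Longrightarrow> x \<noteq> y \<Longrightarrow> adj G x y"
    using U(3)[of "(x, a)" "(y, b)"] by (auto simp: adj_def)
qed

lemma strataI:
  assumes "finite U" "\<And>x a. (x, a) \<in> U \<Longrightarrow> x \<in> verts G \<and> a \<noteq> 0 \<and> red G x a = a"
    and "\<And>x a b. (x, a) \<in> U \<Longrightarrow> (x, b) \<in> U \<Longrightarrow> a = b"
    and "\<And>x y a b. (x, a) \<in> U \<Longrightarrow> (y, b) \<in> U \<Longrightarrow> x \<noteq> y \<Longrightarrow> adj G x y"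
  shows "U \<in> strata G"
proof -
  have "fst s \<noteq> fst t \<and> {fst s, fst t} \<in> edges G" if "s \<in> U" "t \<in> U" "s \<noteq> t" for s t
    using assms(3)[of "fst s" "snd s" "snd t"] assms(4)[of "fst s" "snd s" "fst t" "snd t"] that
    by (auto simp: adj_def prod_eq_iff)
  moreover have "U \<subseteq> syllables G" using assms(2) by (auto simp: syllables_iff)
  ultimately show ?thesis using assms(1) by (simp add: strata_def)
qed

lemma strata_subset: "U \<in> strata G \<Longrightarrow> V \<subseteq> U \<Longrightarrow> V \<in> strata G"
  unfolding strata_def using finite_subset by blast

lemma strata_empty: "{} \<in> strata G"
  by (simp add: strata_def)

lemma supp_iff: "x \<in> supp U \<longleftrightarrow> (\<exists>a. (x, a) \<in> U)"
  by (force simp: supp_def)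

lemma suppI: "(x, a) \<in> U \<Longrightarrow> x \<in> supp U"
  by (auto simp: supp_iff)

lemma supp_verts: "U \<in> strata G \<Longrightarrow> x \<in> supp U \<Longrightarrow> x \<in> verts G"
  using strataD(2) by (auto simp: supp_iff)

lemma supp_star: "U \<in> strata G \<Longrightarrow> x \<in> supp U \<Longrightarrow> y \<in> supp U \<Longrightarrow> y \<in> star G x"
  using strataD(6)[of U x _ y] supp_verts[of U x] star_iff[of x y] by (auto simp: supp_iff)

lemma supp_Diff: "supp (U - {t}) \<subseteq> supp U"
  by (auto simp: supp_def)

lemma stratum_has_maximal:
  assumes "finite A" "A \<noteq> {}"
  obtains s where "s \<in> A" "\<And>r. r \<in> A \<Longrightarrow> \<not> lt G (fst s) (fst r)"
proof -
  have "asymp_on A (\<lambda>s t. lt G (fst s) (fst t))" by (rule asymp_onI) (rule lt_asym)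
  moreover have "transp_on A (\<lambda>s t. lt G (fst s) (fst t))" by (rule transp_onI) (rule lt_trans)
  ultimately obtain s where s: "s \<in> A" "\<forall>r \<in> A. s \<noteq> r \<longrightarrow> \<not> lt G (fst s) (fst r)"
    using Finite_Set.bex_max_element[OF assms(1) _ _ assms(2)] by (metis (no_types, lifting))
  show thesis
  proof (rule that[OF s(1)])
    show "\<not> lt G (fst s) (fst r)" if "r \<in> A" for r using s(2) that by (cases "r = s") (auto simp: lt_irrefl)
  qed
qed

lemma stratum_has_minimal:
  assumes "finite A" "A \<noteq> {}"
  obtains s where "s \<in> A" "\<And>r. r \<in> A \<Longrightarrow> \<not> lt G (fst r) (fst s)"
proof -
  have "asymp_on A (\<lambda>s t. lt G (fst s) (fst t))" by (rule asymp_onI) (rule lt_asym)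
  moreover have "transp_on A (\<lambda>s t. lt G (fst s) (fst t))" by (rule transp_onI) (rule lt_trans)
  ultimately obtain s where s: "s \<in> A" "\<forall>r \<in> A. s \<noteq> r \<longrightarrow> \<not> lt G (fst r) (fst s)"
    using Finite_Set.bex_min_element[OF assms(1) _ _ assms(2)] by (metis (no_types, lifting))
  show thesis
  proof (rule that[OF s(1)])
    show "\<not> lt G (fst r) (fst s)" if "r \<in> A" for r using s(2) that by (cases "r = s") (auto simp: lt_irrefl)
  qed
qed

text \<open>
  Removing a maximal syllable cancels the first factor of the product over a stratum.
\<close>

lemma stratum_induct [consumes 1, case_names empty peel]:
  assumes "U \<in> strata G"
    and "P {}"
    and "\<And>U t. U \<in> strata G \<Longrightarrow> t \<in> U \<Longrightarrow> (\<And>s. s \<in> U \<Longrightarrow> \<not> lt G (fst t) (fst s)) \<Longrightarrow>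
      P (U - {t}) \<Longrightarrow> P U"
  shows "P U"
  using assms(1)
proof (induction "card U" arbitrary: U)
  case 0
  then show ?case using assms(2) strataD(1) by simp
next
  case (Suc n)
  then have "U \<noteq> {}" by auto
  then obtain t where t: "t \<in> U" "\<And>s. s \<in> U \<Longrightarrow> \<not> lt G (fst t) (fst s)"
    using stratum_has_maximal[OF strataD(1)[OF Suc.prems]] by blast
  have "card (U - {t}) = n" using Suc t strataD(1) by simp
  then have "P (U - {t})" using Suc.hyps(1) strata_subset[OF Suc.prems] by blast
  then show ?case using assms(3)[OF Suc.prems t] by blast
qed

lemma numbering_iff:
  "numbering G U us \<longleftrightarrow>
     distinct us \<and> set us = U \<and> sorted_wrt (\<lambda>s t. \<not> lt G (fst s) (fst t)) us"
proof -
  have "(\<forall>j < n. \<forall>k < n. r k j \<longrightarrow> j < k) \<longleftrightarrow> (\<forall>i j. i < j \<longrightarrow> j < n \<longrightarrow> \<not> r i j)"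
    if irr: "\<And>i. \<not> r i i" for r :: "nat \<Rightarrow> nat \<Rightarrow> bool" and n
  proof (intro iffI allI impI)
    fix i j assume "\<forall>j < n. \<forall>k < n. r k j \<longrightarrow> j < k" "i < j" "j < n"
    then show "\<not> r i j" using less_trans[of i j n] less_asym[of i j] by blast
  next
    fix j k assume "\<forall>i j. i < j \<longrightarrow> j < n \<longrightarrow> \<not> r i j" "j < n" "r k j"
    then show "j < k" using irr by (cases j k rule: linorder_cases) auto
  qed
  from this[of "\<lambda>k j. lt G (fst (us ! k)) (fst (us ! j))" "length us"] show ?thesis
    unfolding numbering_def sorted_wrt_iff_nth_less using lt_irrefl by simp
qed

end

definition stratum_prod ::
  "('v, 'b) trickle_data_scheme \<Rightarrow> ('m, 'c) monoid_scheme \<Rightarrow> ('v syllable \<Rightarrow> 'm) \<Rightarrow> 'v stratum \<Rightarrow> 'm"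
  where "stratum_prod G M F U = eval_word M F (SOME us. numbering G U us)"

text \<open>
  The product of a stratum in the symmetric group of the vertex type. It turns the name that a vertex
  has at the right end of the product into the name that it has at the left end.
\<close>

definition stratum_perm :: "('v, 'b) trickle_data_scheme \<Rightarrow> 'v stratum \<Rightarrow> 'v \<Rightarrow> 'v" where
  "stratum_perm G U = stratum_prod G (BijGroup UNIV) (\<lambda>(x, a). act G x a) U"

context trickle_graph
begin

lemma numbering_peel:
  assumes "U \<in> strata G" "t \<in> U" "numbering G (U - {t}) us"
  shows "(\<And>s. s \<in> U \<Longrightarrow> \<not> lt G (fst t) (fst s)) \<Longrightarrow> numbering G U (t # us)"
    and "(\<And>s. s \<in> U \<Longrightarrow> \<not> lt G (fst s) (fst t)) \<Longrightarrow> numbering G U (us @ [t])"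
  using assms by (auto simp: numbering_iff sorted_wrt_append)

lemma numbering_exists: "U \<in> strata G \<Longrightarrow> \<exists>us. numbering G U us"
proof (induction rule: stratum_induct)
  case empty
  show ?case by (auto simp: numbering_iff)
next
  case (peel U t)
  then show ?case using numbering_peel(1) by blast
qed

lemma numbering_some: "U \<in> strata G \<Longrightarrow> numbering G U (SOME us. numbering G U us)"
  using numbering_exists by (rule someI_ex)

lemma realization_Pi:
  "realization G M F \<Longrightarrow> U \<in> strata G \<Longrightarrow> F \<in> U \<rightarrow> carrier M"
  using realization_closed strataD(2) by fastforce

lemma stratum_prod_numbering:
  assumes r: "realization G M F" and U: "U \<in> strata G" and us: "numbering G U us"
  shows "stratum_prod G M F U = eval_word M F us"
proof -
  interpret M: group M using r by (rule realization_group)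
  have com: "F s \<otimes>\<^bsub>M\<^esub> F t = F t \<otimes>\<^bsub>M\<^esub> F s"
    if st: "s \<in> U" "t \<in> U" "\<not> lt G (fst s) (fst t)" "\<not> lt G (fst t) (fst s)" for s t
  proof (cases "s = t")
    case False
    obtain x a y b where xy: "s = (x, a)" "t = (y, b)" by (metis prod.collapse)
    then have "adj G y x"
      using strataD(5,6)[OF U] st False by blast
    moreover have "act G x a y = y" "act G y b x = x" using st xy by (simp_all add: act_fixes)
    ultimately show ?thesis using realization_swap[OF r, of y x b a] xy by simp
  qed simp
  define vs where "vs = (SOME us. numbering G U us)"
  have vs: "numbering G U vs" unfolding vs_def by (rule numbering_some[OF U])
  show ?thesis
    unfolding stratum_prod_def vs_def[symmetric]
  proof (rule M.eval_word_sorted_unique[where prec = "\<lambda>s t. lt G (fst s) (fst t)"])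
    show "distinct us" "sorted_wrt (\<lambda>s t. \<not> lt G (fst s) (fst t)) us"
      using us by (simp_all add: numbering_iff)
    show "distinct vs" "sorted_wrt (\<lambda>s t. \<not> lt G (fst s) (fst t)) vs" "set vs = set us"
      using us vs by (simp_all add: numbering_iff)
    have "set us = U" using us by (simp add: numbering_iff)
    then show "F \<in> set vs \<rightarrow> carrier M" using realization_Pi[OF r U] \<open>set vs = set us\<close> by simp
    show "F s \<otimes>\<^bsub>M\<^esub> F t = F t \<otimes>\<^bsub>M\<^esub> F s" if "s \<in> set vs" "t \<in> set vs"
      "\<not> lt G (fst s) (fst t)" "\<not> lt G (fst t) (fst s)" for s t
      using com[of s t] that \<open>set us = U\<close> \<open>set vs = set us\<close> by blast
  qed
qed

lemma stratum_prod_closed: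
  assumes r: "realization G M F" and U: "U \<in> strata G"
  shows "stratum_prod G M F U \<in> carrier M"
proof -
  interpret M: group M using r by (rule realization_group)
  obtain us where us: "numbering G U us" using numbering_exists[OF U] by blast
  have "F \<in> set us \<rightarrow> carrier M" using us realization_Pi[OF r U] by (simp add: numbering_iff)
  then show ?thesis
    unfolding stratum_prod_numbering[OF r U us] by (rule M.eval_word_closed)
qed

lemma stratum_prod_empty: "realization G M F \<Longrightarrow> stratum_prod G M F {} = \<one>\<^bsub>M\<^esub>"
  using stratum_prod_numbering[of M F "{}" "[]"] strata_empty by (simp add: numbering_iff)

lemma stratum_prod_peel_max:
  assumes r: "realization G M F" and U: "U \<in> strata G" and t: "t \<in> U"
    and "\<And>s. s \<in> U \<Longrightarrow> \<not> lt G (fst t) (fst s)"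
  shows "stratum_prod G M F U = F t \<otimes>\<^bsub>M\<^esub> stratum_prod G M F (U - {t})"
proof -
  have Ut: "U - {t} \<in> strata G" using strata_subset[OF U] by blast
  obtain us where us: "numbering G (U - {t}) us" using numbering_exists[OF Ut] by blast
  show ?thesis
    using stratum_prod_numbering[OF r U numbering_peel(1)[OF U t us assms(4)]]
      stratum_prod_numbering[OF r Ut us] by simp
qed

lemma stratum_prod_peel_min:
  assumes r: "realization G M F" and U: "U \<in> strata G" and t: "t \<in> U"
    and "\<And>s. s \<in> U \<Longrightarrow> \<not> lt G (fst s) (fst t)"
  shows "stratum_prod G M F U = stratum_prod G M F (U - {t}) \<otimes>\<^bsub>M\<^esub> F t"
proof -
  interpret M: group M using r by (rule realization_group)
  have Ut: "U - {t} \<in> strata G" using strata_subset[OF U] by blast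
  obtain us where us: "numbering G (U - {t}) us" using numbering_exists[OF Ut] by blast
  have "F \<in> set us \<union> set [t] \<rightarrow> carrier M"
    using realization_Pi[OF r U] us t by (auto simp: numbering_iff)
  moreover from this have "F t \<in> carrier M" by simp
  ultimately have "eval_word M F (us @ [t]) = eval_word M F us \<otimes>\<^bsub>M\<^esub> F t"
    using M.eval_word_append[of F us "[t]"] by simp
  then show ?thesis
    using stratum_prod_numbering[OF r U numbering_peel(2)[OF U t us assms(4)]]
      stratum_prod_numbering[OF r Ut us] by simp
qed

lemma stratum_perm_carrier: "U \<in> strata G \<Longrightarrow> stratum_perm G U \<in> carrier (BijGroup UNIV)"
  unfolding stratum_perm_def by (rule stratum_prod_closed[OF realization_act])

lemma stratum_perm_eq_iff: "U \<in> strata G \<Longrightarrow> stratum_perm G U x = stratum_perm G U y \<longleftrightarrow> x = y"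
  using stratum_perm_carrier by (auto simp: carrier_BijGroup_UNIV bij_def dest: injD)

lemma stratum_perm_empty: "stratum_perm G {} x = x"
  unfolding stratum_perm_def stratum_prod_empty[OF realization_act] by (simp add: one_BijGroup_apply)

lemma stratum_perm_peel_max:
  assumes "U \<in> strata G" "t \<in> U" "\<And>s. s \<in> U \<Longrightarrow> \<not> lt G (fst t) (fst s)"
  shows "stratum_perm G U z = act G (fst t) (snd t) (stratum_perm G (U - {t}) z)"
proof -
  have "U - {t} \<in> strata G" using strata_subset[OF assms(1)] by blast
  then show ?thesis
    unfolding stratum_perm_def
    by (simp add: stratum_prod_peel_max[OF realization_act assms] case_prod_beta
        mult_BijGroup_apply act_carrier stratum_prod_closed[OF realization_act])
qed

lemma stratum_perm_fixes:
  assumes "U \<in> strata G" "\<And>t. t \<in> supp U \<Longrightarrow> \<not> lt G z t"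
  shows "stratum_perm G U z = z"
  using assms
proof (induction rule: stratum_induct)
  case (peel U t)
  have "\<And>s. s \<in> supp (U - {t}) \<Longrightarrow> \<not> lt G z s" using peel.prems supp_Diff[of U t] by blast
  then have "stratum_perm G (U - {t}) z = z" by (rule peel.IH)
  moreover have "\<not> lt G z (fst t)" using peel.prems peel.hyps(2) by (auto simp: supp_def)
  ultimately show ?case using stratum_perm_peel_max[OF peel.hyps(1-3)] by (simp add: act_fixes)
qed (simp add: stratum_perm_empty)

lemma mu_stratum_perm: "U \<in> strata G \<Longrightarrow> mu G (stratum_perm G U x) = mu G x"
proof (induction rule: stratum_induct)
  case (peel U t)
  then show ?case by (simp add: stratum_perm_peel_max[OF peel.hyps(1-3)])
qed (simp add: stratum_perm_empty)

lemma red_stratum_perm: "U \<in> strata G \<Longrightarrow> red G (stratum_perm G U x) a = red G x a"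
  by (simp add: red_def mu_stratum_perm)

lemma stratum_perm_verts: "U \<in> strata G \<Longrightarrow> stratum_perm G U x \<in> verts G \<longleftrightarrow> x \<in> verts G"
proof (induction rule: stratum_induct)
  case (peel U t)
  then show ?case by (simp add: stratum_perm_peel_max[OF peel.hyps(1-3)] act_verts)
qed (simp add: stratum_perm_empty)

definition common_star :: "'v stratum \<Rightarrow> 'v set" where
  "common_star U = (\<Inter>t \<in> supp U. star G t)"

lemma common_star_Diff: "x \<in> common_star U \<Longrightarrow> x \<in> common_star (U - {t})"
  using supp_Diff[of U t] by (auto simp: common_star_def)

lemma supp_common_star: "U \<in> strata G \<Longrightarrow> x \<in> supp U \<Longrightarrow> x \<in> common_star U"
  using supp_star by (auto simp: common_star_def)

text \<open>
  The action of a maximal vertex \<open>t\<close> respects adjacency and order only on the star of \<open>t\<close>, so the images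
  under the other factors, which act before, must be known to lie there. They do: these factors fix
  \<open>t\<close> by maximality, and by induction they preserve adjacency to \<open>t\<close>.
\<close>

lemma stratum_perm_adj_lt:
  assumes "U \<in> strata G" "y \<in> common_star U" "z \<in> common_star U"
  shows "(adj G (stratum_perm G U y) (stratum_perm G U z) \<longleftrightarrow> adj G y z) \<and>
    (lt G (stratum_perm G U y) (stratum_perm G U z) \<longleftrightarrow> lt G y z)"
  using assms
proof (induction arbitrary: y z rule: stratum_induct)
  case (peel U t)
  let ?p = "stratum_perm G (U - {t})"
  have Ut: "U - {t} \<in> strata G" using strata_subset[OF peel.hyps(1)] by blast
  have ts: "fst t \<in> supp U" using peel.hyps(2) by (simp add: supp_def)
  then have tv: "fst t \<in> verts G" using supp_verts peel.hyps(1) by blast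
  have fix_t: "?p (fst t) = fst t"
    using peel.hyps(3) by (intro stratum_perm_fixes[OF Ut]) (auto simp: supp_def)
  have star: "?p w \<in> star G (fst t)" if "w \<in> common_star U" for w
  proof -
    have "w \<in> star G (fst t)" using that ts by (auto simp: common_star_def)
    moreover have "adj G (?p (fst t)) (?p w) \<longleftrightarrow> adj G (fst t) w"
      using peel.IH[of "fst t" w] common_star_Diff that supp_common_star[OF peel.hyps(1) ts] by blast
    ultimately show ?thesis using fix_t tv by (auto simp: star_iff)
  qed
  show ?case
    using act_adj_lt[OF star[OF peel.prems(1)] star[OF peel.prems(2)], of "snd t"]
      peel.IH[OF common_star_Diff[OF peel.prems(1)] common_star_Diff[OF peel.prems(2)]]
    by (simp add: stratum_perm_peel_max[OF peel.hyps(1-3)])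
qed (simp add: stratum_perm_empty)

lemma stratum_perm_star_max:
  assumes U: "U \<in> strata G" and t: "t \<in> U" "\<And>s. s \<in> U \<Longrightarrow> \<not> lt G (fst t) (fst s)"
    and x: "x \<in> common_star U"
  shows "stratum_perm G (U - {t}) x \<in> star G (fst t)"
proof -
  have Ut: "U - {t} \<in> strata G" using strata_subset[OF U] by blast
  have ts: "fst t \<in> supp U" using t by (simp add: supp_def)
  have "stratum_perm G (U - {t}) (fst t) = fst t"
    using t by (intro stratum_perm_fixes[OF Ut]) (auto simp: supp_def)
  moreover have "x \<in> star G (fst t)" using x ts by (auto simp: common_star_def)
  ultimately show ?thesis
    using stratum_perm_adj_lt[OF Ut, of "fst t" x] common_star_Diff x supp_common_star[OF U ts]
      supp_verts[OF U ts] by (auto simp: star_iff)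
qed

lemma foldr_phi_pow:
  assumes "U \<in> strata G" "numbering G U us" "x \<in> common_star U"
  shows "foldr (\<lambda>(x, a). phi_pow G x a) us x = stratum_perm G U x"
  using assms
proof (induction us arbitrary: U)
  case Nil
  then show ?case by (simp add: numbering_iff stratum_perm_empty)
next
  case (Cons t us)
  have Ut: "U - {t} \<in> strata G" using strata_subset[OF Cons.prems(1)] by blast
  have n: "numbering G (U - {t}) us" and tU: "t \<in> U"
    and t: "\<And>s. s \<in> U \<Longrightarrow> \<not> lt G (fst t) (fst s)"
    using Cons.prems(2) lt_irrefl by (auto simp: numbering_iff)
  have "fst t \<in> verts G" using tU strataD(2)[OF Cons.prems(1)] by (cases t) auto
  then show ?case
    using Cons.IH[OF Ut n common_star_Diff[OF Cons.prems(3)]]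
      phi_pow_eq_act stratum_perm_star_max[OF Cons.prems(1) tU t Cons.prems(3)]
    by (simp add: stratum_perm_peel_max[OF Cons.prems(1) tU t] case_prod_beta)
qed

lemma stratum_perm_numbering_append:
  assumes "U \<in> strata G" "numbering G U (us @ vs)"
  shows "stratum_perm G U x = stratum_perm G (set us) (stratum_perm G (set vs) x)"
proof -
  interpret S: group "BijGroup (UNIV :: 'v set)" by (rule group_BijGroup)
  let ?F = "\<lambda>(x, a). act G x a"
  have sub: "set us \<in> strata G" "set vs \<in> strata G"
    using assms strata_subset by (auto simp: numbering_iff)
  have n: "numbering G (set us) us" "numbering G (set vs) vs"
    using assms(2) by (auto simp: numbering_iff sorted_wrt_append)
  have F: "?F \<in> A \<rightarrow> carrier (BijGroup UNIV)" for A :: "'v stratum" by (auto simp: act_carrier)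
  show ?thesis
    unfolding stratum_perm_def stratum_prod_numbering[OF realization_act assms]
      stratum_prod_numbering[OF realization_act sub(1) n(1)]
      stratum_prod_numbering[OF realization_act sub(2) n(2)]
    using F by (simp add: S.eval_word_append mult_BijGroup_apply S.eval_word_closed)
qed

text \<open>
  The syllables after \<open>s\<close> in a numbering do not move its vertex, so the product over the prefix that
  defines \<open>gamma\<close> may be completed to the product over the whole stratum.
\<close>

lemma gamma_eq:
  assumes U: "U \<in> strata G" and s: "s \<in> U"
  shows "gamma G U s = (stratum_perm G U (fst s), snd s)"
proof -
  define us where "us = (SOME us. numbering G U us)"
  have n: "numbering G U us" using numbering_some[OF U] by (simp add: us_def)
  have "s \<in> set us" using n s by (simp add: numbering_iff)
  then obtain u1 u2 where us: "us = u1 @ s # u2" by (meson split_list)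
  have "s \<notin> set u1" using n by (simp add: numbering_iff us)
  then have prefix: "takeWhile (\<lambda>t. t \<noteq> s) us = u1" unfolding us by (subst takeWhile_append2) auto
  have n1: "numbering G (set u1) u1" and n2: "numbering G (set (s # u2)) (s # u2)"
    using n us by (auto simp: numbering_iff sorted_wrt_append)
  have sub: "set u1 \<in> strata G" "set (s # u2) \<in> strata G" "set u1 \<subseteq> U"
    using n us strata_subset[OF U] by (auto simp: numbering_iff)
  have "stratum_perm G (set (s # u2)) (fst s) = fst s"
    using n2 lt_irrefl by (intro stratum_perm_fixes[OF sub(2)]) (auto simp: numbering_iff supp_def)
  moreover have "fst s \<in> common_star (set u1)"
    using supp_common_star[OF U, of "fst s"] s sub(3) by (auto simp: common_star_def supp_def)
  ultimately have "foldr (\<lambda>(x, a). phi_pow G x a) u1 (fst s) = stratum_perm G U (fst s)"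
    using foldr_phi_pow[OF sub(1) n1] stratum_perm_numbering_append[OF U n[unfolded us]] by simp
  then show ?thesis using prefix by (simp add: gamma_def us_def)
qed

text \<open>
  Commuting a syllable to the front of its stratum: past a larger vertex it is renamed, and past an
  incomparable one it is unchanged.
\<close>

lemma stratum_prod_gamma:
  assumes r: "realization G M F" and "U \<in> strata G" "(x, a) \<in> U"
  shows "stratum_prod G M F U =
    F (stratum_perm G U x, a) \<otimes>\<^bsub>M\<^esub> stratum_prod G M F (U - {(x, a)})"
  using assms(2,3)
proof (induction rule: stratum_induct)
  case (peel U t)
  interpret M: group M using r by (rule realization_group)
  note U = peel.hyps(1) and t = peel.hyps(2,3)
  have Ut: "U - {t} \<in> strata G" using strata_subset[OF U] by blast
  note peelt = stratum_prod_peel_max[OF r U t]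
  have xs: "x \<in> supp U" using peel.prems by (rule suppI)
  show ?case
  proof (cases "t = (x, a)")
    case True
    then have "stratum_perm G U x = x"
      using t by (intro stratum_perm_fixes[OF U]) (auto simp: supp_def)
    then show ?thesis using peelt True by simp
  next
    case False
    obtain z c where zc: "t = (z, c)" by (cases t)
    have zU: "(z, c) \<in> U" using t(1) unfolding zc .
    have zx: "z \<noteq> x"
    proof
      assume "z = x"
      with zU have "c = a" by (intro strataD(5)[OF U _ peel.prems]) simp
      with \<open>z = x\<close> False zc show False by simp
    qed
    have zv: "z \<in> verts G" and zs: "z \<in> supp U"
      by (rule strataD(2)[OF U zU], rule suppI[OF zU])
    define y where "y = stratum_perm G (U - {t}) x"
    have pz: "stratum_perm G (U - {t}) z = z"
      using t(2) zc by (intro stratum_perm_fixes[OF Ut]) (auto simp: supp_def)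
    have "adj G z x" using strataD(6)[OF U zU peel.prems zx] .
    have cs: "z \<in> common_star (U - {t})" "x \<in> common_star (U - {t})"
      using common_star_Diff supp_common_star[OF U] zs xs by blast+
    have zy: "adj G z y" and nlt: "\<not> lt G z y"
      using stratum_perm_adj_lt[OF Ut cs] pz \<open>adj G z x\<close> t(2)[OF peel.prems]
      by (simp_all add: y_def zc)
    have yv: "y \<in> verts G" "act G z c y \<in> verts G" using adj_verts[OF zy] act_verts by blast+
    have mem: "(x, a) \<in> U - {t}" "t \<in> U - {(x, a)}" using peel.prems False t(1) by blast+
    have Ux: "U - {(x, a)} \<in> strata G" and Utx: "U - {t} - {(x, a)} \<in> strata G"
      by (rule strata_subset[OF U], blast)+
    let ?P = "stratum_prod G M F (U - {t} - {(x, a)})"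
    have P: "?P \<in> carrier M" using stratum_prod_closed[OF r Utx] .
    have F: "F (z, c) \<in> carrier M" "F (y, a) \<in> carrier M" "F (act G z c y, a) \<in> carrier M"
      using realization_closed[OF r] zv yv by blast+
    have "stratum_prod G M F U = F t \<otimes>\<^bsub>M\<^esub> stratum_prod G M F (U - {t})" by (rule peelt)
    also have "stratum_prod G M F (U - {t}) = F (y, a) \<otimes>\<^bsub>M\<^esub> ?P"
      unfolding y_def by (rule peel.IH[OF mem(1)])
    also have "F t = F (z, c)" by (simp only: zc)
    also have "F (z, c) \<otimes>\<^bsub>M\<^esub> (F (y, a) \<otimes>\<^bsub>M\<^esub> ?P) = (F (z, c) \<otimes>\<^bsub>M\<^esub> F (y, a)) \<otimes>\<^bsub>M\<^esub> ?P" using F P by (simp add: M.m_assoc)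
    also have "F (z, c) \<otimes>\<^bsub>M\<^esub> F (y, a) = F (act G z c y, a) \<otimes>\<^bsub>M\<^esub> F (z, c)"
      using realization_swap[OF r zy, of c a] act_fixes[OF nlt, of a] by (simp only:)
    also have "(F (act G z c y, a) \<otimes>\<^bsub>M\<^esub> F (z, c)) \<otimes>\<^bsub>M\<^esub> ?P =
        F (act G z c y, a) \<otimes>\<^bsub>M\<^esub> (F (z, c) \<otimes>\<^bsub>M\<^esub> ?P)"
      using F P by (simp add: M.m_assoc)
    also have "F (z, c) \<otimes>\<^bsub>M\<^esub> ?P = stratum_prod G M F (U - {(x, a)})"
    proof -
      have "U - {(x, a)} - {t} = U - {t} - {(x, a)}" by blast
      moreover have "stratum_prod G M F (U - {(x, a)}) =
          F t \<otimes>\<^bsub>M\<^esub> stratum_prod G M F (U - {(x, a)} - {t})"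
        by (rule stratum_prod_peel_max[OF r Ux mem(2)]) (rule t(2), blast)
      ultimately show ?thesis by (simp only: zc)
    qed
    also have "act G z c y = stratum_perm G U x"
      using stratum_perm_peel_max[OF U t, of x] by (simp only: y_def zc fst_conv snd_conv)
    finally show ?thesis .
  qed
qed simp

lemma stratum_perm_gamma:
  assumes "U \<in> strata G" "(x, a) \<in> U"
  shows "stratum_perm G U z = act G (stratum_perm G U x) a (stratum_perm G (U - {(x, a)}) z)"
proof -
  have "U - {(x, a)} \<in> strata G" using strata_subset[OF assms(1)] by blast
  then have "stratum_prod G (BijGroup UNIV) (\<lambda>(x, a). act G x a) (U - {(x, a)}) \<in> carrier (BijGroup UNIV)"
    by (rule stratum_prod_closed[OF realization_act])
  then show ?thesis
    using fun_cong[OF stratum_prod_gamma[OF realization_act assms], of z]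
    by (simp add: stratum_perm_def mult_BijGroup_apply act_carrier)
qed

end

section \<open>Adding a syllable to a stratum\<close>

text \<open>
  The exponent \<open>0\<close> stands for a missing syllable. This merges the three cases in the definition of
  \<open>add_syll\<close> into the single formula \<open>expo_add_syll\<close>, and equalities of strata are proved by comparing
  exponents.
\<close>

definition expo :: "'v stratum \<Rightarrow> 'v \<Rightarrow> int" where
  "expo U x = (if x \<in> supp U then THE a. (x, a) \<in> U else 0)"

lemma nonzero_eqI: "(\<And>c. c \<noteq> 0 \<Longrightarrow> e = c \<longleftrightarrow> e' = c) \<Longrightarrow> e = (e' :: int)"
  by metis

context trickle_graph
begin

lemma expo_mem:
  assumes "U \<in> strata G" "(x, a) \<in> U"
  shows "expo U x = a"
proof -
  have "(THE b. (x, b) \<in> U) = a"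
    by (rule the_equality[where P = "\<lambda>b. (x, b) \<in> U", OF assms(2)]) (rule strataD(5)[OF assms(1) _ assms(2)])
  then show ?thesis using suppI[OF assms(2)] by (simp add: expo_def)
qed

lemma mem_iff_expo:
  assumes "U \<in> strata G"
  shows "(x, a) \<in> U \<longleftrightarrow> a \<noteq> 0 \<and> expo U x = a"
proof
  assume "(x, a) \<in> U"
  then show "a \<noteq> 0 \<and> expo U x = a" using expo_mem[OF assms] strataD(3)[OF assms] by simp
next
  assume a: "a \<noteq> 0 \<and> expo U x = a"
  then have "x \<in> supp U" by (auto simp: expo_def split: if_splits)
  then obtain b where "(x, b) \<in> U" by (auto simp: supp_iff)
  then show "(x, a) \<in> U" using expo_mem[OF assms] a by simp
qed

lemma strata_eqI:
  assumes "U \<in> strata G" "V \<in> strata G" "\<And>x. expo U x = expo V x"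
  shows "U = V"
  using mem_iff_expo[OF assms(1)] mem_iff_expo[OF assms(2)] assms(3) by (simp add: set_eq_iff)

lemma red_expo:
  assumes "U \<in> strata G"
  shows "red G x (expo U x) = expo U x"
proof (cases "expo U x = 0")
  case False
  then have "(x, expo U x) \<in> U" using mem_iff_expo[OF assms] by simp
  then show ?thesis by (rule strataD(4)[OF assms])
qed simp

lemma expo_remove:
  assumes "U \<in> strata G"
  shows "expo (U - {(x, expo U x)}) v = (if v = x then 0 else expo U v)"
proof -
  let ?U = "U - {(x, expo U x)}"
  have U': "?U \<in> strata G" by (rule strata_subset[OF assms]) blast
  have mem: "c \<noteq> 0 \<and> expo ?U v = c \<longleftrightarrow> (c \<noteq> 0 \<and> expo U v = c) \<and> (v, c) \<noteq> (x, expo U x)" for c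
    using mem_iff_expo[OF U', of v c] mem_iff_expo[OF assms, of v c] by simp
  show ?thesis
  proof (cases "v = x")
    case True
    then show ?thesis using mem[of "expo ?U v"] by auto
  next
    case False
    have "expo ?U v = expo U v"
    proof (rule nonzero_eqI)
      show "expo ?U v = c \<longleftrightarrow> expo U v = c" if "c \<noteq> 0" for c
        using mem[of c] that False by simp
    qed
    then show ?thesis using False by simp
  qed
qed

lemma can_add_iff:
  assumes U: "U \<in> strata G" and y: "y \<in> verts G"
  shows "can_add G U (y, b) \<longleftrightarrow> supp U \<subseteq> star G y"
proof (cases "y \<in> supp U")
  case True
  then show ?thesis using supp_star[OF U True] by (auto simp: can_add_def)
next
  case False
  then have "x \<in> star G y \<longleftrightarrow> {y, x} \<in> edges G" if "x \<in> supp U" for x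
    using star_iff[OF y, of x] that by (auto simp: adj_def)
  with False show ?thesis by (auto simp: can_add_def)
qed

lemma add_syll_eq:
  assumes U: "U \<in> strata G" and yb: "(y, b) \<in> syllables G" and s: "supp U \<subseteq> star G y"
  shows "add_syll G U (y, b) = {(act G y (- b) x, a) | x a. (x, a) \<in> U \<and> x \<noteq> y} \<union>
    (let c = red G y (expo U y + b) in if c = 0 then {} else {(y, c)})"
proof -
  have y: "y \<in> verts G" and b: "b \<noteq> 0" "red G y b = b" using yb by (simp_all add: syllables_iff)
  have "phi_pow G y (- b) x = act G y (- b) x" if "(x, a) \<in> U" for x a
    using phi_pow_eq_act[OF y] s suppI[OF that] by blast
  then have W: "{(phi_pow G y (- b) x, a) | x a. (x, a) \<in> U \<and> x \<noteq> y} =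
      {(act G y (- b) x, a) | x a. (x, a) \<in> U \<and> x \<noteq> y}"
    by (metis (no_types, lifting))
  show ?thesis
  proof (cases "y \<in> supp U")
    case True
    then have "(THE a. (y, a) \<in> U) = expo U y" by (simp add: expo_def)
    then show ?thesis using True by (simp add: add_syll_def W Zmu_eq[OF y] Let_def)
  next
    case False
    then have "expo U y = 0" by (simp add: expo_def)
    then show ?thesis using False b by (simp add: add_syll_def W Let_def)
  qed
qed

lemma mem_add_syll:
  assumes "U \<in> strata G" "(y, b) \<in> syllables G" "supp U \<subseteq> star G y"
  shows "(v, c) \<in> add_syll G U (y, b) \<longleftrightarrow>
    (if v = y then c \<noteq> 0 \<and> c = red G y (expo U y + b) else (act G y b v, c) \<in> U)"
proof -
  have "v = act G y (- b) x \<longleftrightarrow> x = act G y b v" for x by (metis act_cancel)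
  then show ?thesis unfolding add_syll_eq[OF assms] Let_def by auto
qed

lemma add_syll_strata:
  assumes U: "U \<in> strata G" and yb: "(y, b) \<in> syllables G" and s: "supp U \<subseteq> star G y"
  shows "add_syll G U (y, b) \<in> strata G"
proof (rule strataI)
  note mem = mem_add_syll[OF assms]
  have y: "y \<in> verts G" using yb by (simp add: syllables_iff)
  have "{(act G y (- b) x, a) | x a. (x, a) \<in> U \<and> x \<noteq> y} \<subseteq> (\<lambda>(x, a). (act G y (- b) x, a)) ` U"
    by force
  then have "finite {(act G y (- b) x, a) | x a. (x, a) \<in> U \<and> x \<noteq> y}"
    by (rule finite_subset) (simp add: strataD(1)[OF U])
  then show "finite (add_syll G U (y, b))" unfolding add_syll_eq[OF assms] Let_def by simp
  show "v \<in> verts G \<and> c \<noteq> 0 \<and> red G v c = c" if "(v, c) \<in> add_syll G U (y, b)" for v c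
  proof (cases "v = y")
    case False
    then have m: "(act G y b v, c) \<in> U" using that mem by simp
    show ?thesis using strataD(2-4)[OF U m] by (simp add: act_verts)
  qed (use that mem y in simp)
  show "c = d" if "(v, c) \<in> add_syll G U (y, b)" "(v, d) \<in> add_syll G U (y, b)" for v c d
  proof (cases "v = y")
    case False
    then have "(act G y b v, c) \<in> U" "(act G y b v, d) \<in> U" using that mem by simp_all
    then show ?thesis by (rule strataD(5)[OF U])
  qed (use that mem in simp)
  have star: "v \<in> star G y" if "(act G y b v, c) \<in> U" for v c
    using suppI[OF that] s act_star[of y b v] by blast
  show "adj G v w" if "(v, c) \<in> add_syll G U (y, b)" "(w, d) \<in> add_syll G U (y, b)" "v \<noteq> w" for v w c d
  proof -
    have v: "(act G y b v, c) \<in> U" if "v \<noteq> y" using mem[of v c] that \<open>(v, c) \<in> _\<close> by simp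
    have w: "(act G y b w, d) \<in> U" if "w \<noteq> y" using mem[of w d] that \<open>(w, d) \<in> _\<close> by simp
    consider "v = y" "w \<noteq> y" | "w = y" "v \<noteq> y" | "v \<noteq> y" "w \<noteq> y" using \<open>v \<noteq> w\<close> by blast
    then show ?thesis
    proof cases
      case 1
      then show ?thesis using star[OF w] star_iff[OF y, of w] by simp
    next
      case 2
      then show ?thesis using star[OF v] star_iff[OF y, of v] adj_sym[of G y v] by simp
    next
      case 3
      have "adj G (act G y b v) (act G y b w)"
        using that(3) by (intro strataD(6)[OF U v[OF 3(1)] w[OF 3(2)]]) simp
      then show ?thesis using act_adj_lt(1)[OF star[OF v[OF 3(1)]] star[OF w[OF 3(2)]]] by simp
    qed
  qed
qed

lemma expo_add_syll:
  assumes U: "U \<in> strata G" and yb: "(y, b) \<in> syllables G" and s: "supp U \<subseteq> star G y"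
  shows "expo (add_syll G U (y, b)) v =
    red G v (expo U (act G y b v) + (if v = y then b else 0))" (is "_ = ?e")
proof -
  have "(v, c) \<in> add_syll G U (y, b) \<longleftrightarrow> c \<noteq> 0 \<and> ?e = c" for c
  proof (cases "v = y")
    case True
    then show ?thesis using mem_add_syll[OF assms, of v c] by auto
  next
    case False
    have "red G v (expo U (act G y b v)) = expo U (act G y b v)"
      using red_expo[OF U, of "act G y b v"] by simp
    then show ?thesis
      using False mem_add_syll[OF assms, of v c] mem_iff_expo[OF U, of "act G y b v" c] by simp
  qed
  then show ?thesis
    using mem_iff_expo[OF add_syll_strata[OF assms], of v] by metis
qed

lemma supp_add_syll:
  assumes "U \<in> strata G" "(y, b) \<in> syllables G" "supp U \<subseteq> star G y"
  shows "v \<in> supp (add_syll G U (y, b)) \<Longrightarrow> v = y \<or> act G y b v \<in> supp U"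
    and "supp (add_syll G U (y, b)) \<subseteq> star G y"
proof -
  show 1: "v = y \<or> act G y b v \<in> supp U" if "v \<in> supp (add_syll G U (y, b))" for v
    using that mem_add_syll[OF assms, of v] by (auto simp: supp_iff split: if_splits)
  show "supp (add_syll G U (y, b)) \<subseteq> star G y"
    using 1 assms(3) act_star[of y b] star_self[of y] by blast
qed

lemma card_add_syll:
  assumes "U \<in> strata G" "(y, b) \<in> syllables G" "supp U \<subseteq> star G y"
  shows "card (add_syll G U (y, b)) \<le> Suc (card U)"
proof -
  let ?f = "\<lambda>(x, a). (act G y (- b) x, a)" and ?c = "(y, red G y (expo U y + b))"
  have fin: "finite U" using assms(1) by (rule strataD(1))
  have "add_syll G U (y, b) \<subseteq> insert ?c (?f ` U)"
    unfolding add_syll_eq[OF assms] Let_def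
  proof (rule Un_least)
    show "{(act G y (- b) x, a) | x a. (x, a) \<in> U \<and> x \<noteq> y} \<subseteq> insert ?c (?f ` U)" by force
  qed simp
  then have "card (add_syll G U (y, b)) \<le> card (insert ?c (?f ` U))"
    using fin by (intro card_mono) auto
  also have "\<dots> \<le> Suc (card (?f ` U))" using fin by (simp add: card_insert_if)
  also have "\<dots> \<le> Suc (card U)" using card_image_le[OF fin] by simp
  finally show ?thesis .
qed

text \<open>
  If \<open>y\<close> does not occur in \<open>U\<close>, then its exponent is \<open>0\<close> and the split-off factor is the unit.
\<close>

lemma stratum_prod_peel_min_expo:
  assumes r: "realization G M F" and U: "U \<in> strata G" and y: "y \<in> verts G"
    and min: "\<And>s. s \<in> U \<Longrightarrow> \<not> lt G (fst s) y"
  shows "stratum_prod G M F U = stratum_prod G M F (U - {(y, expo U y)}) \<otimes>\<^bsub>M\<^esub> F (y, expo U y)"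
proof (cases "expo U y = 0")
  case True
  interpret M: group M using r by (rule realization_group)
  have "(y, 0) \<notin> U" using mem_iff_expo[OF U] by blast
  then show ?thesis using True realization_0[OF r y] stratum_prod_closed[OF r U] by simp
next
  case False
  then have "(y, expo U y) \<in> U" using mem_iff_expo[OF U] by simp
  then show ?thesis using min by (intro stratum_prod_peel_min[OF r U]) simp_all
qed

text \<open>
  The new syllable is inserted at the place of its vertex: the syllables on smaller vertices, which
  come last in the product, are passed one by one, smallest first, and get renamed.
\<close>

lemma stratum_prod_add_syll:
  assumes r: "realization G M F" and "U \<in> strata G" and yb: "(y, b) \<in> syllables G"
    and "supp U \<subseteq> star G y"
  shows "stratum_prod G M F (add_syll G U (y, b)) = stratum_prod G M F U \<otimes>\<^bsub>M\<^esub> F (y, b)"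
  using assms(2,4)
proof (induction "card U" arbitrary: U rule: less_induct)
  case less
  interpret M: group M using r by (rule realization_group)
  note U = less.prems(1) and s = less.prems(2)
  have y: "y \<in> verts G" using yb by (simp add: syllables_iff)
  let ?R = "add_syll G U (y, b)"
  note mem = mem_add_syll[OF U yb s]
  have R: "?R \<in> strata G" by (rule add_syll_strata[OF U yb s])
  have Fy: "F (y, a) \<in> carrier M" for a by (rule realization_closed[OF r y])
  show ?case
  proof (cases "\<exists>t \<in> U. lt G (fst t) y")
    case False
    \<comment> \<open>Only the exponent of \<open>y\<close> changes, and \<open>y\<close> can be placed last in both products.\<close>
    have minR: "\<not> lt G (fst t) y" if "t \<in> ?R" for t
    proof -
      obtain v c where vc: "t = (v, c)" by (cases t)
      show ?thesis
      proof (cases "v = y")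
        case True
        then show ?thesis using vc lt_irrefl by simp
      next
        case ne: False
        then have "(act G y b v, c) \<in> U" using that mem vc by simp
        then show ?thesis using False act_lt_self[of y b v] vc by force
      qed
    qed
    have minU: "\<not> lt G (fst t) y" if "t \<in> U" for t using False that by blast
    have U0: "U - {(y, expo U y)} \<in> strata G" and R0: "?R - {(y, expo ?R y)} \<in> strata G"
      using strata_subset[OF U Diff_subset] strata_subset[OF R Diff_subset] by simp_all
    have eq: "?R - {(y, expo ?R y)} = U - {(y, expo U y)}"
    proof (rule strata_eqI[OF R0 U0])
      fix v
      have "expo ?R v = expo U v" if "v \<noteq> y"
      proof (cases "lt G v y")
        case True
        then have "v \<notin> supp U" "act G y b v \<notin> supp U"
          using False act_lt_self[of y b v] by (auto simp: supp_def)
        then have "expo U v = 0" "expo U (act G y b v) = 0" by (simp_all add: expo_def)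
        then show ?thesis using that by (simp add: expo_add_syll[OF U yb s])
      next
        case nlt: False
        then show ?thesis using that by (simp add: expo_add_syll[OF U yb s] act_fixes red_expo[OF U])
      qed
      then show "expo (?R - {(y, expo ?R y)}) v = expo (U - {(y, expo U y)}) v"
        by (simp add: expo_remove[OF R] expo_remove[OF U])
    qed
    have P: "stratum_prod G M F (U - {(y, expo U y)}) \<in> carrier M" by (rule stratum_prod_closed[OF r U0])
    have "F (y, expo ?R y) = F (y, expo U y + b)"
      by (simp add: expo_add_syll[OF U yb s] realization_red[OF r y])
    also have "\<dots> = F (y, expo U y) \<otimes>\<^bsub>M\<^esub> F (y, b)" by (rule realization_add[OF r y])
    finally have "F (y, expo ?R y) = F (y, expo U y) \<otimes>\<^bsub>M\<^esub> F (y, b)" .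
    then have "stratum_prod G M F ?R =
        stratum_prod G M F (U - {(y, expo U y)}) \<otimes>\<^bsub>M\<^esub> (F (y, expo U y) \<otimes>\<^bsub>M\<^esub> F (y, b))"
      using stratum_prod_peel_min_expo[OF r R y minR] eq by simp
    also have "\<dots> = stratum_prod G M F (U - {(y, expo U y)}) \<otimes>\<^bsub>M\<^esub> F (y, expo U y) \<otimes>\<^bsub>M\<^esub> F (y, b)"
      using P Fy by (simp add: M.m_assoc)
    also have "stratum_prod G M F (U - {(y, expo U y)}) \<otimes>\<^bsub>M\<^esub> F (y, expo U y) = stratum_prod G M F U"
      using stratum_prod_peel_min_expo[OF r U y minU] by simp
    finally show ?thesis .
  next
    case True
    define A where "A = {t \<in> U. lt G (fst t) y}"
    have "finite A" "A \<noteq> {}" using True strataD(1)[OF U] by (auto simp: A_def)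
    then obtain t where tA: "t \<in> A" and minA: "\<And>s. s \<in> A \<Longrightarrow> \<not> lt G (fst s) (fst t)"
      using stratum_has_minimal by metis
    obtain z d where zd: "t = (z, d)" by (cases t)
    have zU: "(z, d) \<in> U" and zy: "lt G z y" using tA by (simp_all add: A_def zd)
    have minU: "\<not> lt G (fst s) z" if "s \<in> U" for s
      using that minA[of s] lt_trans[of "fst s" z y] zy by (auto simp: A_def zd)
    define w where "w = act G y (- b) z"
    have w: "act G y b w = z" "w \<noteq> y" "lt G w y"
      using zy lt_irrefl act_lt_self[of y "- b" z] by (auto simp: w_def)
    have wz: "lt G v w \<longleftrightarrow> lt G (act G y b v) z" if "v \<in> star G y" for v
      using act_adj_lt(2)[OF that lt_star[OF w(3)], of b] w(1) by simp
    have wR: "(w, d) \<in> ?R" using mem[of w d] w zU by simp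
    have minR: "\<not> lt G (fst u) (fst (w, d))" if "u \<in> ?R" for u
    proof -
      obtain v c where vc: "u = (v, c)" by (cases u)
      show ?thesis
      proof (cases "v = y")
        case True
        then show ?thesis using vc lt_asym[OF w(3)] by simp
      next
        case False
        then have vU: "(act G y b v, c) \<in> U" using that mem vc by simp
        then have "v \<in> star G y" using s suppI[OF vU] act_star[of y b v] by blast
        then show ?thesis using wz minU[OF vU] vc by simp
      qed
    qed
    let ?U = "U - {(z, d)}"
    have U': "?U \<in> strata G" and s': "supp ?U \<subseteq> star G y"
      using strata_subset[OF U Diff_subset] subset_trans[OF supp_Diff s] by simp_all
    have zne: "z \<noteq> y" using zy lt_irrefl by blast
    have "expo ?U y = expo U y"
      using expo_remove[OF U, of z y] expo_mem[OF U zU] zne by simp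
    have diff: "?R - {(w, d)} = add_syll G ?U (y, b)"
    proof (rule Set.set_eqI)
      fix u :: "'v syllable"
      obtain v c where vc: "u = (v, c)" by (cases u)
      have "act G y b v = z \<longleftrightarrow> v = w" using w(1) act_eq_iff[of y b v w] by simp
      then show "u \<in> ?R - {(w, d)} \<longleftrightarrow> u \<in> add_syll G ?U (y, b)"
        using mem[of v c] mem_add_syll[OF U' yb s', of v c] \<open>expo ?U y = expo U y\<close> w(2) vc
        by (cases "v = y") auto
    qed
    have "card ?U < card U" using zU strataD(1)[OF U] by (intro card_Diff1_less)
    then have IH: "stratum_prod G M F (add_syll G ?U (y, b)) = stratum_prod G M F ?U \<otimes>\<^bsub>M\<^esub> F (y, b)"
      using less.hyps U' s' by blast
    have "adj G y w" by (rule lt_adj[OF w(3)])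
    then have "F (z, d) \<otimes>\<^bsub>M\<^esub> F (y, b) = F (act G w d y, b) \<otimes>\<^bsub>M\<^esub> F (w, d)"
      using realization_swap[OF r, of y w b d] w(1) by simp
    also have "act G w d y = y" using lt_asym[OF w(3)] by (rule act_fixes)
    finally have swap: "F (z, d) \<otimes>\<^bsub>M\<^esub> F (y, b) = F (y, b) \<otimes>\<^bsub>M\<^esub> F (w, d)" .
    have P: "stratum_prod G M F ?U \<in> carrier M" by (rule stratum_prod_closed[OF r U'])
    have Fz: "F (z, d) \<in> carrier M" "F (w, d) \<in> carrier M"
      using realization_closed[OF r] lt_verts[OF zy] lt_verts[OF w(3)] by simp_all
    have "stratum_prod G M F ?R = stratum_prod G M F ?U \<otimes>\<^bsub>M\<^esub> F (y, b) \<otimes>\<^bsub>M\<^esub> F (w, d)"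
      using stratum_prod_peel_min[OF r R wR minR] diff IH by simp
    also have "\<dots> = stratum_prod G M F ?U \<otimes>\<^bsub>M\<^esub> (F (z, d) \<otimes>\<^bsub>M\<^esub> F (y, b))"
      unfolding swap using P Fz Fy by (simp add: M.m_assoc)
    also have "\<dots> = stratum_prod G M F ?U \<otimes>\<^bsub>M\<^esub> F (z, d) \<otimes>\<^bsub>M\<^esub> F (y, b)"
      using P Fz Fy by (simp add: M.m_assoc)
    also have "stratum_prod G M F ?U \<otimes>\<^bsub>M\<^esub> F (z, d) = stratum_prod G M F U"
      using stratum_prod_peel_min[OF r U zU] minU by simp
    finally show ?thesis .
  qed
qed

lemma stratum_perm_add_syll:
  assumes "U \<in> strata G" "(y, b) \<in> syllables G" "supp U \<subseteq> star G y"
  shows "stratum_perm G (add_syll G U (y, b)) z = stratum_perm G U (act G y b z)"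
proof -
  have "stratum_prod G (BijGroup UNIV) (\<lambda>(x, a). act G x a) U \<in> carrier (BijGroup UNIV)"
    by (rule stratum_prod_closed[OF realization_act assms(1)])
  then show ?thesis
    using fun_cong[OF stratum_prod_add_syll[OF realization_act assms], of z]
    by (simp add: stratum_perm_def mult_BijGroup_apply act_carrier)
qed

lemma act_red: "y \<in> verts G \<Longrightarrow> act G y (red G y a) z = act G y a z"
  using fun_cong[OF realization_red[OF realization_act, of y a], of z] by simp

section \<open>T-transformations\<close>

lemma gamma_syllable:
  assumes "V \<in> strata G" "(x, a) \<in> V"
  shows "(stratum_perm G V x, a) \<in> syllables G"
  using strataD(2-4)[OF assms] stratum_perm_verts[OF assms(1)] red_stratum_perm[OF assms(1)]
  by (simp add: syllables_iff)

lemma T_transformation_iff: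
  assumes "U \<in> strata G" "V \<in> strata G"
  shows "([U, V], p) \<in> T_transformations G \<longleftrightarrow>
    (\<exists>x a. (x, a) \<in> V \<and> supp U \<subseteq> star G (stratum_perm G V x) \<and>
       p = [add_syll G U (stratum_perm G V x, a), V - {(x, a)}])"
proof -
  let ?T = "\<lambda>s. can_add G U (gamma G V s) \<and> p = [add_syll G U (gamma G V s), remove_syll V s]"
  let ?M = "\<lambda>x a. supp U \<subseteq> star G (stratum_perm G V x) \<and>
    p = [add_syll G U (stratum_perm G V x, a), V - {(x, a)}]"
  have TM: "?T (x, a) \<longleftrightarrow> ?M x a" if "(x, a) \<in> V" for x a
  proof -
    have "stratum_perm G V x \<in> verts G" using gamma_syllable[OF assms(2) that] by (simp add: syllables_iff)
    then show ?thesis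
      by (simp add: gamma_eq[OF assms(2) that] can_add_iff[OF assms(1)] remove_syll_def)
  qed
  have "(\<exists>s \<in> V. P s) \<longleftrightarrow> (\<exists>x a. (x, a) \<in> V \<and> P (x, a))" for P by auto
  then have "(\<exists>s \<in> V. ?T s) \<longleftrightarrow> (\<exists>x a. (x, a) \<in> V \<and> ?T (x, a))" .
  also have "\<dots> \<longleftrightarrow> (\<exists>x a. (x, a) \<in> V \<and> ?M x a)" by (intro ex_cong1 conj_cong refl TM)
  finally have "(\<exists>s \<in> V. ?T s) \<longleftrightarrow> (\<exists>x a. (x, a) \<in> V \<and> ?M x a)" .
  moreover have "([U, V], p) \<in> T_transformations G \<longleftrightarrow> (\<exists>s \<in> V. ?T s)"
    using assms by (auto simp: T_transformations_def)
  ultimately show ?thesis by simp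
qed

lemma trickle_rewriting_cases:
  assumes "(u, v) \<in> trickle_rewriting G"
  obtains "u = [{}]" "v = []"
  | U V x a where "U \<in> strata G" "V \<in> strata G" "(x, a) \<in> V"
      "supp U \<subseteq> star G (stratum_perm G V x)"
      "u = [U, V]" "v = [add_syll G U (stratum_perm G V x, a), V - {(x, a)}]"
proof -
  consider "(u, v) \<in> R0" | "(u, v) \<in> T_transformations G"
    using assms by (auto simp: trickle_rewriting_def)
  then show thesis
  proof cases
    case 1
    then show thesis using that(1) by (simp add: R0_def)
  next
    case 2
    then obtain U V where UV: "u = [U, V]" "U \<in> strata G" "V \<in> strata G"
      unfolding T_transformations_def by blast
    then show thesis using that(2) 2 T_transformation_iff by blast
  qed
qed

lemma trickle_rewriting_lists: "trickle_rewriting G \<subseteq> lists (strata G) \<times> lists (strata G)"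
proof (rule subrelI)
  fix u v assume "(u, v) \<in> trickle_rewriting G"
  then show "(u, v) \<in> lists (strata G) \<times> lists (strata G)"
  proof (cases rule: trickle_rewriting_cases)
    case 1
    then show ?thesis by (simp add: strata_empty)
  next
    case (2 U V x a)
    have "add_syll G U (stratum_perm G V x, a) \<in> strata G"
      by (rule add_syll_strata[OF 2(1) gamma_syllable[OF 2(2,3)] 2(4)])
    moreover have "V - {(x, a)} \<in> strata G" by (rule strata_subset[OF 2(2)]) blast
    ultimately show ?thesis using 2 by simp
  qed
qed

abbreviation piling_step :: "'v piling \<Rightarrow> 'v piling \<Rightarrow> bool" where
  "piling_step \<equiv> rewrite (strata G) (trickle_rewriting G)"

lemma piling_step_move:
  assumes "U \<in> strata G" "V \<in> strata G" "(x, a) \<in> V" "stratum_perm G V x = y" "supp U \<subseteq> star G y"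
  shows "piling_step [U, V] [add_syll G U (y, a), V - {(x, a)}]"
  using assms T_transformation_iff[OF assms(1,2)]
  by (intro rewrite_rule) (auto simp: trickle_rewriting_def)

lemma piling_step_empty: "piling_step [{}] []"
  by (intro rewrite_rule) (simp add: trickle_rewriting_def R0_def)

definition relabel :: "('v \<Rightarrow> 'v) \<Rightarrow> 'v stratum \<Rightarrow> 'v stratum" where
  "relabel f S = (\<lambda>(x, a). (f x, a)) ` S"

lemma mem_relabel: "(y, a) \<in> relabel f S \<longleftrightarrow> (\<exists>x. y = f x \<and> (x, a) \<in> S)"
  by (force simp: relabel_def)

lemma common_star_mono: "B \<subseteq> V \<Longrightarrow> common_star V \<subseteq> common_star B"
  by (auto simp: common_star_def supp_def)

lemma stratum_perm_adj:
  assumes V: "V \<in> strata G" and B: "B \<subseteq> V" and "(x, a) \<in> V" "(y, b) \<in> V" "x \<noteq> y"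
  shows "adj G (stratum_perm G B x) (stratum_perm G B y)"
proof -
  have "x \<in> common_star B" "y \<in> common_star B"
    using supp_common_star[OF V] common_star_mono[OF B] suppI[OF assms(3)] suppI[OF assms(4)] by auto
  then show ?thesis
    using stratum_perm_adj_lt[OF strata_subset[OF V B]] strataD(6)[OF V assms(3-5)] by simp
qed

lemma relabel_strata:
  assumes V: "V \<in> strata G" and B: "B \<subseteq> V" and S: "S \<subseteq> V"
  shows "relabel (stratum_perm G B) S \<in> strata G"
proof (rule strataI)
  have B': "B \<in> strata G" and S': "S \<in> strata G" using strata_subset[OF V] B S by blast+
  show "finite (relabel (stratum_perm G B) S)" using strataD(1)[OF S'] by (simp add: relabel_def)
  show "y \<in> verts G \<and> a \<noteq> 0 \<and> red G y a = a" if y: "(y, a) \<in> relabel (stratum_perm G B) S" for y a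
  proof -
    obtain x where x: "y = stratum_perm G B x" "(x, a) \<in> S" using y unfolding mem_relabel by blast
    then show ?thesis
      using strataD(2-4)[OF S' x(2)] by (simp add: stratum_perm_verts[OF B'] red_stratum_perm[OF B'])
  qed
  show "a = b" if y: "(y, a) \<in> relabel (stratum_perm G B) S" "(y, b) \<in> relabel (stratum_perm G B) S" for y a b
  proof -
    obtain x x' where x: "y = stratum_perm G B x" "(x, a) \<in> S" "y = stratum_perm G B x'" "(x', b) \<in> S"
      using y unfolding mem_relabel by blast
    then have "x = x'" using stratum_perm_eq_iff[OF B'] by simp
    then show ?thesis using x strataD(5)[OF S'] by simp
  qed
  show "adj G y z" if y: "(y, a) \<in> relabel (stratum_perm G B) S" "(z, b) \<in> relabel (stratum_perm G B) S"
    "y \<noteq> z" for y z a b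
  proof -
    obtain x x' where x: "y = stratum_perm G B x" "(x, a) \<in> S" "z = stratum_perm G B x'" "(x', b) \<in> S"
      using y(1,2) unfolding mem_relabel by blast
    then show ?thesis using y(3) S by (auto intro!: stratum_perm_adj[OF V B])
  qed
qed

text \<open>
  The vertices of \<open>V - B\<close> appear on the left under their names before passing \<open>B\<close>. Each syllable that is
  moved over from \<open>B\<close> renames them by the inverse of its own action, which strips its factor from the
  permutation of \<open>B\<close>, so the first stratum keeps its form while \<open>B\<close> shrinks.
\<close>

lemma piling_step_merge:
  assumes V: "V \<in> strata G" and "B \<subseteq> V"
  shows "piling_step\<^sup>*\<^sup>* [relabel (stratum_perm G B) (V - B), B] [V]"
  using assms(2)
proof (induction "card B" arbitrary: B)
  case 0
  then have B: "B = {}" using strataD(1)[OF V] finite_subset by fastforce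
  have "piling_step ([V] @ [{}] @ []) ([V] @ [] @ [])"
    using V by (intro rewrite_context[OF piling_step_empty]) auto
  moreover have "relabel (stratum_perm G {}) V = V"
    by (auto simp: relabel_def stratum_perm_empty image_def)
  ultimately show ?case using B by auto
next
  case (Suc n)
  have B: "B \<in> strata G" by (rule strata_subset[OF V Suc.prems])
  have "B \<noteq> {}" using Suc.hyps(2) by auto
  then obtain x a where xB: "(x, a) \<in> B" by auto
  define y where "y = stratum_perm G B x"
  let ?B = "B - {(x, a)}" and ?A = "relabel (stratum_perm G B) (V - B)"
  have B': "?B \<in> strata G" by (rule strata_subset[OF B]) blast
  have A: "?A \<in> strata G" by (rule relabel_strata[OF V Suc.prems]) blast
  have yz: "adj G y z" if "z \<in> supp ?A" for z
  proof -
    obtain u c where u: "z = stratum_perm G B u" "(u, c) \<in> V - B"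
      using \<open>z \<in> supp ?A\<close> by (auto simp: supp_iff mem_relabel)
    have "u \<noteq> x" using u(2) xB strataD(5)[OF V, of u c a] Suc.prems by auto
    then show ?thesis
      unfolding u(1) y_def using u(2) xB Suc.prems
      by (intro stratum_perm_adj[OF V Suc.prems, of x a u c]) auto
  qed
  have yn: "y \<notin> supp ?A" using yz[of y] adj_verts[of y y] by blast
  have ya: "(y, a) \<in> syllables G" unfolding y_def by (rule gamma_syllable[OF B xB])
  have yv: "y \<in> verts G" and a: "a \<noteq> 0" "red G y a = a" using ya by (simp_all add: syllables_iff)
  have star: "supp ?A \<subseteq> star G y" using yz star_iff[OF yv] by blast
  have p: "stratum_perm G B v = act G y a (stratum_perm G ?B v)" for v
    unfolding y_def by (rule stratum_perm_gamma[OF B xB])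
  have px: "stratum_perm G ?B x = y" using p[of x] act_eq_self_iff[of y a] by (metis y_def)
  have "add_syll G ?A (y, a) = relabel (act G y (- a)) ?A \<union> {(y, a)}"
    unfolding add_syll_eq[OF A ya star] Let_def using yn a
    by (force simp: expo_def relabel_def supp_iff)
  also have "relabel (act G y (- a)) ?A = relabel (stratum_perm G ?B) (V - B)"
    unfolding relabel_def image_image by (simp add: case_prod_beta p)
  also have "\<dots> \<union> {(y, a)} = relabel (stratum_perm G ?B) (V - ?B)"
  proof -
    have "V - ?B = insert (x, a) (V - B)" using xB Suc.prems by blast
    then show ?thesis by (simp add: relabel_def px)
  qed
  finally have add: "add_syll G ?A (y, a) = relabel (stratum_perm G ?B) (V - ?B)" .
  have "piling_step [?A, B] [add_syll G ?A (y, a), ?B]"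
    by (rule piling_step_move[OF A B xB y_def[symmetric] star])
  moreover have "card ?B = n" using Suc.hyps(2) xB strataD(1)[OF B] by simp
  ultimately show ?case
    using Suc.hyps(1)[of ?B] Suc.prems unfolding add by (meson Diff_subset converse_rtranclp_into_rtranclp subset_trans)
qed

end

section \<open>Termination\<close>

text \<open>
  A T-transformation moves a syllable one place to the left, possibly destroying it there, so the sum
  of the positions of all syllables drops. The additional term \<open>1\<close> per stratum accounts for the
  deletion of empty strata, and \<open>n\<close> is the position of the first stratum.
\<close>

fun weight :: "nat \<Rightarrow> 'v piling \<Rightarrow> nat" where
  "weight n [] = 0"
| "weight n (U # w) = Suc (n * card U + weight (Suc n) w)"

lemma weight_mono: "m \<le> n \<Longrightarrow> weight m w \<le> weight n w"
proof (induction w arbitrary: m n)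
  case (Cons U w)
  then have "weight (Suc m) w \<le> weight (Suc n) w" by simp
  with Cons.prems show ?case by (simp add: add_mono mult_le_mono1)
qed simp

lemma weight_append: "weight n (u @ v) = weight n u + weight (n + length u) v"
  by (induction u arbitrary: n) simp_all

context trickle_graph
begin

lemma weight_decreases:
  assumes "piling_step p q"
  shows "weight 0 q < weight 0 p"
proof -
  obtain w1 w2 u v where uv: "(u, v) \<in> trickle_rewriting G"
    and p: "p = w1 @ u @ w2" and q: "q = w1 @ v @ w2"
    using assms unfolding rewrite_def by blast
  let ?n = "length w1"
  from uv have "weight ?n (v @ w2) < weight ?n (u @ w2)"
  proof (cases rule: trickle_rewriting_cases)
    case 1
    then show ?thesis using weight_mono[of ?n "Suc ?n" w2] by simp
  next
    case (2 U V x a)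
    have "?n * card (add_syll G U (stratum_perm G V x, a)) \<le> ?n * Suc (card U)"
      using card_add_syll[OF 2(1) gamma_syllable[OF 2(2,3)] 2(4)] by (rule mult_le_mono2)
    moreover have "card V = Suc (card (V - {(x, a)}))"
      using 2(3) strataD(1)[OF 2(2)] by (metis card.remove)
    ultimately show ?thesis unfolding 2(5,6) by simp
  qed
  then show ?thesis unfolding p q weight_append[of 0] by simp
qed

lemma terminating_piling_step: "terminatingp piling_step"
  unfolding terminatingp_def
proof
  assume "\<exists>f. \<forall>i. piling_step (f i) (f (Suc i))"
  then obtain f where "\<And>i. piling_step (f i) (f (Suc i))" by blast
  then have "(f (Suc i), f i) \<in> measure (weight 0)" for i using weight_decreases by simp
  then show False using wf_measure[of "weight 0"] wf_iff_no_infinite_down_chain by metis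
qed

section \<open>Confluence\<close>

definition joinable :: "'v piling \<Rightarrow> 'v piling \<Rightarrow> bool" where
  "joinable p q \<longleftrightarrow> (\<exists>s. piling_step\<^sup>*\<^sup>* p s \<and> piling_step\<^sup>*\<^sup>* q s)"

lemma joinable_sym: "joinable p q \<Longrightarrow> joinable q p"
  by (auto simp: joinable_def)

lemma joinable_refl: "joinable p p"
  by (auto simp: joinable_def)

lemma joinable_context:
  assumes "joinable p q" "w1 \<in> lists (strata G)" "w2 \<in> lists (strata G)"
  shows "joinable (w1 @ p @ w2) (w1 @ q @ w2)"
  using assms(1) rtranclp_rewrite_context[OF _ assms(2,3)] unfolding joinable_def by blast

text \<open>
  Each of the two syllables is renamed by the other one when it comes second. That the total renaming
  of \<open>U\<close> does not depend on the order is the relation \<open>act_act\<close> with negated exponents.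
\<close>

lemma add_add_swap:
  assumes U: "U \<in> strata G" and ya: "(y, a) \<in> syllables G" and wc: "(w, c) \<in> syllables G"
    and sy: "supp U \<subseteq> star G y" and sw: "supp U \<subseteq> star G w" and yw: "adj G y w"
  defines "w' \<equiv> act G y (- a) w" and "y' \<equiv> act G w (- c) y"
  shows "(w', c) \<in> syllables G" and "supp (add_syll G U (y, a)) \<subseteq> star G w'"
    and "add_syll G (add_syll G U (y, a)) (w', c) = add_syll G (add_syll G U (w, c)) (y', a)"
proof -
  have syl: "(act G p i q, d) \<in> syllables G" if "(q, d) \<in> syllables G" for p i q d
    using that by (simp add: syllables_iff act_verts)
  have star: "supp (add_syll G U (p, i)) \<subseteq> star G (act G p (- i) q)"
    if p: "(p, i) \<in> syllables G" and "(q, d) \<in> syllables G" "adj G p q"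
      "supp U \<subseteq> star G p" "supp U \<subseteq> star G q" for p i q d
  proof
    fix v assume v: "v \<in> supp (add_syll G U (p, i))"
    have pv: "p \<in> verts G" and qv: "q \<in> verts G" using adj_verts[OF that(3)] by simp_all
    have qp: "q \<in> star G p" using star_iff[OF pv] that(3) by blast
    show "v \<in> star G (act G p (- i) q)"
    proof (cases "v = p")
      case True
      have "act G p (- i) q \<in> star G p" using qp act_star by blast
      then show ?thesis using star_sym[OF pv] True by blast
    next
      case False
      then have u: "act G p i v \<in> supp U" using supp_add_syll(1)[OF U p that(4) v] by blast
      have "act G p (- i) (act G p i v) \<in> star G (act G p (- i) q)"
        using u that(4,5) by (intro act_star_star[OF qv qp]) blast+
      then show ?thesis by simp
    qed
  qed
  show w'c: "(w', c) \<in> syllables G" unfolding w'_def by (rule syl[OF wc])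
  have y'a: "(y', a) \<in> syllables G" unfolding y'_def by (rule syl[OF ya])
  show s1: "supp (add_syll G U (y, a)) \<subseteq> star G w'"
    unfolding w'_def by (rule star[OF ya wc yw sy sw])
  have s2: "supp (add_syll G U (w, c)) \<subseteq> star G y'"
    unfolding y'_def by (rule star[OF wc ya adj_sym[OF yw] sw sy])
  have U1: "add_syll G U (y, a) \<in> strata G" and U2: "add_syll G U (w, c) \<in> strata G"
    using add_syll_strata[OF U ya sy] add_syll_strata[OF U wc sw] by simp_all
  show "add_syll G (add_syll G U (y, a)) (w', c) = add_syll G (add_syll G U (w, c)) (y', a)"
  proof (rule strata_eqI[OF add_syll_strata[OF U1 w'c s1] add_syll_strata[OF U2 y'a s2]])
    fix v
    have rel: "act G w' (- c) (act G y (- a) z) = act G y' (- a) (act G w (- c) z)" for z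
      unfolding w'_def y'_def by (rule act_act[OF yw])
    have 1: "act G y a (act G w' c v) = act G w c (act G y' a v)"
      using rel[of "act G y a (act G w' c v)"] by (metis act_cancel)
    have "act G w' (- c) y = y'" using rel[of y] by (simp add: y'_def[symmetric])
    then have 2: "act G w' c v = y \<longleftrightarrow> v = y'" by (metis act_cancel)
    have "w' = act G y' (- a) w" using rel[of w] by (simp add: w'_def[symmetric])
    then have 3: "act G y' a v = w \<longleftrightarrow> v = w'" by (metis act_cancel)
    show "expo (add_syll G (add_syll G U (y, a)) (w', c)) v =
        expo (add_syll G (add_syll G U (w, c)) (y', a)) v"
      unfolding expo_add_syll[OF U1 w'c s1] expo_add_syll[OF U2 y'a s2]
        expo_add_syll[OF U ya sy] expo_add_syll[OF U wc sw] 2 3 1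
      by (simp add: add_ac)
  qed
qed

lemma joinable_same_stratum:
  assumes U: "U \<in> strata G" and V: "V \<in> strata G" and xa: "(x, a) \<in> V" and zc: "(z, c) \<in> V"
    and sy: "supp U \<subseteq> star G (stratum_perm G V x)" and sw: "supp U \<subseteq> star G (stratum_perm G V z)"
  shows "joinable [add_syll G U (stratum_perm G V x, a), V - {(x, a)}]
    [add_syll G U (stratum_perm G V z, c), V - {(z, c)}]"
proof (cases "x = z")
  case True
  then have "a = c" using strataD(5)[OF V, of x a c] xa zc by simp
  then show ?thesis using True joinable_refl by simp
next
  case False
  define y w where "y = stratum_perm G V x" and "w = stratum_perm G V z"
  note sy = sy[folded y_def] and sw = sw[folded w_def]
  have yw: "adj G y w" unfolding y_def w_def by (rule stratum_perm_adj[OF V subset_refl xa zc False])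
  have ya: "(y, a) \<in> syllables G" unfolding y_def by (rule gamma_syllable[OF V xa])
  have wc: "(w, c) \<in> syllables G" unfolding w_def by (rule gamma_syllable[OF V zc])
  note swap = add_add_swap[OF U ya wc sy sw yw] and swap' = add_add_swap[OF U wc ya sw sy adj_sym[OF yw]]
  have U1: "add_syll G U (y, a) \<in> strata G" and U2: "add_syll G U (w, c) \<in> strata G"
    using add_syll_strata[OF U ya sy] add_syll_strata[OF U wc sw] by simp_all
  have V1: "V - {(x, a)} \<in> strata G" and V2: "V - {(z, c)} \<in> strata G"
    by (rule strata_subset[OF V], blast)+
  have m: "(z, c) \<in> V - {(x, a)}" "(x, a) \<in> V - {(z, c)}" using xa zc False by auto
  have p1: "stratum_perm G (V - {(x, a)}) z = act G y (- a) w"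
    using stratum_perm_gamma[OF V xa, of z] unfolding y_def[symmetric] w_def[symmetric] by simp
  have p2: "stratum_perm G (V - {(z, c)}) x = act G w (- c) y"
    using stratum_perm_gamma[OF V zc, of x] unfolding y_def[symmetric] w_def[symmetric] by simp
  have "V - {(x, a)} - {(z, c)} = V - {(z, c)} - {(x, a)}" by blast
  then have "piling_step [add_syll G U (w, c), V - {(z, c)}]
      [add_syll G (add_syll G U (y, a)) (act G y (- a) w, c), V - {(x, a)} - {(z, c)}]"
    unfolding swap(3) using piling_step_move[OF U2 V2 m(2) p2 swap'(2)] by simp
  moreover have "piling_step [add_syll G U (y, a), V - {(x, a)}]
      [add_syll G (add_syll G U (y, a)) (act G y (- a) w, c), V - {(x, a)} - {(z, c)}]"
    by (rule piling_step_move[OF U1 V1 m(1) p1 swap(2)])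
  ultimately show ?thesis
    unfolding joinable_def y_def[symmetric] w_def[symmetric] by blast
qed

lemma piling_step3_left:
  assumes "piling_step [U, V] [U', V']" "W \<in> strata G"
  shows "piling_step [U, V, W] [U', V', W]"
  using rewrite_context[OF assms(1), of "[]" "[W]"] assms(2) by simp

lemma piling_step3_right:
  assumes "piling_step [V, W] [V', W']" "U \<in> strata G"
  shows "piling_step [U, V, W] [U, V', W']"
  using rewrite_context[OF assms(1), of "[U]" "[]"] assms(2) by simp

lemma remove_add_syll:
  assumes V: "V \<in> strata G" and xa: "(x, a) \<in> V"
    and wc: "(w, c) \<in> syllables G" and s: "supp V \<subseteq> star G w" and xw: "x \<noteq> w"
  shows "add_syll G (V - {(x, a)}) (w, c) = add_syll G V (w, c) - {(act G w (- c) x, a)}"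
proof (rule Set.set_eqI)
  fix u :: "'v syllable"
  obtain v d where vd: "u = (v, d)" by (cases u)
  have V': "V - {(x, a)} \<in> strata G" by (rule strata_subset[OF V]) blast
  have s': "supp (V - {(x, a)}) \<subseteq> star G w" by (rule subset_trans[OF supp_Diff s])
  have "expo (V - {(x, a)}) w = expo V w"
    using expo_remove[OF V, of x w] expo_mem[OF V xa] xw by simp
  moreover have "v = act G w (- c) x \<longleftrightarrow> act G w c v = x" by (metis act_cancel)
  ultimately show "u \<in> add_syll G (V - {(x, a)}) (w, c) \<longleftrightarrow>
      u \<in> add_syll G V (w, c) - {(act G w (- c) x, a)}"
    using mem_add_syll[OF V' wc s', of v d] mem_add_syll[OF V wc s, of v d] xw vd
    by (cases "v = w") auto
qed

lemma add_add_same: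
  assumes U: "U \<in> strata G" and ya: "(y, a) \<in> syllables G" and yc: "(y, c) \<in> syllables G"
    and s: "supp U \<subseteq> star G y"
  shows "add_syll G (add_syll G U (y, a)) (y, c) =
    (if red G y (a + c) = 0 then U else add_syll G U (y, red G y (a + c)))"
proof -
  let ?e = "red G y (a + c)"
  have y: "y \<in> verts G" using ya by (simp add: syllables_iff)
  have U1: "add_syll G U (y, a) \<in> strata G" by (rule add_syll_strata[OF U ya s])
  have s1: "supp (add_syll G U (y, a)) \<subseteq> star G y" by (rule supp_add_syll(2)[OF U ya s])
  have R: "add_syll G (add_syll G U (y, a)) (y, c) \<in> strata G" by (rule add_syll_strata[OF U1 yc s1])
  have act: "act G y a (act G y c v) = act G y ?e v" for v
    by (simp add: act_red[OF y] act_add)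
  have e: "expo (add_syll G (add_syll G U (y, a)) (y, c)) v =
      red G v (expo U (act G y ?e v) + (if v = y then ?e else 0))" for v
    unfolding expo_add_syll[OF U1 yc s1] expo_add_syll[OF U ya s] act by (simp add: add_ac)
  show ?thesis
  proof (cases "?e = 0")
    case True
    have "add_syll G (add_syll G U (y, a)) (y, c) = U"
      by (rule strata_eqI[OF R U]) (simp add: e True red_expo[OF U])
    then show ?thesis using True by simp
  next
    case False
    then have ye: "(y, ?e) \<in> syllables G" using y by (simp add: syllables_iff)
    have "add_syll G (add_syll G U (y, a)) (y, c) = add_syll G U (y, ?e)"
      by (rule strata_eqI[OF R add_syll_strata[OF U ye s]]) (simp add: e expo_add_syll[OF U ye s])
    then show ?thesis using False by simp
  qed
qed

text \<open>
  The overlap of two moves in three consecutive strata. If the syllable that enters the middle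
  stratum merges with the one that leaves it, then on one side two moves with the same vertex
  correspond to a single move of their sum, or to none if they cancel.
\<close>

lemma joinable_overlap:
  assumes U: "U \<in> strata G" and V: "V \<in> strata G" and W: "W \<in> strata G"
    and xa: "(x, a) \<in> V" and sy: "supp U \<subseteq> star G (stratum_perm G V x)"
    and zc: "(z, c) \<in> W" and sw: "supp V \<subseteq> star G (stratum_perm G W z)"
  shows "joinable [add_syll G U (stratum_perm G V x, a), V - {(x, a)}, W]
    [U, add_syll G V (stratum_perm G W z, c), W - {(z, c)}]"
proof -
  define y w where "y = stratum_perm G V x" and "w = stratum_perm G W z"
  note sy = sy[folded y_def] and sw = sw[folded w_def]
  have ya: "(y, a) \<in> syllables G" unfolding y_def by (rule gamma_syllable[OF V xa])
  have wc: "(w, c) \<in> syllables G" unfolding w_def by (rule gamma_syllable[OF W zc])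
  let ?U1 = "add_syll G U (y, a)" and ?V1 = "V - {(x, a)}"
    and ?V2 = "add_syll G V (w, c)" and ?W = "W - {(z, c)}"
  have U1: "?U1 \<in> strata G" by (rule add_syll_strata[OF U ya sy])
  have V1: "?V1 \<in> strata G" by (rule strata_subset[OF V]) blast
  have V2: "?V2 \<in> strata G" by (rule add_syll_strata[OF V wc sw])
  have W': "?W \<in> strata G" by (rule strata_subset[OF W]) blast
  have s1: "supp ?V1 \<subseteq> star G w" by (rule subset_trans[OF supp_Diff sw])
  have perm2: "stratum_perm G ?V2 v = stratum_perm G V (act G w c v)" for v
    by (rule stratum_perm_add_syll[OF V wc sw])
  have left: "piling_step [?U1, ?V1, W] [?U1, add_syll G ?V1 (w, c), ?W]"
    by (rule piling_step3_right[OF piling_step_move[OF V1 W zc w_def[symmetric] s1] U1])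
  have "joinable [?U1, ?V1, W] [U, ?V2, ?W]"
  proof (cases "x = w")
    case False
    let ?x = "act G w (- c) x"
    have x2: "(?x, a) \<in> ?V2"
      using mem_add_syll[OF V wc sw, of ?x a] xa False by simp
    have "stratum_perm G ?V2 ?x = y" by (simp add: perm2 y_def)
    from piling_step3_left[OF piling_step_move[OF U V2 x2 this sy] W']
    have "piling_step [U, ?V2, ?W] [?U1, add_syll G ?V1 (w, c), ?W]"
      unfolding remove_add_syll[OF V xa wc sw False] .
    then show ?thesis using left unfolding joinable_def by blast
  next
    case True
    let ?e = "red G w (a + c)" and ?M = "add_syll G ?V1 (w, c)"
    have xv: "w \<in> verts G" and c0: "c \<noteq> 0" "red G w c = c" using wc by (simp_all add: syllables_iff)
    have yc: "(y, c) \<in> syllables G"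
      using wc True by (simp add: y_def syllables_iff stratum_perm_verts[OF V] red_stratum_perm[OF V])
    have M: "?M \<in> strata G" by (rule add_syll_strata[OF V1 wc s1])
    \<comment> \<open>Both before and after merging, the vertex \<open>w\<close> has the name \<open>y\<close> at the left end.\<close>
    have "y = act G y a (stratum_perm G ?V1 w)"
      using stratum_perm_gamma[OF V xa, of x] True unfolding y_def by simp
    then have y1: "stratum_perm G ?V1 w = y" using act_eq_self_iff[of y a] by metis
    have "expo ?V1 w = 0" using expo_remove[OF V, of x w] expo_mem[OF V xa] True by simp
    then have wM: "(w, c) \<in> ?M" using mem_add_syll[OF V1 wc s1, of w c] c0 by simp
    have "stratum_perm G ?M w = y"
      by (simp add: stratum_perm_add_syll[OF V1 wc s1] y1)
    from piling_step3_left[OF piling_step_move[OF U1 M wM this supp_add_syll(2)[OF U ya sy]] W']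
    have l: "piling_step\<^sup>*\<^sup>* [?U1, ?V1, W] [add_syll G ?U1 (y, c), ?M - {(w, c)}, ?W]"
      using left by (meson converse_rtranclp_into_rtranclp rtranclp.rtrancl_refl)
    have e2: "expo ?V2 w = ?e"
      using expo_add_syll[OF V wc sw, of w] expo_mem[OF V xa] True by simp
    have middle: "?M - {(w, c)} = ?V2 - {(w, ?e)}"
    proof (rule Set.set_eqI)
      fix u :: "'v syllable"
      obtain v d where vd: "u = (v, d)" by (cases u)
      show "u \<in> ?M - {(w, c)} \<longleftrightarrow> u \<in> ?V2 - {(w, ?e)}"
      proof (cases "v = w")
        case vw: True
        have "expo ?M w = c" by (rule expo_mem[OF M wM])
        then show ?thesis
          using mem_iff_expo[OF M, of w d] mem_iff_expo[OF V2, of w d] e2 vd vw by auto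
      next
        case vw: False
        then have "act G w c v \<noteq> x" using True by simp
        then show ?thesis
          using mem_add_syll[OF V1 wc s1, of v d] mem_add_syll[OF V wc sw, of v d] vd vw by simp
      qed
    qed
    have "red G y (a + c) = ?e"
      using True by (simp add: y_def red_stratum_perm[OF V])
    note same = add_add_same[OF U ya yc sy, unfolded this]
    have l: "piling_step\<^sup>*\<^sup>* [?U1, ?V1, W]
        [if ?e = 0 then U else add_syll G U (y, ?e), ?V2 - {(w, ?e)}, ?W]"
      using l unfolding middle same .
    show ?thesis
    proof (cases "?e = 0")
      case e0: True
      then have "(w, ?e) \<notin> ?V2" using mem_iff_expo[OF V2, of w ?e] by simp
      then show ?thesis using l e0 unfolding joinable_def by auto
    next
      case e0: False
      then have we: "(w, ?e) \<in> ?V2" using mem_iff_expo[OF V2, of w ?e] e2 by simp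
      have "stratum_perm G ?V2 w = y" using True by (simp add: perm2 y_def)
      from piling_step3_left[OF piling_step_move[OF U V2 we this sy] W']
      show ?thesis using l e0 unfolding joinable_def by auto
    qed
  qed
  then show ?thesis by (simp add: y_def w_def)
qed

text \<open>
  The first move into an empty stratum can be continued until the whole neighbour has moved, which
  leaves an empty stratum on the other side.
\<close>

lemma joinable_empty:
  assumes V: "V \<in> strata G" and xa: "(x, a) \<in> V"
  shows "joinable [V] [add_syll G {} (stratum_perm G V x, a), V - {(x, a)}]"
proof -
  let ?B = "V - {(x, a)}" and ?y = "stratum_perm G V x"
  have ya: "(?y, a) \<in> syllables G" by (rule gamma_syllable[OF V xa])
  have "add_syll G {} (?y, a) = {(?y, a)}" by (simp add: add_syll_def supp_def)
  moreover have "relabel (stratum_perm G ?B) (V - ?B) = {(?y, a)}"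
  proof -
    have "?y = act G ?y a (stratum_perm G ?B x)" by (rule stratum_perm_gamma[OF V xa])
    then have "stratum_perm G ?B x = ?y" using act_eq_self_iff[of ?y a] by metis
    moreover have "V - ?B = {(x, a)}" using xa by blast
    ultimately show ?thesis by (simp add: relabel_def)
  qed
  ultimately show ?thesis
    using piling_step_merge[OF V, of ?B] unfolding joinable_def by auto
qed

lemma append_eq_append_splitE:
  assumes "u @ v = u' @ v'" "length u \<le> length u'"
  obtains d where "u' = u @ d" "v = d @ v'"
proof -
  obtain us where "u = u' @ us \<and> us @ v = v' \<or> u @ us = u' \<and> v = us @ v'"
    using assms(1) unfolding append_eq_append_conv2 by blast
  then show thesis using that[of us] that[of "[]"] assms(2) by auto
qed

text \<open>
  The word \<open>d\<close> is the offset of the second redex in the first one. It has length \<open>0\<close> or \<open>1\<close>, as the left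
  sides of rules have length at most \<open>2\<close>.
\<close>

lemma joinable_rules:
  assumes r: "(u, v) \<in> trickle_rewriting G" and r': "(u', v') \<in> trickle_rewriting G"
    and eq: "u @ w = d @ u' @ w'" and d: "length d < length u"
    and w: "w \<in> lists (strata G)" "w' \<in> lists (strata G)"
  shows "joinable (v @ w) (d @ v' @ w')"
  using r
proof (cases rule: trickle_rewriting_cases)
  case 1
  then have d0: "d = []" using d by simp
  from r' show ?thesis
  proof (cases rule: trickle_rewriting_cases)
    case 1
    then show ?thesis using \<open>u = [{}]\<close> \<open>v = []\<close> d0 eq joinable_refl by simp
  next
    case (2 U V x a)
    then have "w = [V] @ w'" "U = {}" using 1 d0 eq by simp_all
    then show ?thesis
      using joinable_context[OF joinable_empty[OF 2(2,3)], of "[]" w'] w 1 d0 2 by simp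
  qed
next
  case (2 U V x a)
  note uv = 2
  from r' show ?thesis
  proof (cases rule: trickle_rewriting_cases)
    case 1
    consider "d = []" | "d = [U]" using d uv(5) eq by (cases d) (auto simp: less_Suc_eq)
    then show ?thesis
    proof cases
      case 1
      then have "U = {}" "w' = [V] @ w" using eq uv(5) \<open>u' = [{}]\<close> by simp_all
      then show ?thesis
        using joinable_context[OF joinable_sym[OF joinable_empty[OF uv(2,3)]], of "[]" w]
          w 1 uv(6) \<open>v' = []\<close> by simp
    next
      case 2
      then have "V = {}" using eq uv(5) 1 by simp
      then show ?thesis using uv(3) by simp
    qed
  next
    case (2 U' V' z c)
    consider "d = []" | "d = [U]" using d uv(5) eq by (cases d) (auto simp: less_Suc_eq)
    then show ?thesis
    proof cases
      case 1
      then have "U' = U" "V' = V" "w' = w" using eq uv(5) 2(5) by simp_all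
      then show ?thesis
        using joinable_context[OF joinable_same_stratum[OF uv(1,2,3) _ uv(4)], of z c "[]" w]
          2(3,4,6) uv(6) 1 w by simp
    next
      case d1: 2
      then have e: "U' = V" "w = [V'] @ w'" using eq uv(5) 2(5) by simp_all
      have "joinable ([add_syll G U (stratum_perm G V x, a), V - {(x, a)}, V'] @ w')
          ([U, add_syll G V (stratum_perm G V' z, c), V' - {(z, c)}] @ w')"
        using joinable_context[OF joinable_overlap[OF uv(1,2) 2(2) uv(3,4) 2(3)], of "[]" w']
          2(4) e(1) w by simp
      then show ?thesis using e d1 uv(6) 2(6) by simp
    qed
  qed
qed

lemma joinable_ordered:
  assumes r: "(u, v) \<in> trickle_rewriting G" and r': "(u', v') \<in> trickle_rewriting G"
    and eq: "w1 @ u @ w2 = w1' @ u' @ w2'" and len: "length w1 \<le> length w1'"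
    and w: "w1 \<in> lists (strata G)" "w2 \<in> lists (strata G)" "w1' \<in> lists (strata G)" "w2' \<in> lists (strata G)"
  shows "joinable (w1 @ v @ w2) (w1' @ v' @ w2')"
proof -
  obtain d where d: "w1' = w1 @ d" "u @ w2 = d @ u' @ w2'"
    by (rule append_eq_append_splitE[OF eq len])
  have dl: "d \<in> lists (strata G)" using w(3) d(1) by simp
  have vl: "v \<in> lists (strata G)" "v' \<in> lists (strata G)"
    using r r' trickle_rewriting_lists by auto
  have "joinable (v @ w2) (d @ v' @ w2')"
  proof (cases "length d < length u")
    case True
    then show ?thesis by (intro joinable_rules[OF r r' d(2)] w)
  next
    case False
    then have "length u \<le> length d" by simp
    then obtain e where e: "d = u @ e" "w2 = e @ u' @ w2'"
      by (rule append_eq_append_splitE[OF d(2)])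
    have el: "e \<in> lists (strata G)" using e(1) dl by simp
    have "piling_step ((v @ e) @ u' @ w2') ((v @ e) @ v' @ w2')"
      using vl el w(4) by (intro rewrite_context[OF rewrite_rule[OF r']]) simp_all
    moreover have "piling_step ([] @ u @ (e @ v' @ w2')) ([] @ v @ (e @ v' @ w2'))"
      using vl el w(4) by (intro rewrite_context[OF rewrite_rule[OF r]]) simp_all
    ultimately show ?thesis unfolding e joinable_def by auto
  qed
  from joinable_context[OF this w(1), of "[]"] show ?thesis by (simp add: d(1))
qed

lemma confluent_piling_step: "confluentp piling_step"
proof (rule newman[OF terminating_piling_step])
  fix p q q'
  assume "piling_step p q" "piling_step p q'"
  then obtain w1 w2 u v w1' w2' u' v' where
    r: "(u, v) \<in> trickle_rewriting G" "p = w1 @ u @ w2" "q = w1 @ v @ w2" and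
    r': "(u', v') \<in> trickle_rewriting G" "p = w1' @ u' @ w2'" "q' = w1' @ v' @ w2'" and
    w: "w1 \<in> lists (strata G)" "w2 \<in> lists (strata G)" "w1' \<in> lists (strata G)" "w2' \<in> lists (strata G)"
    unfolding rewrite_def by (elim bexE exE conjE) (rule that)
  have eq: "w1 @ u @ w2 = w1' @ u' @ w2'" using r(2) r'(2) by simp
  have "joinable q q'"
  proof (cases "length w1 \<le> length w1'")
    case True
    then show ?thesis unfolding r(3) r'(3) by (intro joinable_ordered[OF r(1) r'(1) eq _ w])
  next
    case False
    then show ?thesis unfolding r(3) r'(3)
      by (intro joinable_sym[OF joinable_ordered[OF r'(1) r(1) eq[symmetric] _ w(3,4,1,2)]]) simp
  qed
  then show "\<exists>s. piling_step\<^sup>*\<^sup>* q s \<and> piling_step\<^sup>*\<^sup>* q' s" unfolding joinable_def .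
qed

section \<open>The presentation\<close>

abbreviation group_class :: "'v signed list \<Rightarrow> 'v signed list set" where
  "group_class w \<equiv> word_cong (signed_letters (verts G)) (trickle_rels G \<union> cancel_rels (verts G)) `` {w}"

abbreviation piling_monoid :: "'v piling set monoid" where
  "piling_monoid \<equiv> presented_monoid (strata G) (trickle_rewriting G)"

abbreviation piling_class :: "'v piling \<Rightarrow> 'v piling set" where
  "piling_class w \<equiv> word_cong (strata G) (trickle_rewriting G) `` {w}"

lemma trickle_group_eq:
  "trickle_group G = presented_monoid (signed_letters (verts G)) (trickle_rels G \<union> cancel_rels (verts G))"
  by (simp add: trickle_group_def presented_group_def)

lemma signed_letters_verts [simp]:
  "x \<in> verts G \<Longrightarrow> Gen x \<in> signed_letters (verts G)"
  "x \<in> verts G \<Longrightarrow> Inv x \<in> signed_letters (verts G)"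
  by (simp_all add: signed_letters_def)

lemma group_rels_lists:
  "trickle_rels G \<union> cancel_rels (verts G) \<subseteq>
    lists (signed_letters (verts G)) \<times> lists (signed_letters (verts G))"
proof -
  have "phi G x y \<in> verts G \<and> phi G y x \<in> verts G \<and> x \<in> verts G \<and> y \<in> verts G" if "{x, y} \<in> edges G" for x y
  proof -
    have xy: "adj G x y" using that by (simp add: adj_def)
    then have v: "x \<in> verts G" "y \<in> verts G" using adj_verts by blast+
    then show ?thesis
      using phi_star[OF v(1), of y] phi_star[OF v(2), of x] star_iff xy adj_sym[OF xy] star_verts by metis
  qed
  then show ?thesis
    by (auto simp: trickle_rels_def cancel_rels_def in_lists_conv_set)
qed

lemma group_class_rel:
  assumes "(u, v) \<in> trickle_rels G \<union> cancel_rels (verts G)"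
  shows "group_class u = group_class v"
proof -
  have "u \<in> lists (signed_letters (verts G))" "v \<in> lists (signed_letters (verts G))"
    using group_rels_lists assms by blast+
  then show ?thesis
    by (intro word_cong_class_eqI) (simp_all add: r_into_rtranclp rewrite_rule[OF assms])
qed

lemma twist_adj: "adj G x y \<Longrightarrow> twist G x y = phi G x y"
  using adj_verts star_iff twist_eq_phi by blast

lemma realization_trickle_group:
  "realization G (trickle_group G) (\<lambda>(x, a). trickle_gen G x [^]\<^bsub>trickle_group G\<^esub> a)"
proof (rule realization_powers[OF group_trickle_group])
  interpret T: group "trickle_group G" by (rule group_trickle_group)
  have gen: "trickle_gen G x = group_class [Gen x]" for x by (simp add: trickle_gen_def)
  have cl: "trickle_gen G x \<in> carrier (trickle_group G)" if "x \<in> verts G" for x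
    unfolding gen trickle_group_eq by (rule presented_monoid_class_closed) (simp add: that)
  then show "trickle_gen G \<in> verts G \<rightarrow> carrier (trickle_group G)" by blast
  show "trickle_gen G x [^]\<^bsub>trickle_group G\<^esub> m = \<one>\<^bsub>trickle_group G\<^esub>"
    if x: "x \<in> verts G" and m: "mu G x = enat m" for x m
  proof -
    have "trickle_gen G x [^]\<^bsub>trickle_group G\<^esub> m =
        eval_word (trickle_group G) (\<lambda>l. group_class [l]) (replicate m (Gen x))"
      using T.eval_word_replicate[of "\<lambda>l. group_class [l]" "Gen x" m] cl[OF x] by (simp add: gen)
    also have "\<dots> = group_class (replicate m (Gen x))"
      unfolding trickle_group_eq using x by (intro eval_word_class) (simp add: in_lists_conv_set)
    also have "\<dots> = group_class []"
      using x m by (intro group_class_rel) (auto simp: trickle_rels_def)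
    finally show ?thesis by (simp add: trickle_group_eq presented_monoid_one)
  qed
  show "trickle_gen G (twist G x y) \<otimes>\<^bsub>trickle_group G\<^esub> trickle_gen G x =
      trickle_gen G (twist G y x) \<otimes>\<^bsub>trickle_group G\<^esub> trickle_gen G y" if xy: "adj G x y" for x y
  proof -
    have v: "x \<in> verts G" "y \<in> verts G" using adj_verts[OF xy] by simp_all
    have v': "twist G x y \<in> verts G" "twist G y x \<in> verts G"
      using act_verts[of x 1 y] act_verts[of y 1 x] v by (simp_all add: act_1)
    have "group_class [Gen (phi G x y), Gen x] = group_class [Gen (phi G y x), Gen y]"
      using xy by (intro group_class_rel) (auto simp: trickle_rels_def adj_def)
    then show ?thesis
      using v v' unfolding gen trickle_group_eq
      by (simp add: presented_monoid_mult twist_adj[OF xy] twist_adj[OF adj_sym[OF xy]])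
  qed
qed

lemma omega_eq:
  "omega G U = stratum_prod G (trickle_group G) (\<lambda>(x, a). trickle_gen G x [^]\<^bsub>trickle_group G\<^esub> a) U"
  unfolding omega_def stratum_prod_def eval_word_def
  by (rule foldr_cong) (simp_all add: case_prod_beta)

lemma piling_class_step:
  assumes "piling_step\<^sup>*\<^sup>* p q" "p \<in> lists (strata G)" "q \<in> lists (strata G)"
  shows "piling_class p = piling_class q"
  using assms by (rule word_cong_class_eqI)

lemma piling_class_empty: "piling_class [{}] = piling_class []"
  by (rule piling_class_step) (simp_all add: r_into_rtranclp piling_step_empty strata_empty)

text \<open>
  The case of \<open>piling_step_merge\<close> in which a single syllable stays behind.
\<close>

lemma piling_class_split:
  assumes V: "V \<in> strata G" and xa: "(x, a) \<in> V"
  shows "piling_class [{(stratum_perm G (V - {(x, a)}) x, a)}] \<otimes>\<^bsub>piling_monoid\<^esub>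
    piling_class [V - {(x, a)}] = piling_class [V]"
proof -
  let ?B = "V - {(x, a)}"
  have "V - ?B = {(x, a)}" using xa by blast
  then have r: "relabel (stratum_perm G ?B) (V - ?B) = {(stratum_perm G ?B x, a)}"
    by (simp add: relabel_def)
  have A: "{(stratum_perm G ?B x, a)} \<in> strata G"
    using relabel_strata[OF V, of ?B "V - ?B"] unfolding r by blast
  have B: "?B \<in> strata G" by (rule strata_subset[OF V]) blast
  have "piling_class [{(stratum_perm G ?B x, a)}, ?B] = piling_class [V]"
    using piling_step_merge[OF V, of ?B] A B V unfolding r by (intro piling_class_step) simp_all
  then show ?thesis using A B by (simp add: presented_monoid_mult)
qed

text \<open>
  The stratum whose class corresponds to the power of the generator \<open>x\<close> with exponent \<open>a\<close>.
\<close>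

definition single :: "'v \<Rightarrow> int \<Rightarrow> 'v stratum" where
  "single x a = (if red G x a = 0 then {} else {(x, red G x a)})"

lemma single_strata: "x \<in> verts G \<Longrightarrow> single x a \<in> strata G"
  by (rule strataI) (auto simp: single_def split: if_splits)

lemma expo_single: "x \<in> verts G \<Longrightarrow> expo (single x a) v = (if v = x then red G x a else 0)"
  by (simp add: single_def expo_def supp_def)

lemma single_syllable: "(x, a) \<in> syllables G \<Longrightarrow> single x a = {(x, a)}"
  by (simp add: single_def syllables_iff)

lemma piling_class_single_add:
  assumes x: "x \<in> verts G"
  shows "piling_class [single x a] \<otimes>\<^bsub>piling_monoid\<^esub> piling_class [single x b] = piling_class [single x (a + b)]"
proof -
  note S = single_strata[OF x]
  have "piling_step\<^sup>*\<^sup>* [single x a, single x b] [single x (a + b)]"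
  proof (cases "red G x b = 0")
    case True
    then have "single x b = {}" by (simp add: single_def)
    moreover have "single x (a + b) = single x a"
    proof -
      have "red G x (a + b) = red G x (a + red G x b)" by simp
      then show ?thesis unfolding single_def True by simp
    qed
    moreover have "piling_step ([single x a] @ [{}] @ []) ([single x a] @ [] @ [])"
      using S by (intro rewrite_context[OF piling_step_empty]) simp_all
    ultimately show ?thesis by auto
  next
    case False
    let ?b = "red G x b"
    have b: "(x, ?b) \<in> syllables G" using x False by (simp add: syllables_iff)
    have sb: "single x b = {(x, ?b)}" using False by (simp add: single_def)
    have s: "supp (single x a) \<subseteq> star G x" by (auto simp: single_def supp_def star_self)
    have p: "stratum_perm G (single x b) x = x"
      by (rule stratum_perm_fixes[OF S]) (auto simp: sb supp_def lt_irrefl)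
    have add: "add_syll G (single x a) (x, ?b) = single x (a + b)"
      by (rule strata_eqI[OF add_syll_strata[OF S b s] S])
        (auto simp: expo_add_syll[OF S b s] expo_single[OF x])
    have rest: "single x b - {(x, ?b)} = {}" and mem: "(x, ?b) \<in> single x b" by (simp_all add: sb)
    have "piling_step [single x a, single x b] [single x (a + b), {}]"
      using piling_step_move[OF S S mem p s] unfolding add rest .
    moreover have "piling_step ([single x (a + b)] @ [{}] @ []) ([single x (a + b)] @ [] @ [])"
      using S by (intro rewrite_context[OF piling_step_empty]) simp_all
    ultimately show ?thesis by (simp add: converse_rtranclp_into_rtranclp)
  qed
  then have "piling_class [single x a, single x b] = piling_class [single x (a + b)]"
    using S by (intro piling_class_step) simp_all
  then show ?thesis using S by (simp add: presented_monoid_mult)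
qed

lemma piling_class_single_0: "piling_class [single x 0] = \<one>\<^bsub>piling_monoid\<^esub>"
  using piling_class_empty by (simp add: single_def presented_monoid_one)

lemma piling_class_closed: "U \<in> strata G \<Longrightarrow> piling_class [U] \<in> carrier piling_monoid"
  by (rule presented_monoid_class_closed) simp

lemma piling_class_single_pow:
  assumes x: "x \<in> verts G"
  shows "piling_class [single x a] [^]\<^bsub>piling_monoid\<^esub> (n :: nat) = piling_class [single x (int n * a)]"
proof (induction n)
  case 0
  show ?case using piling_class_single_0 by simp
next
  case (Suc n)
  then show ?case using piling_class_single_add[OF x, of "int n * a" a] by (simp add: algebra_simps)
qed

text \<open>
  Both sides arise from the stratum with the syllables \<open>x\<^sup>1\<close> and \<open>y\<^sup>1\<close>, by pulling the one or the other
  to the left end.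
\<close>

lemma piling_class_edge:
  assumes xy: "adj G x y"
  shows "piling_class [{(twist G x y, 1)}] \<otimes>\<^bsub>piling_monoid\<^esub> piling_class [{(x, 1)}] =
    piling_class [{(twist G y x, 1)}] \<otimes>\<^bsub>piling_monoid\<^esub> piling_class [{(y, 1)}]"
proof -
  let ?V = "{(x, 1), (y, 1)} :: 'v stratum"
  have v: "x \<in> verts G" "y \<in> verts G" "x \<noteq> y" using adj_verts[OF xy] by simp_all
  have V: "?V \<in> strata G"
    using v red_1 xy adj_sym[OF xy] by (intro strataI) auto
  have p: "stratum_perm G {(z, 1)} u = twist G z u" if z: "z \<in> verts G" for z u
  proof -
    have "{(z, 1)} \<in> strata G" using red_1[OF z] z by (intro strataI) auto
    then show ?thesis
      using stratum_perm_peel_max[of "{(z, 1)}" "(z, 1)" u] lt_irrefl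
      by (simp add: stratum_perm_empty act_1)
  qed
  have d: "?V - {(y, 1)} = {(x, 1)}" "?V - {(x, 1)} = {(y, 1)}" using v(3) by auto
  show ?thesis
    using piling_class_split[OF V, of y 1] piling_class_split[OF V, of x 1]
    unfolding d p[OF v(1)] p[OF v(2)] by simp
qed

text \<open>
  The first syllable of a numbering is maximal, so it keeps its name when it is pulled to the left.
\<close>

lemma piling_class_prod:
  assumes "U \<in> strata G" "numbering G U us"
  shows "eval_word piling_monoid (\<lambda>s. piling_class [{s}]) us = piling_class [U]"
  using assms
proof (induction us arbitrary: U)
  case Nil
  then show ?case using piling_class_empty by (simp add: numbering_iff presented_monoid_one)
next
  case (Cons t us)
  obtain x a where t: "t = (x, a)" by (cases t)
  let ?B = "U - {(x, a)}"
  have tU: "(x, a) \<in> U" and n: "numbering G ?B us" and max: "\<And>s. s \<in> ?B \<Longrightarrow> \<not> lt G x (fst s)"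
    using Cons.prems(2) by (auto simp: numbering_iff t)
  have B: "?B \<in> strata G" by (rule strata_subset[OF Cons.prems(1)]) blast
  have "stratum_perm G ?B x = x"
    using max by (intro stratum_perm_fixes[OF B]) (auto simp: supp_def)
  then show ?case
    using piling_class_split[OF Cons.prems(1) tU] Cons.IH[OF B n] t by simp
qed

lemma trickle_rewriting_presentation:
  "has_monoid_presentation (trickle_group G) (strata G) (omega G) (trickle_rewriting G)"
proof -
  interpret T: group "trickle_group G" by (rule group_trickle_group)
  interpret P: monoid piling_monoid by (rule monoid_presented_monoid)
  let ?F = "\<lambda>(x, a :: int). trickle_gen G x [^]\<^bsub>trickle_group G\<^esub> a"
  let ?S = "signed_letters (verts G)" and ?R = "trickle_rels G \<union> cancel_rels (verts G)"
  note real = realization_trickle_group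
  have omega_closed: "omega G U \<in> carrier (trickle_group G)" if "U \<in> strata G" for U
    unfolding omega_eq by (rule stratum_prod_closed[OF real that])
  have gen: "trickle_gen G x = group_class [Gen x]" for x by (simp add: trickle_gen_def)
  have gen_closed: "trickle_gen G x \<in> carrier (trickle_group G)" if "x \<in> verts G" for x
    using realization_closed[OF real that, of 1] by (simp add: gen trickle_group_eq presented_monoid_class_closed that)

  have "eval_word (trickle_group G) (omega G) u = eval_word (trickle_group G) (omega G) v"
    if "(u, v) \<in> trickle_rewriting G" for u v
    using that
  proof (cases rule: trickle_rewriting_cases)
    case 1
    then show ?thesis by (simp add: omega_eq stratum_prod_empty[OF real])
  next
    case (2 U V x a)
    let ?y = "stratum_perm G V x"
    have ya: "(?y, a) \<in> syllables G" by (rule gamma_syllable[OF 2(2,3)])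
    then have yv: "?y \<in> verts G" by (simp add: syllables_iff)
    have V': "V - {(x, a)} \<in> strata G" by (rule strata_subset[OF 2(2)]) blast
    have F: "?F (?y, a) \<in> carrier (trickle_group G)" by (rule realization_closed[OF real yv])
    have "omega G V = ?F (?y, a) \<otimes>\<^bsub>trickle_group G\<^esub> omega G (V - {(x, a)})"
      unfolding omega_eq by (rule stratum_prod_gamma[OF real 2(2,3)])
    moreover have "omega G (add_syll G U (?y, a)) = omega G U \<otimes>\<^bsub>trickle_group G\<^esub> ?F (?y, a)"
      unfolding omega_eq by (rule stratum_prod_add_syll[OF real 2(1) ya 2(4)])
    ultimately show ?thesis
      using F omega_closed[OF 2(1)] omega_closed[OF V'] unfolding 2(5,6)
      by (simp add: T.m_assoc)
  qed
  then obtain h where h: "h \<in> hom piling_monoid (trickle_group G)"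
    "h \<one>\<^bsub>piling_monoid\<^esub> = \<one>\<^bsub>trickle_group G\<^esub>"
    "\<And>w. w \<in> lists (strata G) \<Longrightarrow> h (piling_class w) = eval_word (trickle_group G) (omega G) w"
    using presented_monoid_universal[OF T.is_monoid _ trickle_rewriting_lists, of "omega G"] omega_closed
    by (metis (no_types, lifting) Pi_I)

  define f where "f l = (case l of Gen x \<Rightarrow> piling_class [single x 1] | Inv x \<Rightarrow> piling_class [single x (- 1)])" for l
  have f: "f (Gen x) = piling_class [single x 1]" "f (Inv x) = piling_class [single x (- 1)]" for x
    by (simp_all add: f_def)
  have single_closed: "piling_class [single x a] \<in> carrier piling_monoid" if "x \<in> verts G" for x a
    by (rule piling_class_closed[OF single_strata[OF that]])
  have f_closed: "f \<in> ?S \<rightarrow> carrier piling_monoid"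
    using single_closed by (auto simp: signed_letters_def f)
  have "eval_word piling_monoid f u = eval_word piling_monoid f v" if uv: "(u, v) \<in> ?R" for u v
  proof -
    consider x m where "x \<in> verts G" "mu G x = enat m" "u = replicate m (Gen x)" "v = []"
      | x y where "adj G x y" "u = [Gen (phi G x y), Gen x]" "v = [Gen (phi G y x), Gen y]"
      | x where "x \<in> verts G" "u = [Gen x, Inv x]" "v = []"
      | x where "x \<in> verts G" "u = [Inv x, Gen x]" "v = []"
      using uv by (auto simp: trickle_rels_def cancel_rels_def adj_def)
    then show ?thesis
    proof cases
      case (1 x m)
      have "eval_word piling_monoid f u = piling_class [single x (int m)]"
        using P.eval_word_replicate[of f "Gen x" m] single_closed[OF 1(1)] piling_class_single_pow[OF 1(1), of 1 m]
        by (simp add: f 1(3))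
      also have "single x (int m) = single x 0" using 1(2) by (simp add: single_def red_def)
      finally show ?thesis using piling_class_single_0 1(4) by simp
    next
      case (2 x y)
      have v: "x \<in> verts G" "y \<in> verts G" using adj_verts[OF 2(1)] by simp_all
      have v': "twist G x y \<in> verts G" "twist G y x \<in> verts G"
        using act_verts[of x 1 y] act_verts[of y 1 x] v by (simp_all add: act_1)
      have s: "single z 1 = {(z, 1)}" if "z \<in> verts G" for z
        using red_1[OF that] by (simp add: single_def)
      have "piling_class [{(z, 1)}] \<in> carrier piling_monoid" if "z \<in> verts G" for z
        using single_closed[OF that, of 1] s[OF that] by simp
      then show ?thesis
        using piling_class_edge[OF 2(1)] v v' s twist_adj[OF 2(1)] twist_adj[OF adj_sym[OF 2(1)]]
        by (simp add: f 2(2,3))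
    next
      case (3 x)
      then show ?thesis
        using piling_class_single_add[OF 3(1), of 1 "- 1"] single_closed[OF 3(1)] piling_class_single_0
        by (simp add: f)
    next
      case (4 x)
      then show ?thesis
        using piling_class_single_add[OF 4(1), of "- 1" 1] single_closed[OF 4(1)] piling_class_single_0
        by (simp add: f)
    qed
  qed
  then obtain k where k: "k \<in> hom (trickle_group G) piling_monoid"
    "k \<one>\<^bsub>trickle_group G\<^esub> = \<one>\<^bsub>piling_monoid\<^esub>"
    "\<And>w. w \<in> lists ?S \<Longrightarrow> k (group_class w) = eval_word piling_monoid f w"
    unfolding trickle_group_eq
    using presented_monoid_universal[OF monoid_presented_monoid f_closed group_rels_lists]
    by (metis (no_types, lifting))

  have k_gen: "k (?F (x, a)) = piling_class [single x a]" if x: "x \<in> verts G" for x a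
  proof -
    let ?g = "trickle_gen G x" and ?e = "\<lambda>a. piling_class [single x a]"
    note g = gen_closed[OF x] and e = single_closed[OF x]
    have k1: "k ?g = ?e 1" using k(3)[of "[Gen x]"] x e by (simp add: gen f)
    \<comment> \<open>The monoid of pilings is not known to be a group here, so an inverse is exhibited.\<close>
    have cancel: "p = q" if pq: "p \<in> carrier piling_monoid" "q \<in> carrier piling_monoid"
      "p \<otimes>\<^bsub>piling_monoid\<^esub> ?e 1 = q \<otimes>\<^bsub>piling_monoid\<^esub> ?e 1" for p q
    proof -
      have "r \<otimes>\<^bsub>piling_monoid\<^esub> ?e 1 \<otimes>\<^bsub>piling_monoid\<^esub> ?e (- 1) = r" if "r \<in> carrier piling_monoid" for r
        using that e piling_class_single_add[OF x, of 1 "- 1"] piling_class_single_0 by (simp add: P.m_assoc)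
      then show ?thesis using pq by metis
    qed
    have "(k (?g [^]\<^bsub>trickle_group G\<^esub> (i + 1)) = ?e (i + 1)) = (k (?g [^]\<^bsub>trickle_group G\<^esub> i) = ?e i)" for i :: int
    proof -
      have "k (?g [^]\<^bsub>trickle_group G\<^esub> (i + 1)) = k (?g [^]\<^bsub>trickle_group G\<^esub> i) \<otimes>\<^bsub>piling_monoid\<^esub> ?e 1"
        using g by (simp add: T.int_pow_mult hom_mult[OF k(1)] k1)
      moreover have "?e (i + 1) = ?e i \<otimes>\<^bsub>piling_monoid\<^esub> ?e 1"
        by (rule piling_class_single_add[OF x, symmetric])
      moreover have "k (?g [^]\<^bsub>trickle_group G\<^esub> i) \<in> carrier piling_monoid"
        using g by (intro hom_in_carrier[OF k(1)]) simp
      ultimately show ?thesis using cancel e by metis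
    qed
    then have "(k (?g [^]\<^bsub>trickle_group G\<^esub> a) = ?e a) = (k (?g [^]\<^bsub>trickle_group G\<^esub> (0 :: int)) = ?e 0)"
      by (rule int_shift_invariant)
    then show ?thesis using k(2) piling_class_single_0 by simp
  qed
  have k_omega: "k (omega G U) = piling_class [U]" if U: "U \<in> strata G" for U
  proof -
    obtain us where us: "numbering G U us" using numbering_exists[OF U] by blast
    then have set: "set us = U" by (simp add: numbering_iff)
    have "omega G U = eval_word (trickle_group G) ?F us"
      unfolding omega_eq by (rule stratum_prod_numbering[OF real U us])
    then have "k (omega G U) = eval_word piling_monoid (\<lambda>s. k (?F s)) us"
      using hom_eval_word[OF T.is_monoid k(1,2), of ?F us] realization_Pi[OF real U] set by simp
    also have "\<dots> = eval_word piling_monoid (\<lambda>s. piling_class [{s}]) us"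
    proof (rule eval_word_cong)
      fix s assume "s \<in> set us"
      obtain x a where s: "s = (x, a)" by (cases s)
      have xa: "(x, a) \<in> U" using \<open>s \<in> set us\<close> set s by simp
      then have "(x, a) \<in> syllables G" using strataD(2-4)[OF U xa] by (simp add: syllables_iff)
      then show "k (?F s) = piling_class [{s}]"
        using k_gen[OF strataD(2)[OF U xa], of a] single_syllable s by simp
    qed
    also have "\<dots> = piling_class [U]" by (rule piling_class_prod[OF U us])
    finally show ?thesis .
  qed
  have kh: "k (h X) = X" if "X \<in> carrier piling_monoid" for X
  proof -
    obtain w where w: "w \<in> lists (strata G)" "X = piling_class w"
      by (rule presented_monoid_carrierE[OF \<open>X \<in> carrier piling_monoid\<close>])
    have "omega G \<in> set w \<rightarrow> carrier (trickle_group G)" using w(1) omega_closed by auto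
    then have "k (h X) = eval_word piling_monoid (\<lambda>U. k (omega G U)) w"
      using h(3)[OF w(1)] hom_eval_word[OF T.is_monoid k(1,2)] w(2) by simp
    also have "\<dots> = eval_word piling_monoid (\<lambda>U. piling_class [U]) w"
      using w(1) k_omega by (intro eval_word_cong) auto
    also have "\<dots> = X" unfolding w(2) by (rule eval_word_class[OF w(1)])
    finally show ?thesis .
  qed
  have h_single: "h (piling_class [single x a]) = ?F (x, a)" if x: "x \<in> verts G" for x a
  proof -
    have S: "single x a \<in> strata G" by (rule single_strata[OF x])
    have "h (piling_class [single x a]) = omega G (single x a)"
      using h(3)[of "[single x a]"] S omega_closed[OF S] by simp
    also have "\<dots> = ?F (x, expo (single x a) x)"
    proof -
      have n: "numbering G (single x a) (if red G x a = 0 then [] else [(x, red G x a)])"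
        by (simp add: numbering_iff single_def)
      have F: "?F (x, b) \<in> carrier (trickle_group G)" for b by (rule realization_closed[OF real x])
      show ?thesis
        unfolding omega_eq stratum_prod_numbering[OF real S n]
        using F by (simp add: expo_single[OF x])
    qed
    also have "\<dots> = ?F (x, a)" unfolding expo_single[OF x] using realization_red[OF real x] by simp
    finally show ?thesis .
  qed
  have hk: "h (k X) = X" if "X \<in> carrier (trickle_group G)" for X
  proof -
    obtain w where w: "w \<in> lists ?S" "X = group_class w"
      by (rule presented_monoid_carrierE[OF \<open>X \<in> carrier (trickle_group G)\<close>[unfolded trickle_group_eq]])
    have hf: "h (f l) = group_class [l]" if "l \<in> ?S" for l
    proof -
      obtain x where x: "x \<in> verts G" "l = Gen x \<or> l = Inv x"
        using \<open>l \<in> ?S\<close> by (auto simp: signed_letters_def)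
      have g: "?F (x, 1) = group_class [Gen x]"
        using gen_closed[OF x(1)] by (simp add: gen)
      have i: "?F (x, - 1) = group_class [Inv x]"
      proof -
        have "group_class [Inv x, Gen x] = group_class []"
          using x(1) by (intro group_class_rel) (auto simp: cancel_rels_def)
        then have "group_class [Inv x] \<otimes>\<^bsub>trickle_group G\<^esub> trickle_gen G x = \<one>\<^bsub>trickle_group G\<^esub>"
          unfolding gen trickle_group_eq presented_monoid_one using x(1) by (simp add: presented_monoid_mult)
        moreover have "group_class [Inv x] \<in> carrier (trickle_group G)"
          unfolding trickle_group_eq using x(1) by (intro presented_monoid_class_closed) simp
        ultimately have "inv\<^bsub>trickle_group G\<^esub> trickle_gen G x = group_class [Inv x]"
          using gen_closed[OF x(1)] by (intro T.inv_equality)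
        then show ?thesis using gen_closed[OF x(1)] by (simp add: T.int_pow_neg)
      qed
      show ?thesis using x h_single[OF x(1)] g i f by metis
    qed
    have "f \<in> set w \<rightarrow> carrier piling_monoid" using w(1) f_closed by auto
    then have "h (k X) = eval_word (trickle_group G) (\<lambda>l. h (f l)) w"
      using k(3)[OF w(1)] hom_eval_word[OF P.monoid_axioms h(1,2)] w(2) by simp
    also have "\<dots> = eval_word (trickle_group G) (\<lambda>l. group_class [l]) w"
      using w(1) hf by (intro eval_word_cong) auto
    also have "\<dots> = X" unfolding w(2) trickle_group_eq by (rule eval_word_class[OF w(1)])
    finally show ?thesis .
  qed
  have "bij_betw h (carrier piling_monoid) (carrier (trickle_group G))"
    using kh hk hom_in_carrier[OF h(1)] hom_in_carrier[OF k(1)]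
    by (intro bij_betw_byWitness[where f' = k]) auto
  then have "h \<in> iso piling_monoid (trickle_group G)" using h(1) by (simp add: iso_def)
  moreover have "h (piling_class [U]) = omega G U" if "U \<in> strata G" for U
    using h(3)[of "[U]"] that omega_closed[OF that] by simp
  ultimately show ?thesis
    unfolding has_monoid_presentation_def using trickle_rewriting_lists by blast
qed

end

theorem theorem2p4:
  fixes G :: "'v trickle_data"
  assumes "trickle_graph G"
  shows "has_monoid_presentation (trickle_group G) (strata G) (omega G) (trickle_rewriting G)
    \<and> terminatingp (rewrite (strata G) (trickle_rewriting G))
    \<and> confluentp (rewrite (strata G) (trickle_rewriting G))"
proof -
  interpret trickle_graph G by (rule assms)
  show ?thesis
    using trickle_rewriting_presentation terminating_piling_step confluent_piling_step by blast
qed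

end
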